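(* Let $k$ be an algebraically closed field, let $A$ be a finitely generated associative unital $k$-algebra, and let $d \ge 1$. If $C$ is an irreducible component of ${\rm mod}_A^{d}(k)$, then $$C = \overline{C_1\oplus\dots\oplus C_t}$$ for some irreducible components $C_i$ of module varieties ${\rm mod}_A^{d_i}(k)$ (with $d_1+\dots+d_t=d$), with the property that the general module in each $C_i$ is indecomposable. Moreover $C_1,\dots,C_t$ are uniquely determined by this, up to reordering.
   Context: Modules are right $A$-modules. For $d\ge 1$, ${\rm mod}_A^d(k)$ is the set of $A$-module structures on $k^d$, equivalently the set of (unital) $k$-algebra homomorphisms $A \to {\rm M}_d(k)$ (the homomorphism $m$ gives the row space $k^d$ the right module structure $v\cdot a = v\,m(a)$). A homomorphism is determined by its values on a finite set of $N$ generators of $A$, and this embeds ${\rm mod}_A^d(k)$ as a Zariski closed subvariety of ${\rm M}_d(k)^N$; topological notions refer to the Zariski topology. The group ${\rm GL}_d(k)$ acts by conjugation, $(g\cdot m)(a) = g\,m(a)\,g^{-1}$, and orbits correspond to isomorphism classes of $d$-dimensional $A$-modules. If $C$ is a ${\rm GL}_d(k)$-stable subset, a $d$-dimensional module $M$ is said to be "in" $C$ if the corresponding orbit is contained in $C$. (Irreducible components are ${\rm GL}_d(k)$-stable.) Direct sums: given ${\rm GL}_{d_i}(k)$-stable subsets $C_i \subseteq {\rm mod}_A^{d_i}(k)$ ($1\le i\le t$) and $d=d_1+\dots+d_t$, the set $C_1\oplus\dots\oplus C_t$ is the ${\rm GL}_d(k)$-stable subset of ${\rm mod}_A^d(k)$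 corresponding to all modules isomorphic to $M_1\oplus\dots\oplus M_t$ with each $M_i$ in $C_i$. The bar denotes closure in ${\rm mod}_A^d(k)$. The general module in an irreducible component $C$ has a property if all modules in some dense open subset of $C$ have that property. *)

theory Defs
  imports
    "HOL-Analysis.Abstract_Topology"
    "HOL-Library.FuncSet"
    "HOL-Library.Multiset"
    "HOL-Computational_Algebra.Polynomial"
    "Jordan_Normal_Form.Matrix"
begin

section \<open>Finitely generated associative unital algebras\<close>

text \<open>The sort \<open>{ring, monoid_mult}\<close> is that of associative unital rings in which \<open>0 = 1\<close> is
  permitted (the class \<open>ring_1\<close> would exclude the zero algebra).\<close>

locale unital_algebra = vector_space scale
  for scale :: "'k :: field \<Rightarrow> 'a :: {ring, monoid_mult} \<Rightarrow> 'a" +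
  assumes scale_mult_left: "scale c x * y = scale c (x * y)"
    and scale_mult_right: "x * scale c y = scale c (x * y)"

inductive_set generated_subalgebra ::
  "('k \<Rightarrow> 'a \<Rightarrow> 'a) \<Rightarrow> 'a set \<Rightarrow> 'a :: {ring, monoid_mult} set"
  for scale :: "'k \<Rightarrow> 'a \<Rightarrow> 'a" and S :: "'a set"
where
  gen: "x \<in> S \<Longrightarrow> x \<in> generated_subalgebra scale S"
| one: "1 \<in> generated_subalgebra scale S"
| add: "x \<in> generated_subalgebra scale S \<Longrightarrow> y \<in> generated_subalgebra scale S \<Longrightarrow>
    x + y \<in> generated_subalgebra scale S"
| mult: "x \<in> generated_subalgebra scale S \<Longrightarrow> y \<in> generated_subalgebra scale S \<Longrightarrow>
    x * y \<in> generated_subalgebra scale S"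
| scale: "x \<in> generated_subalgebra scale S \<Longrightarrow> scale c x \<in> generated_subalgebra scale S"

locale fg_algebra = unital_algebra scale
  for scale :: "'k :: field \<Rightarrow> 'a :: {ring, monoid_mult} \<Rightarrow> 'a" +
  fixes gens :: "'a set"
  assumes finite_gens: "finite gens"
    and generated_gens: "generated_subalgebra scale gens = UNIV"


section \<open>The Zariski topology on affine space\<close>

text \<open>Affine space with coordinates indexed by \<open>I\<close> is \<open>I \<rightarrow>\<^sub>E UNIV\<close>; \<open>poly_fun I\<close> consists of the
  polynomial functions in the coordinates from \<open>I\<close>.\<close>

inductive_set poly_fun :: "'v set \<Rightarrow> (('v \<Rightarrow> 'k :: field) \<Rightarrow> 'k) set" for I :: "'v set"
where
  const: "(\<lambda>_. c) \<in> poly_fun I"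
| coord: "v \<in> I \<Longrightarrow> (\<lambda>x. x v) \<in> poly_fun I"
| add: "f \<in> poly_fun I \<Longrightarrow> g \<in> poly_fun I \<Longrightarrow> (\<lambda>x. f x + g x) \<in> poly_fun I"
| mult: "f \<in> poly_fun I \<Longrightarrow> g \<in> poly_fun I \<Longrightarrow> (\<lambda>x. f x * g x) \<in> poly_fun I"

definition zero_locus :: "'v set \<Rightarrow> (('v \<Rightarrow> 'k) \<Rightarrow> 'k) set \<Rightarrow> ('v \<Rightarrow> 'k :: field) set" where
  "zero_locus I F = {x \<in> I \<rightarrow>\<^sub>E UNIV. \<forall>f\<in>F. f x = 0}"

definition zariski :: "'v set \<Rightarrow> ('v \<Rightarrow> 'k :: field) topology" where
  "zariski I = topology (\<lambda>U. \<exists>F \<subseteq> poly_fun I. U = (I \<rightarrow>\<^sub>E UNIV) - zero_locus I F)"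

lemma istopology_zariski:
  "istopology (\<lambda>U :: ('v \<Rightarrow> 'k :: field) set.
     \<exists>F \<subseteq> poly_fun I. U = (I \<rightarrow>\<^sub>E UNIV) - zero_locus I F)"
  unfolding istopology_def
proof (intro conjI allI impI)
  fix S T :: "('v \<Rightarrow> 'k) set"
  assume "\<exists>F \<subseteq> poly_fun I. S = (I \<rightarrow>\<^sub>E UNIV) - zero_locus I F"
    and "\<exists>F \<subseteq> poly_fun I. T = (I \<rightarrow>\<^sub>E UNIV) - zero_locus I F"
  then obtain F G where F: "F \<subseteq> poly_fun I" "S = (I \<rightarrow>\<^sub>E UNIV) - zero_locus I F"
    and G: "G \<subseteq> poly_fun I" "T = (I \<rightarrow>\<^sub>E UNIV) - zero_locus I G"
    by blast
  define H where "H = (\<lambda>(f, g) x. f x * g x) ` (F \<times> G)"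
  have "H \<subseteq> poly_fun I"
    using F(1) G(1) by (auto simp: H_def intro!: poly_fun.mult)
  moreover have "S \<inter> T = (I \<rightarrow>\<^sub>E UNIV) - zero_locus I H"
    unfolding F(2) G(2) H_def zero_locus_def by auto
  ultimately show "\<exists>F \<subseteq> poly_fun I. S \<inter> T = (I \<rightarrow>\<^sub>E UNIV) - zero_locus I F" by blast
next
  fix K :: "('v \<Rightarrow> 'k) set set"
  assume "\<forall>S\<in>K. \<exists>F \<subseteq> poly_fun I. S = (I \<rightarrow>\<^sub>E UNIV) - zero_locus I F"
  then obtain F where F: "\<And>S. S \<in> K \<Longrightarrow> F S \<subseteq> poly_fun I"
    "\<And>S. S \<in> K \<Longrightarrow> S = (I \<rightarrow>\<^sub>E UNIV) - zero_locus I (F S)"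
    by metis
  have "\<Union> K = \<Union> ((\<lambda>S. S) ` K)" by simp
  also have "(\<lambda>S. S) ` K = (\<lambda>S. (I \<rightarrow>\<^sub>E UNIV) - zero_locus I (F S)) ` K"
    by (rule image_cong[OF refl F(2)])
  also have "\<Union> \<dots> = (I \<rightarrow>\<^sub>E UNIV) - zero_locus I (\<Union> (F ` K))"
    unfolding zero_locus_def by blast
  finally show "\<exists>F \<subseteq> poly_fun I. \<Union> K = (I \<rightarrow>\<^sub>E UNIV) - zero_locus I F"
    using F(1) by (intro exI[of _ "\<Union> (F ` K)"]) auto
qed

lemma openin_zariski:
  "openin (zariski I) U \<longleftrightarrow> (\<exists>F \<subseteq> poly_fun I. U = (I \<rightarrow>\<^sub>E UNIV) - zero_locus I F)"
  unfolding zariski_def topology_inverse'[OF istopology_zariski] ..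

lemma topspace_zariski: "topspace (zariski I :: ('v \<Rightarrow> 'k :: field) topology) = I \<rightarrow>\<^sub>E UNIV"
proof
  show "topspace (zariski I :: ('v \<Rightarrow> 'k) topology) \<subseteq> I \<rightarrow>\<^sub>E UNIV"
    unfolding topspace_def openin_zariski by blast
  have "openin (zariski I) ((I \<rightarrow>\<^sub>E UNIV) :: ('v \<Rightarrow> 'k) set)"
    unfolding openin_zariski
    by (rule exI[of _ "{\<lambda>_. 1}"]) (auto simp: zero_locus_def intro: poly_fun.const)
  then show "I \<rightarrow>\<^sub>E UNIV \<subseteq> topspace (zariski I :: ('v \<Rightarrow> 'k) topology)"
    by (rule openin_subset)
qed

lemma closedin_zariski:
  "closedin (zariski I) (Z :: ('v \<Rightarrow> 'k :: field) set) \<longleftrightarrow> (\<exists>F \<subseteq> poly_fun I. Z = zero_locus I F)"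
proof -
  have sub: "zero_locus I F \<subseteq> I \<rightarrow>\<^sub>E UNIV" for F :: "(('v \<Rightarrow> 'k) \<Rightarrow> 'k) set"
    unfolding zero_locus_def by (rule Collect_restrict)
  have "Z \<subseteq> A \<and> A - Z = A - L \<longleftrightarrow> Z = L" if "L \<subseteq> A" for A L
    using that by (metis double_diff order_refl)
  from this[OF sub] show ?thesis
    unfolding closedin_def topspace_zariski openin_zariski by metis
qed


section \<open>Irreducible components and general elements\<close>

definition irreducible_in :: "'x topology \<Rightarrow> 'x set \<Rightarrow> bool" where
  "irreducible_in X S \<longleftrightarrow> S \<subseteq> topspace X \<and> S \<noteq> {} \<and>
     (\<forall>Y Z. closedin X Y \<and> closedin X Z \<and> S \<subseteq> Y \<union> Z \<longrightarrow> S \<subseteq> Y \<or> S \<subseteq> Z)"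

definition irreducible_component :: "'x topology \<Rightarrow> 'x set \<Rightarrow> bool" where
  "irreducible_component X C \<longleftrightarrow>
     irreducible_in X C \<and> (\<forall>S. irreducible_in X S \<and> C \<subseteq> S \<longrightarrow> S = C)"

definition general_in :: "'x topology \<Rightarrow> 'x set \<Rightarrow> ('x \<Rightarrow> bool) \<Rightarrow> bool" where
  "general_in X C P \<longleftrightarrow>
     (\<exists>U. openin (subtopology X C) U \<and> Abstract_Topology.closure_of (subtopology X C) U = C \<and> (\<forall>x\<in>U. P x))"


section \<open>Module varieties\<close>

text \<open>A homomorphism \<open>m\<close> gives the row space \<open>k\<^sup>d\<close> the right module structure \<open>v \<cdot> a = v m(a)\<close>.\<close>

definition module_variety ::
  "('k :: field \<Rightarrow> 'a :: {ring, monoid_mult} \<Rightarrow> 'a) \<Rightarrow> nat \<Rightarrow> ('a \<Rightarrow> 'k mat) set" where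
  "module_variety scale d =
     {m. (\<forall>a. m a \<in> carrier_mat d d) \<and>
         m 1 = 1\<^sub>m d \<and>
         (\<forall>a b. m (a + b) = m a + m b) \<and>
         (\<forall>a b. m (a * b) = m a * m b) \<and>
         (\<forall>c a. m (scale c a) = c \<cdot>\<^sub>m m a)}"

text \<open>The values of \<open>m\<close> on the generators, as a point of the affine space \<open>M\<^sub>d(k)\<^sup>N\<close>, whose
  coordinates are indexed by a generator and a matrix position. On \<open>module_variety scale d\<close> this map
  is injective, so the pullback below is the subspace topology inherited from \<open>M\<^sub>d(k)\<^sup>N\<close>.\<close>

definition coord_index :: "'a set \<Rightarrow> nat \<Rightarrow> ('a \<times> nat \<times> nat) set" where
  "coord_index gens d = gens \<times> {..<d} \<times> {..<d}"

definition gen_values :: "'a set \<Rightarrow> nat \<Rightarrow> ('a \<Rightarrow> 'k mat) \<Rightarrow> ('a \<times> nat \<times> nat \<Rightarrow> 'k)" where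
  "gen_values gens d m = (\<lambda>(a, i, j) \<in> coord_index gens d. m a $$ (i, j))"

definition module_topology ::
  "('k :: field \<Rightarrow> 'a :: {ring, monoid_mult} \<Rightarrow> 'a) \<Rightarrow> 'a set \<Rightarrow> nat \<Rightarrow> ('a \<Rightarrow> 'k mat) topology"
where
  "module_topology scale gens d =
     pullback_topology (module_variety scale d) (gen_values gens d) (zariski (coord_index gens d))"

lemma topspace_module_topology:
  "topspace (module_topology scale gens d) = module_variety scale d"
  by (auto simp: module_topology_def topspace_pullback_topology topspace_zariski gen_values_def)

lemma gen_values_inj:
  fixes scale :: "'k :: field \<Rightarrow> 'a :: {ring, monoid_mult} \<Rightarrow> 'a"
  assumes "generated_subalgebra scale gens = UNIV"
  shows "inj_on (gen_values gens d) (module_variety scale d)"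
proof (rule inj_onI)
  fix m n :: "'a \<Rightarrow> 'k mat"
  assume m: "m \<in> module_variety scale d" and n: "n \<in> module_variety scale d"
    and eq: "gen_values gens d m = gen_values gens d n"
  have "m a = n a" if "a \<in> generated_subalgebra scale gens" for a
    using that
  proof induction
    case (gen a)
    have dims: "m a \<in> carrier_mat d d" "n a \<in> carrier_mat d d"
      using m n unfolding module_variety_def by blast+
    show ?case
    proof (rule eq_matI)
      fix i j assume "i < dim_row (n a)" "j < dim_col (n a)"
      then have "(a, i, j) \<in> coord_index gens d"
        using dims gen unfolding coord_index_def by simp
      then show "m a $$ (i, j) = n a $$ (i, j)"
        using fun_cong[OF eq, of "(a, i, j)"] by (simp add: gen_values_def)
    qed (use dims in simp_all)
  next
    case one
    show ?case using m n unfolding module_variety_def by (metis (mono_tags, lifting) mem_Collect_eq)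
  next
    case (add x y)
    then show ?case using m n unfolding module_variety_def by (metis (mono_tags, lifting) mem_Collect_eq)
  next
    case (mult x y)
    then show ?case using m n unfolding module_variety_def by (metis (mono_tags, lifting) mem_Collect_eq)
  next
    case (scale x c)
    then show ?case using m n unfolding module_variety_def by (metis (mono_tags, lifting) mem_Collect_eq)
  qed
  then show "m = n" using assms by (intro ext) (metis UNIV_I)
qed

definition conj_orbit :: "nat \<Rightarrow> ('a \<Rightarrow> 'k :: field mat) \<Rightarrow> ('a \<Rightarrow> 'k mat) set" where
  "conj_orbit d m =
     {\<lambda>a. g * m a * h | g h. g \<in> carrier_mat d d \<and> h \<in> carrier_mat d d \<and>
                             g * h = 1\<^sub>m d \<and> h * g = 1\<^sub>m d}"

definition direct_sum :: "('a \<Rightarrow> 'k :: zero mat) list \<Rightarrow> ('a \<Rightarrow> 'k mat)" where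
  "direct_sum ms = (\<lambda>a. diag_block_mat (map (\<lambda>m. m a) ms))"

text \<open>Since every nonzero finite-dimensional module is isomorphic to one on some \<open>k\<^sup>e\<close>, with
  \<open>e \<ge> 1\<close>, this says that the module is nonzero and is not isomorphic to a direct sum of two
  nonzero modules.\<close>

definition indecomposable ::
  "('k :: field \<Rightarrow> 'a :: {ring, monoid_mult} \<Rightarrow> 'a) \<Rightarrow> nat \<Rightarrow> ('a \<Rightarrow> 'k mat) \<Rightarrow> bool" where
  "indecomposable scale d m \<longleftrightarrow> d \<ge> 1 \<and>
     \<not> (\<exists>e f m1 m2. e \<ge> 1 \<and> f \<ge> 1 \<and> d = e + f \<and>
          m1 \<in> module_variety scale e \<and> m2 \<in> module_variety scale f \<and>
          m \<in> conj_orbit d (direct_sum [m1, m2]))"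

text \<open>A finite family of subsets \<open>C\<^sub>i\<close> of the module varieties of dimension \<open>d\<^sub>i\<close> is a list of pairs
  \<open>(d\<^sub>i, C\<^sub>i)\<close>. A \<open>d\<^sub>i\<close>-dimensional module is in \<open>C\<^sub>i\<close> if its whole orbit is contained in \<open>C\<^sub>i\<close>.\<close>

definition direct_sum_set ::
  "('k :: field \<Rightarrow> 'a :: {ring, monoid_mult} \<Rightarrow> 'a) \<Rightarrow> (nat \<times> ('a \<Rightarrow> 'k mat) set) list
     \<Rightarrow> ('a \<Rightarrow> 'k mat) set" where
  "direct_sum_set scale Cs =
     {m \<in> module_variety scale (sum_list (map fst Cs)).
        \<exists>ms. list_all2 (\<lambda>(e, D) n. n \<in> module_variety scale e \<and> conj_orbit e n \<subseteq> D) Cs ms \<and>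
             m \<in> conj_orbit (sum_list (map fst Cs)) (direct_sum ms)}"

definition generic_decomposition ::
  "('k :: field \<Rightarrow> 'a :: {ring, monoid_mult} \<Rightarrow> 'a) \<Rightarrow> 'a set \<Rightarrow> nat \<Rightarrow> ('a \<Rightarrow> 'k mat) set
     \<Rightarrow> (nat \<times> ('a \<Rightarrow> 'k mat) set) list \<Rightarrow> bool" where
  "generic_decomposition scale gens d C Cs \<longleftrightarrow>
     sum_list (map fst Cs) = d \<and>
     (\<forall>(e, D) \<in> set Cs. e \<ge> 1 \<and>
        irreducible_component (module_topology scale gens e) D \<and>
        general_in (module_topology scale gens e) D (indecomposable scale e)) \<and>
     C = Abstract_Topology.closure_of (module_topology scale gens d) (direct_sum_set scale Cs)"

end

theory Submission
  imports Defs "Jordan_Normal_Form.Determinant"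
begin

text \<open>Existence is by strong induction on \<open>d\<close>. The modules in \<open>C\<close> that decompose lie in the finitely many
  closures of sums \<open>E \<oplus> F\<close> of components of smaller module varieties. These closures are irreducible,
  since \<open>E \<oplus> F\<close> is the image of \<open>GL\<^sub>d \<times> E \<times> F\<close>. So either the general module in \<open>C\<close> is
  indecomposable, or \<open>C\<close> is contained in, hence equal to, one of them, and the decompositions of \<open>E\<close>
  and \<open>F\<close> can be concatenated.

  For uniqueness, take for each summand \<open>D\<close> of the first decomposition a dense open subset consisting of
  indecomposable modules that lie in no summand of the second one unless it contains \<open>D\<close>. The sums of
  such modules form a dense subset of \<open>C\<close>, which is constructible by Chevalley's theorem and so contains
  a nonempty open subset of \<open>C\<close>. The same holds for the second decomposition, so some module in \<open>C\<close> is a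
  sum of both kinds. The Krull--Remak--Schmidt theorem matches the summands, and matched components
  are equal by maximality.\<close>

hide_const (open) module.smult

section \<open>Polynomial functions\<close>

lemma poly_fun_sum:
  "(\<And>i. i \<in> A \<Longrightarrow> f i \<in> poly_fun I) \<Longrightarrow> (\<lambda>x. \<Sum>i\<in>A. f i x) \<in> poly_fun I"
  by (induction A rule: infinite_finite_induct) (auto intro: poly_fun.intros)

lemma poly_fun_uminus: "f \<in> poly_fun I \<Longrightarrow> (\<lambda>x. - f x) \<in> poly_fun I"
  using poly_fun.mult[OF poly_fun.const[of "- 1" I], of f] by simp

lemma poly_fun_diff:
  "f \<in> poly_fun I \<Longrightarrow> g \<in> poly_fun I \<Longrightarrow> (\<lambda>x. f x - g x) \<in> poly_fun I"
  using poly_fun.add[OF _ poly_fun_uminus, of f I g] by simp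

lemma poly_fun_cong:
  "f \<in> poly_fun I \<Longrightarrow> (\<And>i. i \<in> I \<Longrightarrow> x i = y i) \<Longrightarrow> f x = f y"
  by (induction rule: poly_fun.induct) auto

lemma poly_fun_subst:
  assumes "f \<in> poly_fun J" and "\<And>w. w \<in> J \<Longrightarrow> (\<lambda>x. \<phi> x w) \<in> poly_fun I"
  shows "(\<lambda>x. f (\<phi> x)) \<in> poly_fun I"
  using assms by (induction rule: poly_fun.induct) (auto intro: poly_fun.intros)

lemma poly_fun_mono: "f \<in> poly_fun I \<Longrightarrow> I \<subseteq> J \<Longrightarrow> f \<in> poly_fun J"
  using poly_fun_subst[of f I "\<lambda>x. x" J] by (auto intro: poly_fun.coord)

lemma poly_fun_empty: "f \<in> poly_fun {} \<Longrightarrow> \<exists>c. f = (\<lambda>_. c)"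
  by (induction rule: poly_fun.induct) auto

text \<open>A polynomial in one extra variable over the ring of polynomial functions is encoded pointwise in
  the parameter \<open>x\<close>; the bound \<open>n\<close> makes the degree uniform in \<open>x\<close>.\<close>

definition param_poly :: "'v set \<Rightarrow> nat \<Rightarrow> (('v \<Rightarrow> 'k :: field) \<Rightarrow> 'k poly) \<Rightarrow> bool" where
  "param_poly I n P \<longleftrightarrow> (\<forall>i. (\<lambda>x. coeff (P x) i) \<in> poly_fun I) \<and> (\<forall>x. \<forall>i\<ge>n. coeff (P x) i = 0)"

lemma param_poly_mono: "param_poly I m P \<Longrightarrow> m \<le> n \<Longrightarrow> param_poly I n P"
  by (auto simp: param_poly_def)

lemma param_poly_0: "param_poly I n (\<lambda>_. 0)"
  by (auto simp: param_poly_def intro: poly_fun.const)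

lemma param_poly_add:
  "param_poly I n P \<Longrightarrow> param_poly I n Q \<Longrightarrow> param_poly I n (\<lambda>x. P x + Q x)"
  by (auto simp: param_poly_def intro: poly_fun.add)

lemma param_poly_smult:
  "f \<in> poly_fun I \<Longrightarrow> param_poly I n P \<Longrightarrow> param_poly I n (\<lambda>x. smult (f x) (P x))"
  by (auto simp: param_poly_def intro: poly_fun.mult)

lemma param_poly_diff:
  "param_poly I n P \<Longrightarrow> param_poly I n Q \<Longrightarrow> param_poly I n (\<lambda>x. P x - Q x)"
  by (auto simp: param_poly_def intro: poly_fun_diff)

lemma param_poly_monom_mult:
  "param_poly I n P \<Longrightarrow> param_poly I (m + n) (\<lambda>x. monom 1 m * P x)"
proof -
  assume P: "param_poly I n P"
  have "(\<lambda>x. coeff (monom 1 m * P x) i) \<in> poly_fun I" for i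
    using P by (cases "i < m") (auto simp: param_poly_def coeff_monom_mult intro: poly_fun.const)
  then show ?thesis using P by (auto simp: param_poly_def coeff_monom_mult)
qed

lemma coeff_monom_diff_mult:
  "m \<le> n \<Longrightarrow> coeff (monom 1 (n - m) * p) n = coeff (p :: 'k :: field poly) m"
  by (subst coeff_monom_mult) auto

lemma param_poly_mult:
  assumes "param_poly I m P" "param_poly I n Q"
  shows "param_poly I (m + n) (\<lambda>x. P x * Q x)"
  unfolding param_poly_def
proof safe
  show "(\<lambda>x. coeff (P x * Q x) i) \<in> poly_fun I" for i
    unfolding coeff_mult
    using assms by (intro poly_fun_sum poly_fun.mult) (auto simp: param_poly_def)
  show "coeff (P x * Q x) i = 0" if "m + n \<le> i" for x i
    unfolding coeff_mult
  proof (rule sum.neutral, safe)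
    fix j assume "j \<le> i"
    have "m \<le> j \<or> n \<le> i - j" using that by arith
    then show "coeff (P x) j * coeff (Q x) (i - j) = 0"
      using assms unfolding param_poly_def by auto
  qed
qed

lemma param_poly_drop_lead:
  "param_poly I (Suc n) P \<Longrightarrow> (\<And>x. coeff (P x) n = 0) \<Longrightarrow> param_poly I n P"
  unfolding param_poly_def by (metis Suc_leI le_neq_implies_less)

lemma poly_fun_insert_param_poly:
  assumes "f \<in> poly_fun (insert v I)"
  shows "\<exists>n P. param_poly I n P \<and> f = (\<lambda>x. poly (P x) (x v))"
  using assms
proof induction
  case (const c)
  have "param_poly I 1 (\<lambda>_. [:c:])"
    by (auto simp: param_poly_def coeff_pCons split: nat.splits intro: poly_fun.const)
  then show ?case by (intro exI[of _ 1] exI[of _ "\<lambda>_. [:c:]"]) auto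
next
  case (coord w)
  show ?case
  proof (cases "w = v")
    case True
    have "param_poly I 2 (\<lambda>_. [:0, 1:])"
      by (auto simp: param_poly_def coeff_pCons split: nat.splits intro: poly_fun.const)
    then show ?thesis using True by (intro exI[of _ 2] exI[of _ "\<lambda>_. [:0, 1:]"]) auto
  next
    case False
    have "(\<lambda>x. coeff [:x w:] i) \<in> poly_fun I" for i
      using False coord by (cases i) (auto intro: poly_fun.intros)
    then have "param_poly I 1 (\<lambda>x. [:x w:])"
      by (auto simp: param_poly_def coeff_pCons split: nat.splits)
    then show ?thesis by (intro exI[of _ 1] exI[of _ "\<lambda>x. [:x w:]"]) auto
  qed
next
  case (add f g)
  then obtain m P n Q where P: "param_poly I m P" "f = (\<lambda>x. poly (P x) (x v))"
    and Q: "param_poly I n Q" "g = (\<lambda>x. poly (Q x) (x v))" by blast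
  have "param_poly I (max m n) (\<lambda>x. P x + Q x)"
    by (intro param_poly_add param_poly_mono[OF P(1)] param_poly_mono[OF Q(1)]) auto
  then show ?case unfolding P(2) Q(2)
    by (intro exI[of _ "max m n"] exI[of _ "\<lambda>x. P x + Q x"]) auto
next
  case (mult f g)
  then obtain m P n Q where P: "param_poly I m P" "f = (\<lambda>x. poly (P x) (x v))"
    and Q: "param_poly I n Q" "g = (\<lambda>x. poly (Q x) (x v))" by blast
  from param_poly_mult[OF P(1) Q(1)] show ?case unfolding P(2) Q(2)
    by (intro exI[of _ "m + n"] exI[of _ "\<lambda>x. P x * Q x"]) auto
qed

section \<open>The Hilbert basis theorem\<close>

inductive_set poly_ideal :: "'v set \<Rightarrow> (('v \<Rightarrow> 'k) \<Rightarrow> 'k) set \<Rightarrow> (('v \<Rightarrow> 'k :: field) \<Rightarrow> 'k) set"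
  for I S where
  zero: "(\<lambda>_. 0) \<in> poly_ideal I S"
| base: "f \<in> S \<Longrightarrow> f \<in> poly_ideal I S"
| add: "f \<in> poly_ideal I S \<Longrightarrow> g \<in> poly_ideal I S \<Longrightarrow> (\<lambda>x. f x + g x) \<in> poly_ideal I S"
| mult: "r \<in> poly_fun I \<Longrightarrow> f \<in> poly_ideal I S \<Longrightarrow> (\<lambda>x. r x * f x) \<in> poly_ideal I S"

lemma poly_ideal_diff:
  assumes "f \<in> poly_ideal I S" "g \<in> poly_ideal I S"
  shows "(\<lambda>x. f x - g x) \<in> poly_ideal I S"
  using poly_ideal.add[OF assms(1) poly_ideal.mult[OF poly_fun.const[of "- 1"] assms(2)]] by simp

lemma poly_ideal_least:
  assumes "f \<in> poly_ideal I S" "S \<subseteq> poly_ideal I T"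
  shows "f \<in> poly_ideal I T"
  using assms by induction (auto intro: poly_ideal.intros)

lemma poly_ideal_mono: "S \<subseteq> T \<Longrightarrow> poly_ideal I S \<subseteq> poly_ideal I T"
  using poly_ideal_least[of _ I S T] by (auto intro: poly_ideal.base)

lemma poly_ideal_finite:
  assumes "f \<in> poly_ideal I S"
  shows "\<exists>F \<subseteq> S. finite F \<and> f \<in> poly_ideal I F"
  using assms
proof induction
  case zero
  then show ?case by (intro exI[of _ "{}"]) (auto intro: poly_ideal.zero)
next
  case (base f)
  then show ?case by (intro exI[of _ "{f}"]) (auto intro: poly_ideal.base)
next
  case (add f g)
  then obtain F G where *: "F \<subseteq> S" "finite F" "f \<in> poly_ideal I F"
    "G \<subseteq> S" "finite G" "g \<in> poly_ideal I G" by blast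
  then have "f \<in> poly_ideal I (F \<union> G)" "g \<in> poly_ideal I (F \<union> G)"
    using poly_ideal_mono[of F "F \<union> G" I] poly_ideal_mono[of G "F \<union> G" I] by auto
  with * show ?case by (intro exI[of _ "F \<union> G"]) (auto intro: poly_ideal.add)
next
  case (mult r f)
  then obtain F where "F \<subseteq> S" "finite F" "f \<in> poly_ideal I F" by blast
  with mult(1) show ?case by (intro exI[of _ F]) (auto intro: poly_ideal.mult)
qed

lemma poly_ideal_vanish: "f \<in> poly_ideal I S \<Longrightarrow> (\<And>g. g \<in> S \<Longrightarrow> g x = 0) \<Longrightarrow> f x = 0"
  by (induction rule: poly_ideal.induct) auto

definition poly_noetherian :: "'v set \<Rightarrow> 'k :: field itself \<Rightarrow> bool" where
  "poly_noetherian I _ \<longleftrightarrow>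
     (\<forall>S \<subseteq> (poly_fun I :: (('v \<Rightarrow> 'k) \<Rightarrow> 'k) set). \<exists>F \<subseteq> S. finite F \<and> S \<subseteq> poly_ideal I F)"

lemma poly_noetherian_empty: "poly_noetherian ({} :: 'v set) TYPE('k :: field)"
  unfolding poly_noetherian_def
proof (intro allI impI)
  fix S :: "(('v \<Rightarrow> 'k) \<Rightarrow> 'k) set" assume S: "S \<subseteq> poly_fun {}"
  show "\<exists>F \<subseteq> S. finite F \<and> S \<subseteq> poly_ideal {} F"
  proof (cases "S \<subseteq> {\<lambda>_. 0}")
    case True
    then show ?thesis by (intro exI[of _ "{}"]) (auto intro: poly_ideal.zero)
  next
    case False
    then obtain c where c: "(\<lambda>_. c) \<in> S" "c \<noteq> 0" using S poly_fun_empty by blast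
    have "f \<in> poly_ideal {} {\<lambda>_. c}" if f: "f \<in> S" for f
    proof -
      obtain b where b: "f = (\<lambda>_. b)" using f S poly_fun_empty[of f] by blast
      show ?thesis
        using poly_ideal.mult[OF poly_fun.const[of "b / c"] poly_ideal.base[of "\<lambda>_. c" "{\<lambda>_. c}"]] c(2)
        by (simp add: b)
    qed
    with c show ?thesis by (intro exI[of _ "{\<lambda>_. c}"]) auto
  qed
qed

lemma poly_noetherian_insert:
  fixes I :: "'v set"
  assumes I: "poly_noetherian I TYPE('k :: field)"
  shows "poly_noetherian (insert v I) TYPE('k)"
  unfolding poly_noetherian_def
proof (intro allI impI)
  fix S :: "(('v \<Rightarrow> 'k) \<Rightarrow> 'k) set" assume S: "S \<subseteq> poly_fun (insert v I)"
  define J where "J = poly_ideal (insert v I) S"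
  define ev where "ev P x = poly (P x) (x v)" for P :: "('v \<Rightarrow> 'k) \<Rightarrow> 'k poly" and x
  \<comment> \<open>leading coefficients of the elements of \<open>J\<close> of degree at most \<open>n\<close>\<close>
  define L where "L n = {\<lambda>x. coeff (P x) n | P. param_poly I (Suc n) P \<and> ev P \<in> J}" for n
  have L_poly: "L n \<subseteq> poly_fun I" for n by (auto simp: L_def param_poly_def)
  have ev_shift: "ev (\<lambda>x. monom 1 k * P x) = (\<lambda>x. x v ^ k * ev P x)" for k P
    by (auto simp: ev_def poly_monom)
  have pw: "(\<lambda>x. x v ^ k) \<in> poly_fun (insert v I)" for k
    by (induction k) (auto intro: poly_fun.intros)
  have L_mono: "L m \<subseteq> L n" if "m \<le> n" for m n
  proof
    fix c assume "c \<in> L m"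
    then obtain P where P: "c = (\<lambda>x. coeff (P x) m)" "param_poly I (Suc m) P" "ev P \<in> J"
      by (auto simp: L_def)
    have "param_poly I (Suc n) (\<lambda>x. monom 1 (n - m) * P x)"
      using param_poly_monom_mult[OF P(2), of "n - m"] that by simp
    moreover have "ev (\<lambda>x. monom 1 (n - m) * P x) \<in> J"
      unfolding ev_shift using P(3) unfolding J_def by (rule poly_ideal.mult[OF pw])
    moreover have "c = (\<lambda>x. coeff (monom 1 (n - m) * P x) n)"
      using that by (simp add: P(1) coeff_monom_diff_mult)
    ultimately show "c \<in> L n" unfolding L_def by (intro CollectI exI conjI)
  qed
  have fg: "\<exists>F \<subseteq> T. finite F \<and> T \<subseteq> poly_ideal I F" if "T \<subseteq> poly_fun I"
    for T :: "(('v \<Rightarrow> 'k) \<Rightarrow> 'k) set"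
    using I that unfolding poly_noetherian_def by simp
  have "\<forall>n. \<exists>F. F \<subseteq> L n \<and> finite F \<and> L n \<subseteq> poly_ideal I F"
    using fg[OF L_poly] by simp
  from choice[OF this] obtain F where
    F: "\<And>n. F n \<subseteq> L n" "\<And>n. finite (F n)" "\<And>n. L n \<subseteq> poly_ideal I (F n)" by auto
  have "(\<Union>n. L n) \<subseteq> poly_fun I" using L_poly by blast
  then obtain F' where F': "F' \<subseteq> (\<Union>n. L n)" "finite F'" "(\<Union>n. L n) \<subseteq> poly_ideal I F'"
    using fg[of "\<Union>n. L n"] by auto
  have "\<exists>N. F' \<subseteq> L N"
    using F'(2,1)
  proof induction
    case empty
    then show ?case by simp
  next
    case (insert c G)
    then obtain N n where "G \<subseteq> L N" "c \<in> L n" by auto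
    then have "insert c G \<subseteq> L (max n N)"
      using L_mono[of N "max n N"] L_mono[of n "max n N"] by auto
    then show ?case by blast
  qed
  then obtain N where N: "F' \<subseteq> L N" by blast
  define E where "E n = (if n < N then F n else F')" for n
  have E: "E n \<subseteq> L n" "finite (E n)" "L n \<subseteq> poly_ideal I (E n)" for n
    using F[of n] F' N L_mono[of N n] unfolding E_def by (auto simp: subset_iff)
  have "\<forall>n. \<forall>c\<in>E n. \<exists>P. c = (\<lambda>x. coeff (P x) n) \<and> param_poly I (Suc n) P \<and> ev P \<in> J"
    using E(1) unfolding L_def by auto
  then have *: "\<exists>P. c = (\<lambda>x. coeff (P x) n) \<and> param_poly I (Suc n) P \<and> ev P \<in> J"
    if "c \<in> E n" for n c using that by blast
  define P where "P n c = (SOME P. c = (\<lambda>x. coeff (P x) n) \<and> param_poly I (Suc n) P \<and> ev P \<in> J)" for n c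
  have P: "c = (\<lambda>x. coeff (P n c x) n)" "param_poly I (Suc n) (P n c)" "ev (P n c) \<in> J"
    if "c \<in> E n" for n c
    using someI_ex[OF *[OF that]] unfolding P_def by blast+
  define G where "G = (\<Union>n\<le>N. (\<lambda>c. ev (P n c)) ` E n)"
  have GJ: "G \<subseteq> J" using P(3) by (auto simp: G_def)
  have finG: "finite G" using E(2) by (auto simp: G_def)
  have lead: "\<exists>Q. param_poly I (Suc n) Q \<and> c = (\<lambda>x. coeff (Q x) n) \<and>
      ev Q \<in> poly_ideal (insert v I) G"
    if "c \<in> poly_ideal I (E m)" "m \<le> n" "m \<le> N" for c m n
    using that(1)
  proof induction
    case zero
    then show ?case
      by (intro exI[of _ "\<lambda>_. 0"]) (auto simp: ev_def param_poly_0 intro: poly_ideal.zero)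
  next
    case (base c)
    have "param_poly I (Suc n) (\<lambda>x. monom 1 (n - m) * P m c x)"
      using param_poly_monom_mult[OF P(2)[OF base], of "n - m"] that by simp
    moreover have "c = (\<lambda>x. coeff (monom 1 (n - m) * P m c x) n)"
      using that by (subst P(1)[OF base]) (simp add: coeff_monom_diff_mult)
    moreover have "ev (P m c) \<in> G" using that(3) base by (auto simp: G_def)
    then have "ev (\<lambda>x. monom 1 (n - m) * P m c x) \<in> poly_ideal (insert v I) G"
      unfolding ev_shift by (intro poly_ideal.mult[OF pw] poly_ideal.base)
    ultimately show ?case by (intro exI conjI)
  next
    case (add f g)
    then obtain A B where A: "param_poly I (Suc n) A" "f = (\<lambda>x. coeff (A x) n)"
        "ev A \<in> poly_ideal (insert v I) G"
      and B: "param_poly I (Suc n) B" "g = (\<lambda>x. coeff (B x) n)"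
        "ev B \<in> poly_ideal (insert v I) G" by blast
    have "ev (\<lambda>x. A x + B x) = (\<lambda>x. ev A x + ev B x)" by (auto simp: ev_def)
    with poly_ideal.add[OF A(3) B(3)]
    have "ev (\<lambda>x. A x + B x) \<in> poly_ideal (insert v I) G" by simp
    then show ?case
      by (intro exI[of _ "\<lambda>x. A x + B x"] conjI param_poly_add A(1) B(1)) (simp_all add: A(2) B(2))
  next
    case (mult r f)
    then obtain A where A: "param_poly I (Suc n) A" "f = (\<lambda>x. coeff (A x) n)"
        "ev A \<in> poly_ideal (insert v I) G" by blast
    have "ev (\<lambda>x. smult (r x) (A x)) = (\<lambda>x. r x * ev A x)" by (auto simp: ev_def)
    moreover have "r \<in> poly_fun (insert v I)" using mult(1) by (rule poly_fun_mono) auto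
    ultimately have "ev (\<lambda>x. smult (r x) (A x)) \<in> poly_ideal (insert v I) G"
      using poly_ideal.mult[OF _ A(3), of r] by simp
    then show ?case
      by (intro exI[of _ "\<lambda>x. smult (r x) (A x)"] conjI param_poly_smult A(1) mult(1))
        (simp_all add: A(2))
  qed
  have gen: "ev Q \<in> poly_ideal (insert v I) G" if "param_poly I n Q" "ev Q \<in> J" for n Q
    using that
  proof (induction n arbitrary: Q)
    case 0
    then have "Q x = 0" for x by (simp add: param_poly_def poly_eq_iff)
    then have "ev Q = (\<lambda>_. 0)" by (simp add: ev_def fun_eq_iff)
    then show ?case by (simp add: poly_ideal.zero)
  next
    case (Suc n)
    define m where "m = min n N"
    have "(\<lambda>x. coeff (Q x) n) \<in> L n" using Suc.prems by (auto simp: L_def)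
    also have "L n \<subseteq> poly_ideal I (E n)" by (rule E)
    also have "E n = E m" unfolding E_def m_def by simp
    finally have "(\<lambda>x. coeff (Q x) n) \<in> poly_ideal I (E m)" .
    from lead[OF this, of n] obtain R where R: "param_poly I (Suc n) R"
      "(\<lambda>x. coeff (Q x) n) = (\<lambda>x. coeff (R x) n)" "ev R \<in> poly_ideal (insert v I) G"
      unfolding m_def by (meson min.cobounded1 min.cobounded2)
    have evd: "ev (\<lambda>x. Q x - R x) = (\<lambda>x. ev Q x - ev R x)" by (auto simp: ev_def)
    have "ev R \<in> J" using R(3) GJ unfolding J_def by (rule poly_ideal_least)
    with Suc.prems(2) have "ev (\<lambda>x. Q x - R x) \<in> J"
      unfolding evd J_def by (rule poly_ideal_diff)
    moreover have "param_poly I n (\<lambda>x. Q x - R x)"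
    proof (rule param_poly_drop_lead)
      show "coeff (Q x - R x) n = 0" for x using fun_cong[OF R(2), of x] by simp
    qed (rule param_poly_diff[OF Suc.prems(1) R(1)])
    ultimately have "ev (\<lambda>x. Q x - R x) \<in> poly_ideal (insert v I) G" by (rule Suc.IH[rotated])
    from poly_ideal.add[OF this R(3)] show ?case unfolding evd by simp
  qed
  have JG: "S \<subseteq> poly_ideal (insert v I) G"
  proof
    fix f assume f: "f \<in> S"
    then obtain n Q where "param_poly I n Q" "f = ev Q"
      using S poly_fun_insert_param_poly[of f v I] unfolding ev_def by blast
    moreover have "f \<in> J" using f by (auto simp: J_def intro: poly_ideal.base)
    ultimately show "f \<in> poly_ideal (insert v I) G" using gen by auto
  qed
  have "\<exists>T \<subseteq> S. finite T \<and> G \<subseteq> poly_ideal (insert v I) T"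
    using finG GJ
  proof induction
    case empty
    then show ?case by auto
  next
    case (insert g G)
    then obtain T where T: "T \<subseteq> S" "finite T" "G \<subseteq> poly_ideal (insert v I) T" by blast
    have "g \<in> poly_ideal (insert v I) S" using insert by (auto simp: J_def)
    then obtain T' where T': "T' \<subseteq> S" "finite T'" "g \<in> poly_ideal (insert v I) T'"
      using poly_ideal_finite by blast
    show ?case
      using T T' poly_ideal_mono[of T "T \<union> T'" "insert v I"] poly_ideal_mono[of T' "T \<union> T'" "insert v I"]
      by (intro exI[of _ "T \<union> T'"]) auto
  qed
  then obtain T where T: "T \<subseteq> S" "finite T" "G \<subseteq> poly_ideal (insert v I) T" by blast
  with JG have "S \<subseteq> poly_ideal (insert v I) T" using poly_ideal_least by blast
  with T show "\<exists>F \<subseteq> S. finite F \<and> S \<subseteq> poly_ideal (insert v I) F" by blast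
qed

theorem hilbert_basis: "finite I \<Longrightarrow> poly_noetherian I TYPE('k :: field)"
  by (induction rule: finite_induct) (simp_all add: poly_noetherian_empty poly_noetherian_insert)

corollary finite_equations:
  fixes F :: "(('v \<Rightarrow> 'k :: field) \<Rightarrow> 'k) set"
  assumes "finite I" "F \<subseteq> poly_fun I"
  obtains F0 where "F0 \<subseteq> F" "finite F0" "\<And>x. (\<forall>f\<in>F. f x = 0) \<longleftrightarrow> (\<forall>f\<in>F0. f x = 0)"
proof -
  obtain F0 where F0: "F0 \<subseteq> F" "finite F0" "F \<subseteq> poly_ideal I F0"
    using hilbert_basis[OF assms(1), where 'k = 'k, unfolded poly_noetherian_def, rule_format, OF assms(2)]
    by auto
  have "f x = 0" if "\<forall>g\<in>F0. g x = 0" "f \<in> F" for f x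
    using F0(3) that poly_ideal_vanish[of f I F0 x] by auto
  then have "(\<forall>f\<in>F. f x = 0) \<longleftrightarrow> (\<forall>f\<in>F0. f x = 0)" for x
    using F0(1) by auto
  from that[OF F0(1,2) this] show thesis .
qed

section \<open>Elimination of quantifiers\<close>

inductive constructible :: "'v set \<Rightarrow> (('v \<Rightarrow> 'k :: field) \<Rightarrow> bool) \<Rightarrow> bool" for I where
  zero: "f \<in> poly_fun I \<Longrightarrow> constructible I (\<lambda>x. f x = 0)"
| neg: "constructible I P \<Longrightarrow> constructible I (\<lambda>x. \<not> P x)"
| conj: "constructible I P \<Longrightarrow> constructible I Q \<Longrightarrow> constructible I (\<lambda>x. P x \<and> Q x)"

lemma constructible_disj:
  assumes "constructible I P" "constructible I Q"
  shows "constructible I (\<lambda>x. P x \<or> Q x)"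
proof -
  have "constructible I (\<lambda>x. \<not> (\<not> P x \<and> \<not> Q x))"
    using assms by (intro constructible.neg constructible.conj)
  then show ?thesis by simp
qed

lemma constructible_const: "constructible I (\<lambda>_. b)"
proof (cases b)
  case True
  then show ?thesis using constructible.zero[OF poly_fun.const[of 0 I]] by simp
next
  case False
  then show ?thesis using constructible.zero[OF poly_fun.const[of 1 I]] by simp
qed

lemma constructible_ball:
  "finite A \<Longrightarrow> (\<And>a. a \<in> A \<Longrightarrow> constructible I (P a)) \<Longrightarrow> constructible I (\<lambda>x. \<forall>a\<in>A. P a x)"
  by (induction rule: finite_induct) (simp_all add: constructible_const constructible.conj)

lemma constructible_bex:
  "finite A \<Longrightarrow> (\<And>a. a \<in> A \<Longrightarrow> constructible I (P a)) \<Longrightarrow> constructible I (\<lambda>x. \<exists>a\<in>A. P a x)"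
  by (induction rule: finite_induct) (simp_all add: constructible_const constructible_disj)

lemma constructible_eq:
  assumes "f \<in> poly_fun I" "g \<in> poly_fun I"
  shows "constructible I (\<lambda>x. f x = g x)"
  using constructible.zero[OF poly_fun_diff[OF assms]] by simp

lemma constructible_neq0:
  "f \<in> poly_fun I \<Longrightarrow> constructible I (\<lambda>x. f x \<noteq> 0)"
  by (intro constructible.neg constructible.zero)

lemma constructible_subst:
  assumes "constructible J P" and \<phi>: "\<And>w. w \<in> J \<Longrightarrow> (\<lambda>x. \<phi> x w) \<in> poly_fun I"
  shows "constructible I (\<lambda>x. P (\<phi> x))"
  using assms(1)
proof induction
  case (zero f)
  from constructible.zero[OF poly_fun_subst[OF zero \<phi>]] show ?case .
qed (auto intro: constructible.intros)

lemma constructible_cong_on: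
  "constructible I P \<Longrightarrow> (\<And>i. i \<in> I \<Longrightarrow> x i = y i) \<Longrightarrow> P x = P y"
proof (induction rule: constructible.induct)
  case (zero f)
  then show ?case using poly_fun_cong[of f I x y] by simp
qed auto

definition dnf :: "'v set \<Rightarrow> (('v \<Rightarrow> 'k :: field) \<Rightarrow> bool) \<Rightarrow> bool" where
  "dnf I P \<longleftrightarrow> (\<exists>L. finite L \<and>
     (\<forall>(F, g)\<in>L. finite F \<and> F \<subseteq> poly_fun I \<and> g \<in> poly_fun I) \<and>
     (\<forall>x. P x \<longleftrightarrow> (\<exists>(F, g)\<in>L. (\<forall>f\<in>F. f x = 0) \<and> g x \<noteq> 0)))"

lemma dnfI:
  assumes "finite L" "\<And>F g. (F, g) \<in> L \<Longrightarrow> finite F \<and> F \<subseteq> poly_fun I \<and> g \<in> poly_fun I"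
    "\<And>x. P x \<longleftrightarrow> (\<exists>(F, g)\<in>L. (\<forall>f\<in>F. f x = 0) \<and> g x \<noteq> 0)"
  shows "dnf I P"
  unfolding dnf_def
proof (intro exI conjI)
  show "\<forall>(F, g)\<in>L. finite F \<and> F \<subseteq> poly_fun I \<and> g \<in> poly_fun I" using assms(2) by fast
qed (use assms(1,3) in simp_all)

lemma dnf_disj:
  assumes "dnf I P" "dnf I Q"
  shows "dnf I (\<lambda>x. P x \<or> Q x)"
proof -
  obtain L where L: "finite L" "\<forall>(F, g)\<in>L. finite F \<and> F \<subseteq> poly_fun I \<and> g \<in> poly_fun I"
    "\<forall>x. P x \<longleftrightarrow> (\<exists>(F, g)\<in>L. (\<forall>f\<in>F. f x = 0) \<and> g x \<noteq> 0)"
    using assms(1) unfolding dnf_def by (elim exE conjE)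
  obtain M where M: "finite M" "\<forall>(F, g)\<in>M. finite F \<and> F \<subseteq> poly_fun I \<and> g \<in> poly_fun I"
    "\<forall>x. Q x \<longleftrightarrow> (\<exists>(F, g)\<in>M. (\<forall>f\<in>F. f x = 0) \<and> g x \<noteq> 0)"
    using assms(2) unfolding dnf_def by (elim exE conjE)
  show ?thesis
  proof (rule dnfI[of "L \<union> M"])
    show "P x \<or> Q x \<longleftrightarrow> (\<exists>(F, g)\<in>L \<union> M. (\<forall>f\<in>F. f x = 0) \<and> g x \<noteq> 0)" for x
      unfolding bex_Un L(3)[rule_format] M(3)[rule_format] ..
  qed (use L(1,2) M(1,2) in \<open>fast | simp\<close>)+
qed

lemma dnf_conj:
  assumes "dnf I P" "dnf I Q"
  shows "dnf I (\<lambda>x. P x \<and> Q x)"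
proof -
  obtain L where L: "finite L" "\<forall>(F, g)\<in>L. finite F \<and> F \<subseteq> poly_fun I \<and> g \<in> poly_fun I"
    "\<forall>x. P x \<longleftrightarrow> (\<exists>(F, g)\<in>L. (\<forall>f\<in>F. f x = 0) \<and> g x \<noteq> 0)"
    using assms(1) unfolding dnf_def by (elim exE conjE)
  obtain M where M: "finite M" "\<forall>(F, g)\<in>M. finite F \<and> F \<subseteq> poly_fun I \<and> g \<in> poly_fun I"
    "\<forall>x. Q x \<longleftrightarrow> (\<exists>(F, g)\<in>M. (\<forall>f\<in>F. f x = 0) \<and> g x \<noteq> 0)"
    using assms(2) unfolding dnf_def by (elim exE conjE)
  define N where "N = (\<Union>a\<in>L. (\<lambda>b. (fst a \<union> fst b, \<lambda>x. snd a x * snd b x)) ` M)"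
  show ?thesis
  proof (rule dnfI[of N])
    show "finite F \<and> F \<subseteq> poly_fun I \<and> g \<in> poly_fun I" if N: "(F, g) \<in> N" for F g
    proof -
      from N obtain a b where ab: "a \<in> L" "b \<in> M" "(F, g) = (fst a \<union> fst b, \<lambda>x. snd a x * snd b x)"
        unfolding N_def by (elim UN_E imageE)
      have "finite (fst a) \<and> fst a \<subseteq> poly_fun I \<and> snd a \<in> poly_fun I"
        using bspec[OF L(2) ab(1)] by (simp add: split_beta)
      moreover have "finite (fst b) \<and> fst b \<subseteq> poly_fun I \<and> snd b \<in> poly_fun I"
        using bspec[OF M(2) ab(2)] by (simp add: split_beta)
      moreover have "F = fst a \<union> fst b" "g = (\<lambda>x. snd a x * snd b x)" using ab(3) by (simp_all only: prod.inject)
      ultimately show ?thesis by (simp only:) (intro conjI poly_fun.mult; simp)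
    qed
    show "P x \<and> Q x \<longleftrightarrow> (\<exists>(F, g)\<in>N. (\<forall>f\<in>F. f x = 0) \<and> g x \<noteq> 0)" for x
      unfolding L(3)[rule_format] M(3)[rule_format] N_def by (simp add: ball_Un split_beta) blast
    show "finite N" using L(1) M(1) by (auto simp: N_def)
  qed
qed

lemma constructible_dnf:
  "constructible I P \<Longrightarrow> dnf I P \<and> dnf I (\<lambda>x. \<not> P x)"
proof (induction rule: constructible.induct)
  case (zero f)
  have "dnf I (\<lambda>x. f x = 0)"
    by (rule dnfI[of "{({f}, \<lambda>_. 1)}"]) (use zero in \<open>auto intro: poly_fun.const\<close>)
  moreover have "dnf I (\<lambda>x. f x \<noteq> 0)"
    by (rule dnfI[of "{({}, f)}"]) (use zero in auto)
  ultimately show ?case by simp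
next
  case (neg P)
  then show ?case by simp
next
  case (conj P Q)
  then show ?case using dnf_conj[of I P Q] dnf_disj[of I "\<lambda>x. \<not> P x" "\<lambda>x. \<not> Q x"] by simp
qed

lemma param_poly_eq_0_iff:
  "param_poly I n P \<Longrightarrow> P x = 0 \<longleftrightarrow> (\<forall>i\<in>{..<n}. coeff (P x) i = 0)"
  unfolding param_poly_def by (metis leading_coeff_0_iff lessThan_iff not_le coeff_0)

lemma param_poly_degree: "param_poly I (Suc n) P \<Longrightarrow> coeff (P x) n \<noteq> 0 \<Longrightarrow> degree (P x) = n"
  unfolding param_poly_def by (metis Suc_leI le_degree le_neq_implies_less leading_coeff_0_iff degree_0 coeff_0)

lemma param_poly_coeff: "param_poly I n P \<Longrightarrow> (\<lambda>x. coeff (P x) i) \<in> poly_fun I"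
  by (simp add: param_poly_def)

lemma param_poly_sub_lead:
  assumes "param_poly I (Suc n) P"
  shows "param_poly I n (\<lambda>x. P x - monom (coeff (P x) n) n)"
proof -
  have "(\<lambda>x. coeff (P x - monom (coeff (P x) n) n) i) \<in> poly_fun I" for i
    using param_poly_coeff[OF assms] poly_fun.const[of 0 I] by (cases "i = n") simp_all
  then show ?thesis using assms by (auto simp: param_poly_def le_Suc_eq)
qed

lemma param_poly_pseudo_rem:
  assumes P: "param_poly I (Suc n) P" and R: "param_poly I (Suc m) R" and "n \<le> m"
  shows "param_poly I m (\<lambda>x. smult (coeff (P x) n) (R x) - smult (coeff (R x) m) (monom 1 (m - n) * P x))"
proof (rule param_poly_drop_lead)
  have "param_poly I (Suc m) (\<lambda>x. monom 1 (m - n) * P x)"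
    using param_poly_monom_mult[OF P, of "m - n"] assms(3) by simp
  then show "param_poly I (Suc m) (\<lambda>x. smult (coeff (P x) n) (R x) - smult (coeff (R x) m) (monom 1 (m - n) * P x))"
    by (intro param_poly_diff param_poly_smult param_poly_coeff[OF P] param_poly_coeff[OF R] R)
qed (simp add: coeff_monom_diff_mult[OF assms(3)])

lemma constructible_dvd:
  assumes P: "param_poly I (Suc n) P" and "param_poly I m R"
  shows "constructible I (\<lambda>x. coeff (P x) n \<noteq> 0 \<and> P x dvd R x)"
  using assms(2)
proof (induction m arbitrary: R)
  case 0
  then have "R x = 0" for x using param_poly_eq_0_iff[OF 0] by simp
  then show ?case using constructible_neq0[OF param_poly_coeff[OF P]] by simp
next
  case (Suc m)
  show ?case
  proof (cases "n \<le> m")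
    case True
    define R' where "R' x = smult (coeff (P x) n) (R x) - smult (coeff (R x) m) (monom 1 (m - n) * P x)" for x
    have "param_poly I m R'" unfolding R'_def by (rule param_poly_pseudo_rem[OF P Suc.prems True])
    from Suc.IH[OF this] have "constructible I (\<lambda>x. coeff (P x) n \<noteq> 0 \<and> P x dvd R' x)" .
    moreover have eq: "P x dvd R' x \<longleftrightarrow> P x dvd R x" if "coeff (P x) n \<noteq> 0" for x
    proof -
      have "P x dvd smult (coeff (R x) m) (monom 1 (m - n) * P x)"
        by (intro dvd_smult) simp
      moreover have "smult (coeff (P x) n) (R x) =
          R' x + smult (coeff (R x) m) (monom 1 (m - n) * P x)" by (simp add: R'_def)
      ultimately have "P x dvd R' x \<longleftrightarrow> P x dvd smult (coeff (P x) n) (R x)"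
        by (simp only: dvd_add_left_iff)
      then show ?thesis using that by (simp add: dvd_smult_iff)
    qed
    moreover have "(\<lambda>x. coeff (P x) n \<noteq> 0 \<and> P x dvd R' x) = (\<lambda>x. coeff (P x) n \<noteq> 0 \<and> P x dvd R x)"
      using eq by blast
    ultimately show ?thesis by simp
  next
    case False
    have "P x dvd R x \<longleftrightarrow> R x = 0" if "coeff (P x) n \<noteq> 0" for x
    proof
      assume div: "P x dvd R x"
      show "R x = 0"
      proof (rule ccontr)
        assume nz: "R x \<noteq> 0"
        have "n \<le> degree (R x)"
          using dvd_imp_degree_le[OF div nz] param_poly_degree[of I n P x, OF P that] by simp
        then have "coeff (R x) (degree (R x)) = 0"
          using Suc.prems False unfolding param_poly_def by auto
        with nz show False by simp
      qed
    qed auto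
    note dvd_iff = this
    have "P x dvd R x \<longleftrightarrow> (\<forall>i\<in>{..<Suc m}. coeff (R x) i = 0)" if "coeff (P x) n \<noteq> 0" for x
      unfolding dvd_iff[OF that] by (rule param_poly_eq_0_iff[OF Suc.prems])
    then have eq: "(\<lambda>x. coeff (P x) n \<noteq> 0 \<and> P x dvd R x) =
        (\<lambda>x. coeff (P x) n \<noteq> 0 \<and> (\<forall>i\<in>{..<Suc m}. coeff (R x) i = 0))"
      by (intro ext conj_cong refl)
    have "constructible I (\<lambda>x. \<forall>i\<in>{..<Suc m}. coeff (R x) i = 0)"
      by (rule constructible_ball[OF finite_lessThan]) (rule constructible.zero[OF param_poly_coeff[OF Suc.prems]])
    then show ?thesis unfolding eq
      by (rule constructible.conj[OF constructible_neq0[OF param_poly_coeff[OF P]]])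
  qed
qed

lemma infinite_alg_closed: "infinite (UNIV :: 'k :: alg_closed_field set)"
proof
  assume fin: "finite (UNIV :: 'k set)"
  define p where "p = (\<Prod>a\<in>UNIV. [:- a, 1:]) + (1 :: 'k poly)"
  have "poly p x = 1" for x using fin by (simp add: p_def poly_prod)
  moreover have "degree (\<Prod>a\<in>(UNIV :: 'k set). [:- a, 1:]) = card (UNIV :: 'k set)"
    by (subst degree_prod_eq_sum_degree) auto
  then have "degree p > 0"
    unfolding p_def using fin by (subst degree_add_eq_left) (auto simp: card_gt_0_iff)
  then have "\<exists>x. poly p x = 0" by (rule alg_closed_imp_poly_has_root)
  ultimately show False by simp
qed

lemma alg_closed_dvd_power_iff:
  fixes p q :: "'k :: alg_closed_field poly"
  assumes "p \<noteq> 0" "degree p = n"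
  shows "p dvd q ^ n \<longleftrightarrow> (\<forall>c. poly p c = 0 \<longrightarrow> poly q c = 0)"
proof safe
  fix c assume dvd: "p dvd q ^ n" and c: "poly p c = 0"
  have "poly (q ^ n) c = 0" using dvd c by (meson poly_eq_0_iff_dvd dvd_trans)
  then show "poly q c = 0" by (simp add: poly_power)
next
  assume "\<forall>c. poly p c = 0 \<longrightarrow> poly q c = 0"
  with assms show "p dvd q ^ n"
  proof (induction n arbitrary: p)
    case 0
    then show ?case by (simp add: is_unit_iff_degree)
  next
    case (Suc n)
    then obtain c where c: "poly p c = 0"
      using alg_closed_imp_poly_has_root[of p] by auto
    then obtain r where r: "p = [:- c, 1:] * r" by (auto simp: poly_eq_0_iff_dvd elim: dvdE)
    have "r \<noteq> 0" using r Suc.prems(1) by auto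
    moreover have "degree r = n" using Suc.prems(2) \<open>r \<noteq> 0\<close> unfolding r by (subst (asm) degree_mult_eq) auto
    ultimately have "r dvd q ^ n" using Suc.prems(3) by (intro Suc.IH) (auto simp: r)
    moreover have "[:- c, 1:] dvd q" using Suc.prems(3) c by (simp add: poly_eq_0_iff_dvd)
    ultimately show ?case unfolding r power_Suc by (rule mult_dvd_mono[rotated])
  qed
qed

lemma alg_closed_ex_nonzero:
  fixes q :: "'k :: alg_closed_field poly"
  shows "(\<exists>c. poly q c \<noteq> 0) \<longleftrightarrow> q \<noteq> 0"
proof
  assume "q \<noteq> 0"
  then have "finite {c. poly q c = 0}" by (rule poly_roots_finite)
  then have "{c. poly q c = 0} \<noteq> UNIV" using infinite_alg_closed by metis
  then show "\<exists>c. poly q c \<noteq> 0" by blast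
qed auto

lemma constructible_ex_common_root:
  fixes Q :: "('v \<Rightarrow> 'k :: alg_closed_field) \<Rightarrow> 'k poly"
  assumes "\<And>n P. (n, P) \<in> set Ps \<Longrightarrow> param_poly I n P" and Q: "param_poly I m Q"
  shows "constructible I (\<lambda>x. \<exists>c. (\<forall>(n, P)\<in>set Ps. poly (P x) c = 0) \<and> poly (Q x) c \<noteq> 0)"
  using assms(1)
proof (induction "sum_list (map (Suc \<circ> fst) Ps)" arbitrary: Ps rule: less_induct)
  case less
  define E where "E Ps x \<longleftrightarrow> (\<exists>c. (\<forall>(n, P)\<in>set Ps. poly (P x) c = 0) \<and> poly (Q x) c \<noteq> 0)"
    for Ps :: "(nat \<times> (('v \<Rightarrow> 'k) \<Rightarrow> 'k poly)) list" and x
  have IH: "constructible I (E Rs)"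
    if "sum_list (map (Suc \<circ> fst) Rs) < sum_list (map (Suc \<circ> fst) Ps)"
      "\<And>n P. (n, P) \<in> set Rs \<Longrightarrow> param_poly I n P" for Rs
    using less.hyps[OF that] unfolding E_def .
  have perm: "constructible I (E Ps')"
    if "mset Ps' = mset Ps" "Ps' = (Suc n1, P1) # (Suc n2, P2) # Rs" "n1 \<le> n2" for Ps' n1 n2 P1 P2 Rs
  proof -
    have sum: "sum_list (map (Suc \<circ> fst) Ps) = Suc (Suc n1) + (Suc (Suc n2) + sum_list (map (Suc \<circ> fst) Rs))"
      using arg_cong[OF that(1), of "\<lambda>M. sum_mset (image_mset (Suc \<circ> fst) M)"]
      unfolding mset_map[symmetric] sum_mset_sum_list that(2) by simp
    have "set Ps' = set Ps" using that(1) by (rule mset_eq_setD)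
    then have "param_poly I n P" if "(n, P) \<in> set Ps'" for n P
      using less.prems that by blast
    then have P1: "param_poly I (Suc n1) P1" and P2: "param_poly I (Suc n2) P2"
      and Rs: "\<And>n P. (n, P) \<in> set Rs \<Longrightarrow> param_poly I n P" using that(2) by auto
    define A where "A = (n1, \<lambda>x. P1 x - monom (coeff (P1 x) n1) n1) # (Suc n2, P2) # Rs"
    define B where "B = (Suc n1, P1) #
      (n2, \<lambda>x. smult (coeff (P1 x) n1) (P2 x) - smult (coeff (P2 x) n2) (monom 1 (n2 - n1) * P1 x)) # Rs"
    have A: "constructible I (E A)"
    proof (rule IH)
      show "param_poly I n P" if "(n, P) \<in> set A" for n P
        using that P2 Rs param_poly_sub_lead[OF P1] unfolding A_def by fastforce
    qed (simp add: A_def sum)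
    have B: "constructible I (E B)"
    proof (rule IH)
      show "param_poly I n P" if "(n, P) \<in> set B" for n P
        using that P1 Rs param_poly_pseudo_rem[OF P1 P2 \<open>n1 \<le> n2\<close>] unfolding B_def by fastforce
    qed (simp add: B_def sum)
    have EA: "E Ps' x = E A x" if "coeff (P1 x) n1 = 0" for x
      unfolding E_def A_def \<open>Ps' = _\<close> using that by simp
    have EB: "E Ps' x = E B x" if "coeff (P1 x) n1 \<noteq> 0" for x
    proof -
      have "poly (P1 x) c = 0 \<and> poly (P2 x) c = 0 \<longleftrightarrow> poly (P1 x) c = 0 \<and>
        poly (smult (coeff (P1 x) n1) (P2 x) - smult (coeff (P2 x) n2) (monom 1 (n2 - n1) * P1 x)) c = 0" for c
        using that by auto
      then show ?thesis unfolding E_def B_def \<open>Ps' = _\<close> by simp metis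
    qed
    have "E Ps' = (\<lambda>x. (coeff (P1 x) n1 = 0 \<and> E A x) \<or> (coeff (P1 x) n1 \<noteq> 0 \<and> E B x))"
      using EA EB by blast
    then show ?thesis
      using A B constructible.zero[OF param_poly_coeff[OF P1, of n1]]
      by (simp add: constructible.conj constructible.neg constructible_disj)
  qed
  have "constructible I (E Ps)"
  proof (cases "\<exists>P. (0, P) \<in> set Ps")
    case True
    then obtain P xs ys where Ps: "Ps = xs @ (0, P) # ys" by (meson split_list)
    have P: "P x = 0" for x
      using less.prems[of 0 P] param_poly_eq_0_iff[of I 0 P x] by (auto simp: Ps)
    have "E Ps = E (xs @ ys)" by (auto simp: E_def Ps P fun_eq_iff)
    moreover have "constructible I (E (xs @ ys))"
      using less.prems by (intro IH) (auto simp: Ps)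
    ultimately show ?thesis by simp
  next
    case False
    then have pos: "n > 0" if "(n, P) \<in> set Ps" for n P using that by (cases n) auto
    consider "Ps = []" | n P where "Ps = [(Suc n, P)]"
      | n1 P1 n2 P2 Rs where "Ps = (Suc n1, P1) # (Suc n2, P2) # Rs"
    proof (cases Ps)
      case (Cons a Rs)
      obtain n P where a: "a = (Suc n, P)" using pos[of "fst a" "snd a"] Cons by (cases a) (auto elim: lessE simp: gr0_conv_Suc)
      show thesis
      proof (cases Rs)
        case (Cons b Rs')
        obtain m R where b: "b = (Suc m, R)" using pos[of "fst b" "snd b"] Cons \<open>Ps = _\<close>
          by (cases b) (auto simp: gr0_conv_Suc)
        show thesis using that(3) a b Cons \<open>Ps = _\<close> by simp
      qed (use that(2) a Cons in simp)
    qed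
    then show ?thesis
    proof cases
      case 1
      have "E Ps = (\<lambda>x. \<exists>i\<in>{..<m}. coeff (Q x) i \<noteq> 0)"
        using param_poly_eq_0_iff[OF Q] by (auto simp: E_def 1 alg_closed_ex_nonzero fun_eq_iff)
      then show ?thesis
        using Q by (auto intro!: constructible_bex constructible_neq0 param_poly_coeff)
    next
      case (2 n P)
      have P: "param_poly I (Suc n) P" using less.prems 2 by simp
      define A where "A = [(n, \<lambda>x. P x - monom (coeff (P x) n) n)]"
      have A: "constructible I (E A)"
        using param_poly_sub_lead[OF P] by (intro IH) (auto simp: A_def 2)
      have "param_poly I (k * m + 1) (\<lambda>x. Q x ^ k)" for k
      proof (induction k)
        case 0
        have "param_poly I 1 (\<lambda>_. 1)"
          by (auto simp: param_poly_def intro: poly_fun.const)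
        then show ?case by simp
      next
        case (Suc k)
        from param_poly_mult[OF Q this] show ?case by (simp add: add_ac)
      qed
      from constructible_dvd[OF P this[of n]]
      have B: "constructible I (\<lambda>x. coeff (P x) n \<noteq> 0 \<and> P x dvd Q x ^ n)" by simp
      have "E Ps x \<longleftrightarrow> \<not> P x dvd Q x ^ n" if "coeff (P x) n \<noteq> 0" for x
      proof -
        have "P x \<noteq> 0" using that by (metis coeff_0)
        from alg_closed_dvd_power_iff[OF this param_poly_degree[OF P that]] show ?thesis
          by (auto simp: E_def 2)
      qed
      moreover have "E Ps x = E A x" if "coeff (P x) n = 0" for x
        unfolding E_def A_def 2 using that by simp
      ultimately have "E Ps = (\<lambda>x. (coeff (P x) n = 0 \<and> E A x) \<or>
         (coeff (P x) n \<noteq> 0 \<and> \<not> (coeff (P x) n \<noteq> 0 \<and> P x dvd Q x ^ n)))"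
        by blast
      note eq = this
      have C: "constructible I (\<lambda>x. coeff (P x) n = 0)"
        by (rule constructible.zero[OF param_poly_coeff[OF P]])
      show ?thesis unfolding eq
        by (rule constructible_disj[OF constructible.conj[OF C A]
              constructible.conj[OF constructible.neg[OF C] constructible.neg[OF B]]])
    next
      case (3 n1 P1 n2 P2 Rs)
      show ?thesis
      proof (cases "n1 \<le> n2")
        case True
        then show ?thesis using perm[OF refl 3] by simp
      next
        case False
        have "constructible I (E ((Suc n2, P2) # (Suc n1, P1) # Rs))"
          using False by (intro perm[OF _ refl]) (auto simp: 3)
        moreover have "E ((Suc n2, P2) # (Suc n1, P1) # Rs) = E Ps"
          by (auto simp: E_def 3 fun_eq_iff)
        ultimately show ?thesis by simp
      qed
    qed
  qed
  then show ?case unfolding E_def .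
qed

lemma constructible_ex1:
  fixes P :: "('v \<Rightarrow> 'k :: alg_closed_field) \<Rightarrow> bool"
  assumes "constructible (insert v I) P" "v \<notin> I"
  shows "constructible I (\<lambda>x. \<exists>c. P (x(v := c)))"
proof -
  from constructible_dnf[OF assms(1)] have "dnf (insert v I) P" ..
  then obtain L where L: "finite L"
    "\<forall>(F, g)\<in>L. finite F \<and> F \<subseteq> poly_fun (insert v I) \<and> g \<in> poly_fun (insert v I)"
    "\<forall>x. P x \<longleftrightarrow> (\<exists>(F, g)\<in>L. (\<forall>f\<in>F. f x = 0) \<and> g x \<noteq> 0)"
    unfolding dnf_def by (elim exE conjE)
  have upd: "\<exists>n R. param_poly I n R \<and> (\<forall>x c. f (x(v := c)) = poly (R x) c)"
    if f: "f \<in> poly_fun (insert v I)" for f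
  proof -
    obtain n R where R: "param_poly I n R" "f = (\<lambda>x. poly (R x) (x v))"
      using poly_fun_insert_param_poly[OF f] by blast
    have "R (x(v := c)) = R x" for x c
    proof (rule poly_eqI)
      show "coeff (R (x(v := c))) i = coeff (R x) i" for i
        using assms(2) by (intro poly_fun_cong[OF param_poly_coeff[OF R(1)]]) auto
    qed
    with R show ?thesis by auto
  qed
  have "constructible I (\<lambda>x. \<exists>c. (\<forall>f\<in>F. f (x(v := c)) = 0) \<and> g (x(v := c)) \<noteq> 0)"
    if "(F, g) \<in> L" for F g
  proof -
    from bspec[OF L(2) that] have F: "finite F" "F \<subseteq> poly_fun (insert v I)" and g: "g \<in> poly_fun (insert v I)"
      by auto
    have "\<forall>f\<in>F. \<exists>nR. param_poly I (fst nR) (snd nR) \<and> (\<forall>x c. f (x(v := c)) = poly (snd nR x) c)"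
      using upd F(2) by fastforce
    from bchoice[OF this] obtain h where
      h: "\<And>f. f \<in> F \<Longrightarrow> param_poly I (fst (h f)) (snd (h f))"
      "\<And>f x c. f \<in> F \<Longrightarrow> f (x(v := c)) = poly (snd (h f) x) c" by blast
    obtain m Q where Q: "param_poly I m Q" "\<And>x c. g (x(v := c)) = poly (Q x) c" using upd[OF g] by blast
    obtain fs where fs: "set fs = F" using F(1) finite_list by blast
    have "constructible I (\<lambda>x. \<exists>c. (\<forall>(n, P)\<in>set (map h fs). poly (P x) c = 0) \<and> poly (Q x) c \<noteq> 0)"
    proof (rule constructible_ex_common_root[OF _ Q(1)])
      fix n P assume "(n, P) \<in> set (map h fs)"
      then obtain f where "f \<in> F" "h f = (n, P)" by (auto simp: fs)
      then show "param_poly I n P" using h(1)[of f] by simp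
    qed
    moreover have "(\<forall>f\<in>F. f (x(v := c)) = 0) \<longleftrightarrow> (\<forall>(n, P)\<in>set (map h fs). poly (P x) c = 0)" for x c
      using h(2) by (simp add: fs split_beta)
    ultimately show ?thesis by (simp only: Q(2))
  qed
  then have "constructible I (\<lambda>x. \<exists>Fg\<in>L. \<exists>c. (\<forall>f\<in>fst Fg. f (x(v := c)) = 0) \<and> snd Fg (x(v := c)) \<noteq> 0)"
    by (intro constructible_bex L(1)) auto
  moreover have "(\<exists>c. P (x(v := c))) \<longleftrightarrow>
      (\<exists>Fg\<in>L. \<exists>c. (\<forall>f\<in>fst Fg. f (x(v := c)) = 0) \<and> snd Fg (x(v := c)) \<noteq> 0)" for x
    unfolding L(3)[rule_format] case_prod_unfold by blast
  ultimately show ?thesis by simp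
qed

lemma constructible_ex:
  fixes P :: "('v \<Rightarrow> 'k :: alg_closed_field) \<Rightarrow> bool"
  assumes "finite J" "constructible (I \<union> J) P" "I \<inter> J = {}"
  shows "constructible I (\<lambda>x. \<exists>y. P (\<lambda>i. if i \<in> J then y i else x i))"
  using assms
proof (induction J arbitrary: P)
  case empty
  then show ?case by simp
next
  case (insert v J)
  have "constructible (insert v (I \<union> J)) P" using insert.prems by simp
  moreover have "v \<notin> I \<union> J" "I \<inter> J = {}" using insert.hyps(2) insert.prems(2) by auto
  ultimately have "constructible I (\<lambda>x. \<exists>y c. P ((\<lambda>i. if i \<in> J then y i else x i)(v := c)))"
    by (intro insert.IH[OF constructible_ex1])
  moreover have "(\<exists>y c. P ((\<lambda>i. if i \<in> J then y i else x i)(v := c))) \<longleftrightarrow>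
      (\<exists>y. P (\<lambda>i. if i \<in> insert v J then y i else x i))" for x
  proof safe
    fix y c assume "P ((\<lambda>i. if i \<in> J then y i else x i)(v := c))"
    moreover have "(\<lambda>i. if i \<in> J then y i else x i)(v := c) = (\<lambda>i. if i \<in> insert v J then (y(v := c)) i else x i)"
      using insert.hyps by auto
    ultimately show "\<exists>y. P (\<lambda>i. if i \<in> insert v J then y i else x i)"
      by (intro exI[of _ "y(v := c)"]) (simp only:)
  next
    fix y assume P: "P (\<lambda>i. if i \<in> insert v J then y i else x i)"
    have "(\<lambda>i. if i \<in> insert v J then y i else x i) = ((\<lambda>i. if i \<in> J then y i else x i)(v := y v))"
      by auto
    with P show "\<exists>y c. P ((\<lambda>i. if i \<in> J then y i else x i)(v := c))"
      by (intro exI[of _ y] exI[of _ "y v"]) (simp only:)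
  qed
  ultimately show ?case by simp
qed

theorem chevalley_image:
  fixes \<phi> :: "('w \<Rightarrow> 'k :: alg_closed_field) \<Rightarrow> 'v \<Rightarrow> 'k"
  assumes fin: "finite I" "finite J" and P: "constructible J P"
    and \<phi>: "\<And>i. i \<in> I \<Longrightarrow> (\<lambda>y. \<phi> y i) \<in> poly_fun J"
  shows "constructible I (\<lambda>x. \<exists>y. P y \<and> (\<forall>i\<in>I. x i = \<phi> y i))"
proof -
  define G where "G u \<longleftrightarrow> P (u \<circ> Inr) \<and> (\<forall>i\<in>I. u (Inl i) = \<phi> (u \<circ> Inr) i)"
    for u :: "'v + 'w \<Rightarrow> 'k"
  have inr: "(\<lambda>u. (u \<circ> Inr) w) \<in> poly_fun (Inl ` I \<union> Inr ` J)" if "w \<in> J" for w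
    using poly_fun.coord[of "Inr w" "Inl ` I \<union> Inr ` J"] that by auto
  have "constructible (Inl ` I \<union> Inr ` J) G"
    unfolding G_def
    by (intro constructible.conj constructible_ball fin constructible_eq constructible_subst[OF P inr]
        poly_fun_subst[OF \<phi> inr] poly_fun.coord) auto
  from constructible_ex[OF _ this] fin
  have "constructible (Inl ` I) (\<lambda>x. \<exists>y. G (\<lambda>i. if i \<in> Inr ` J then y i else x i))" by auto
  then have "constructible I (\<lambda>x. \<exists>y. G (\<lambda>i. if i \<in> Inr ` J then y i else case_sum x (\<lambda>_. 0) i))"
  proof (rule constructible_subst)
    show "(\<lambda>x. case_sum x (\<lambda>_. 0) w) \<in> poly_fun I" if "w \<in> Inl ` I" for w :: "'v + 'w"
      using that by (auto intro: poly_fun.coord)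
  qed
  moreover have "(\<exists>y. G (\<lambda>i. if i \<in> Inr ` J then y i else case_sum x (\<lambda>_. 0) i)) \<longleftrightarrow>
      (\<exists>y. P y \<and> (\<forall>i\<in>I. x i = \<phi> y i))" (is "?L \<longleftrightarrow> ?R") for x :: "'v \<Rightarrow> 'k"
  proof -
    define u where "u y = (\<lambda>i. if i \<in> Inr ` J then y i else case_sum x (\<lambda>_. 0) i)" for y
    have G: "G (u y) \<longleftrightarrow> P z \<and> (\<forall>i\<in>I. x i = \<phi> z i)" if "\<And>w. w \<in> J \<Longrightarrow> y (Inr w) = z w" for y z
    proof -
      have "P (u y \<circ> Inr) = P z"
        by (rule constructible_cong_on[OF P]) (auto simp: u_def that)
      moreover have "\<phi> (u y \<circ> Inr) i = \<phi> z i" if "i \<in> I" for i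
        by (rule poly_fun_cong[OF \<phi>[OF that]]) (auto simp: u_def \<open>\<And>w. w \<in> J \<Longrightarrow> y (Inr w) = z w\<close>)
      moreover have "u y (Inl i) = x i" for i by (auto simp: u_def)
      ultimately show ?thesis by (simp add: G_def)
    qed
    have "?L \<longleftrightarrow> (\<exists>y. G (u y))" by (simp add: u_def)
    also have "\<dots> \<longleftrightarrow> ?R"
    proof
      assume "\<exists>y. G (u y)"
      then obtain y where "G (u y)" ..
      then show ?R using G[of y "y \<circ> Inr"] by (intro exI[of _ "y \<circ> Inr"]) simp
    next
      assume ?R
      then obtain y where "P y \<and> (\<forall>i\<in>I. x i = \<phi> y i)" ..
      then show "\<exists>y. G (u y)"
        using G[of "case_sum (\<lambda>_. 0) y" y] by (intro exI[of _ "case_sum (\<lambda>_. 0) y"]) simp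
    qed
    finally show ?thesis .
  qed
  ultimately show ?thesis by simp
qed

section \<open>Matrix algebra\<close>

text \<open>Versions of the matrix laws whose side conditions do not introduce new variables, so that the
  simplifier can discharge them.\<close>

lemma mult_mat_assoc_dim:
  "dim_col A = dim_row B \<Longrightarrow> dim_col B = dim_row C \<Longrightarrow> A * B * C = A * (B * C :: 'k :: semiring_0 mat)"
  by (rule assoc_mult_mat[of A "dim_row A" "dim_col A" B "dim_col B" C "dim_col C"]) (auto intro: carrier_matI)

lemma mult_mat_add_dim:
  "dim_col A = dim_row B \<Longrightarrow> dim_row B = dim_row C \<Longrightarrow> dim_col B = dim_col C \<Longrightarrow>
    A * (B + C) = A * B + (A * C :: 'k :: semiring_0 mat)"
  by (rule mult_add_distrib_mat[of A "dim_row A" "dim_col A" B "dim_col B" C]) (auto intro: carrier_matI)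

lemma add_mat_mult_dim:
  "dim_col B = dim_row A \<Longrightarrow> dim_row B = dim_row C \<Longrightarrow> dim_col B = dim_col C \<Longrightarrow>
    (B + C) * A = B * A + (C * A :: 'k :: semiring_0 mat)"
  by (rule add_mult_distrib_mat[of B "dim_row B" "dim_col B" C A "dim_col A"]) (auto intro: carrier_matI)

lemma mult_mat_minus_dim:
  "dim_col A = dim_row B \<Longrightarrow> dim_row B = dim_row C \<Longrightarrow> dim_col B = dim_col C \<Longrightarrow>
    A * (B - C) = A * B - (A * C :: 'k :: ring mat)"
  by (rule mult_minus_distrib_mat[of A "dim_row A" "dim_col A" B "dim_col B" C]) (auto intro: carrier_matI)

lemma minus_mat_mult_dim:
  "dim_col B = dim_row A \<Longrightarrow> dim_row B = dim_row C \<Longrightarrow> dim_col B = dim_col C \<Longrightarrow>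
    (B - C) * A = B * A - (C * A :: 'k :: ring mat)"
  by (rule minus_mult_distrib_mat[of B "dim_row B" "dim_col B" C A "dim_col A"]) (auto intro: carrier_matI)

lemma one_mat_mult_dim: "dim_row A = n \<Longrightarrow> 1\<^sub>m n * A = (A :: 'k :: semiring_1 mat)"
  by (rule left_mult_one_mat[of A n "dim_col A"]) (auto intro: carrier_matI)

lemma mult_one_mat_dim: "dim_col A = n \<Longrightarrow> A * 1\<^sub>m n = (A :: 'k :: semiring_1 mat)"
  by (rule right_mult_one_mat[of A "dim_row A" n]) (auto intro: carrier_matI)

lemma zero_mat_mult_dim: "dim_row A = n \<Longrightarrow> 0\<^sub>m r n * A = (0\<^sub>m r (dim_col A) :: 'k :: semiring_0 mat)"
  by (rule left_mult_zero_mat[of A n "dim_col A"]) (auto intro: carrier_matI)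

lemma mult_zero_mat_dim: "dim_col A = n \<Longrightarrow> A * 0\<^sub>m n c = (0\<^sub>m (dim_row A) c :: 'k :: semiring_0 mat)"
  by (rule right_mult_zero_mat[of A "dim_row A" n]) (auto intro: carrier_matI)

lemma minus_zero_mat_dim: "dim_row A = r \<Longrightarrow> dim_col A = c \<Longrightarrow> A - 0\<^sub>m r c = (A :: 'k :: ring mat)"
  by (intro eq_matI) auto

lemma minus_self_mat: "dim_row A = r \<Longrightarrow> dim_col A = c \<Longrightarrow> A - A = (0\<^sub>m r c :: 'k :: ring mat)"
  by (intro eq_matI) auto

lemma plus_zero_mat_dim: "dim_row A = r \<Longrightarrow> dim_col A = c \<Longrightarrow> A + 0\<^sub>m r c = (A :: 'k :: ring mat)"
  by (intro eq_matI) auto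

lemma zero_plus_mat_dim: "dim_row A = r \<Longrightarrow> dim_col A = c \<Longrightarrow> 0\<^sub>m r c + A = (A :: 'k :: ring mat)"
  by (intro eq_matI) auto

lemma minus_eq_imp_eq_mat:
  "A - B = 0\<^sub>m r c \<Longrightarrow> A \<in> carrier_mat r c \<Longrightarrow> B \<in> carrier_mat r c \<Longrightarrow> A = (B :: 'k :: ring mat)"
proof (rule eq_matI)
  fix i j assume *: "A - B = 0\<^sub>m r c" "A \<in> carrier_mat r c" "B \<in> carrier_mat r c" "i < dim_row B" "j < dim_col B"
  then have "(A - B) $$ (i, j) = 0" by simp
  then show "A $$ (i, j) = B $$ (i, j)" using *(2-5) by simp
qed auto

lemmas mat_dim_rules =
  mult_mat_assoc_dim mult_mat_add_dim add_mat_mult_dim mult_mat_minus_dim minus_mat_mult_dim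
  one_mat_mult_dim mult_one_mat_dim zero_mat_mult_dim mult_zero_mat_dim minus_zero_mat_dim
  plus_zero_mat_dim zero_plus_mat_dim

lemma index_mult_mat_sum:
  "i < dim_row A \<Longrightarrow> j < dim_col B \<Longrightarrow> dim_col A = dim_row B \<Longrightarrow>
    (A * B) $$ (i, j) = (\<Sum>k<dim_row B. A $$ (i, k) * B $$ (k, j))"
  by (simp add: scalar_prod_def atLeast0LessThan)

lemma right_inverse_mat_dim_le:
  fixes p q :: "'k :: field mat"
  assumes p: "p \<in> carrier_mat f y" and q: "q \<in> carrier_mat y f" and pq: "p * q = 1\<^sub>m f"
  shows "f \<le> y"
proof (rule ccontr)
  assume "\<not> f \<le> y"
  then have lt: "y < f" by simp
  define P where "P = mat f f (\<lambda>(i, j). if j < y then p $$ (i, j) else 0)"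
  define Q where "Q = mat f f (\<lambda>(i, j). if i < y then q $$ (i, j) else 0)"
  have PQ: "P * Q = 1\<^sub>m f"
  proof (rule eq_matI)
    fix i j assume "i < dim_row (1\<^sub>m f :: 'k mat)" "j < dim_col (1\<^sub>m f :: 'k mat)"
    then have ij: "i < f" "j < f" by auto
    have "(P * Q) $$ (i, j) = (\<Sum>k<f. P $$ (i, k) * Q $$ (k, j))"
      using ij by (subst index_mult_mat_sum) (auto simp: P_def Q_def)
    also have "\<dots> = (\<Sum>k<y. p $$ (i, k) * q $$ (k, j))"
      using ij lt by (intro sum.mono_neutral_cong_right) (auto simp: P_def Q_def)
    also have "\<dots> = (p * q) $$ (i, j)"
      using ij p q by (subst index_mult_mat_sum) auto
    finally show "(P * Q) $$ (i, j) = 1\<^sub>m f $$ (i, j)" by (simp add: pq)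
  qed (auto simp: P_def Q_def)
  have "Q * P = 1\<^sub>m f"
    by (rule mat_mult_left_right_inverse[OF _ _ PQ]) (auto simp: P_def Q_def)
  then have "(Q * P) $$ (y, y) = 1" using lt by simp
  moreover have "(Q * P) $$ (y, y) = (\<Sum>k<f. Q $$ (y, k) * P $$ (k, y))"
    using lt by (subst index_mult_mat_sum) (auto simp: P_def Q_def)
  moreover have "\<dots> = 0" using lt by (intro sum.neutral) (auto simp: P_def Q_def)
  ultimately show False by simp
qed

lemma idempotent_factorization:
  fixes E :: "'k :: field mat"
  assumes E: "E \<in> carrier_mat y y" and EE: "E * E = E"
  obtains f p q where "p \<in> carrier_mat f y" "q \<in> carrier_mat y f" "p * q = 1\<^sub>m f" "q * p = E"
proof -
  define S where "S f \<longleftrightarrow> (\<exists>p q. p \<in> carrier_mat f y \<and> q \<in> carrier_mat y f \<and> p * q = 1\<^sub>m f \<and>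
    E * q = q \<and> p * E = p)" for f
  have "S 0" unfolding S_def
    by (intro exI[of _ "0\<^sub>m 0 y"] exI[of _ "0\<^sub>m y 0"]) (use E in \<open>auto intro!: eq_matI\<close>)
  moreover have le: "f \<le> y" if "S f" for f
    using that right_inverse_mat_dim_le unfolding S_def by metis
  ultimately obtain f where f: "S f" "\<And>g. S g \<Longrightarrow> g \<le> f"
    using ex_has_greatest_nat[of S 0 "\<lambda>x. x" "Suc y"] by (auto simp: less_Suc_eq_le)
  from f(1) obtain p q where p: "p \<in> carrier_mat f y" and q: "q \<in> carrier_mat y f" and pq: "p * q = 1\<^sub>m f"
    and Eq: "E * q = q" and pE: "p * E = p" unfolding S_def by (elim exE conjE)
  note [simp] = carrier_matD[OF p] carrier_matD[OF q] carrier_matD[OF E]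
  define F where "F = E - q * p"
  have [simp]: "dim_row F = y" "dim_col F = y" by (auto simp: F_def)
  have Fc: "F \<in> carrier_mat y y" by auto
  have pqp: "p * (q * p) = p"
    using mult_mat_assoc_dim[of p q p] pq by (simp add: mat_dim_rules)
  have Eqp: "E * (q * p) = q * p"
    using mult_mat_assoc_dim[of E q p] Eq by simp
  have qpE: "q * p * E = q * p" by (simp add: mult_mat_assoc_dim pE)
  have EF: "E * F = F" by (simp add: F_def mat_dim_rules EE Eqp)
  have FE: "F * E = F" by (simp add: F_def minus_mat_mult_dim EE qpE)
  have pF: "p * F = 0\<^sub>m f y" by (simp add: F_def mat_dim_rules pE pqp minus_self_mat)
  have Fq: "F * q = 0\<^sub>m y f"
    by (simp add: F_def minus_mat_mult_dim Eq mult_mat_assoc_dim pq mult_one_mat_dim minus_self_mat)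
  have "F * (q * p) = 0\<^sub>m y y"
    using mult_mat_assoc_dim[of F q p] Fq by (simp add: mat_dim_rules)
  then have FF: "F * F = F" by (subst (2) F_def) (simp add: mult_mat_minus_dim FE minus_zero_mat_dim)
  have "F = 0\<^sub>m y y"
  proof (rule ccontr)
    assume "F \<noteq> 0\<^sub>m y y"
    then obtain k l where kl: "k < y" "l < y" "F $$ (k, l) \<noteq> 0" by (auto simp: mat_eq_iff)
    define V where "V = mat y (Suc f) (\<lambda>(i, j). if j < f then q $$ (i, j) else F $$ (i, l))"
    define R where "R = mat (Suc f) y (\<lambda>(i, j). if i < f then p $$ (i, j) else F $$ (k, j) / F $$ (k, l))"
    have [simp]: "dim_row V = y" "dim_col V = Suc f" "dim_row R = Suc f" "dim_col R = y"
      by (auto simp: V_def R_def)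
    have entry: "(\<Sum>s<y. A $$ (i, s) * B $$ (s, j)) = (A * B) $$ (i, j)"
      if "i < dim_row A" "j < dim_col B" "dim_col A = y" "dim_row B = y" for A B :: "'k mat" and i j
      using that by (subst index_mult_mat_sum) auto
    have RV: "R * V = 1\<^sub>m (Suc f)"
    proof (rule eq_matI)
      fix i j assume "i < dim_row (1\<^sub>m (Suc f) :: 'k mat)" "j < dim_col (1\<^sub>m (Suc f) :: 'k mat)"
      then have ij: "i < Suc f" "j < Suc f" by auto
      then have s: "(R * V) $$ (i, j) = (\<Sum>s<y. R $$ (i, s) * V $$ (s, j))"
        by (subst index_mult_mat_sum) auto
      consider "i < f" "j < f" | "i < f" "j = f" | "i = f" "j < f" | "i = f" "j = f" using ij by linarith
      then show "(R * V) $$ (i, j) = 1\<^sub>m (Suc f) $$ (i, j)"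
      proof cases
        case 1
        then have "(R * V) $$ (i, j) = (p * q) $$ (i, j)"
          unfolding s by (subst entry[symmetric]) (auto simp: R_def V_def)
        then show ?thesis using 1 by (simp add: pq)
      next
        case 2
        then have "(R * V) $$ (i, j) = (p * F) $$ (i, l)"
          unfolding s using kl by (subst entry[symmetric]) (auto simp: R_def V_def)
        then show ?thesis using 2 kl by (simp add: pF)
      next
        case 3
        then have "(R * V) $$ (i, j) = (F * q) $$ (k, j) / F $$ (k, l)"
          unfolding s using kl
          by (subst entry[symmetric]) (auto simp: R_def V_def sum_divide_distrib intro: sum.cong)
        then show ?thesis using 3 kl by (simp add: Fq)
      next
        case 4
        then have "(R * V) $$ (i, j) = (F * F) $$ (k, l) / F $$ (k, l)"
          unfolding s using kl
          by (subst entry[symmetric]) (auto simp: R_def V_def sum_divide_distrib intro: sum.cong)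
        then show ?thesis using 4 kl by (simp add: FF)
      qed
    qed auto
    have EV: "E * V = V"
    proof (rule eq_matI)
      fix i j assume "i < dim_row V" "j < dim_col V"
      then have ij: "i < y" "j < Suc f" by auto
      then have s: "(E * V) $$ (i, j) = (\<Sum>s<y. E $$ (i, s) * V $$ (s, j))"
        by (subst index_mult_mat_sum) auto
      show "(E * V) $$ (i, j) = V $$ (i, j)"
      proof (cases "j < f")
        case True
        then have "(E * V) $$ (i, j) = (E * q) $$ (i, j)"
          unfolding s using ij by (subst entry[symmetric]) (auto simp: V_def)
        then show ?thesis using True ij by (simp add: Eq V_def)
      next
        case False
        then have "(E * V) $$ (i, j) = (E * F) $$ (i, l)"
          unfolding s using ij kl by (subst entry[symmetric]) (auto simp: V_def)
        then show ?thesis using False ij by (simp add: EF V_def)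
      qed
    qed auto
    have RE: "R * E = R"
    proof (rule eq_matI)
      fix i j assume "i < dim_row R" "j < dim_col R"
      then have ij: "i < Suc f" "j < y" by auto
      then have s: "(R * E) $$ (i, j) = (\<Sum>s<y. R $$ (i, s) * E $$ (s, j))"
        by (subst index_mult_mat_sum) auto
      show "(R * E) $$ (i, j) = R $$ (i, j)"
      proof (cases "i < f")
        case True
        then have "(R * E) $$ (i, j) = (p * E) $$ (i, j)"
          unfolding s using ij by (subst entry[symmetric]) (auto simp: R_def)
        then show ?thesis using True ij by (simp add: pE R_def)
      next
        case False
        then have "(R * E) $$ (i, j) = (F * E) $$ (k, j) / F $$ (k, l)"
          unfolding s using ij kl
          by (subst entry[symmetric]) (auto simp: R_def sum_divide_distrib intro: sum.cong)
        then show ?thesis using False ij by (simp add: FE R_def)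
      qed
    qed auto
    have "S (Suc f)" unfolding S_def
      by (intro exI[of _ R] exI[of _ V]) (auto simp: RV EV RE)
    then show False using f(2)[of "Suc f"] by simp
  qed
  then have "E = q * p"
    using minus_eq_imp_eq_mat[of E "q * p" y y] p q E unfolding F_def by simp
  then have "q * p = E" ..
  with p q pq that show thesis by blast
qed

lemma linear_relation:
  fixes f :: "nat \<Rightarrow> nat \<Rightarrow> 'k :: field"
  obtains c where "\<exists>i\<le>n. c i \<noteq> 0" "\<And>j. j < n \<Longrightarrow> (\<Sum>i\<le>n. c i * f i j) = 0"
proof -
  define B where "B = mat (Suc n) (Suc n) (\<lambda>(j, i). if j < n then f i j else 0)"
  have B: "B \<in> carrier_mat (Suc n) (Suc n)" by (simp add: B_def)
  have "det B = (det B \<cdot>\<^sub>m 1\<^sub>m (Suc n)) $$ (n, n)" by simp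
  also have "\<dots> = (B * adj_mat B) $$ (n, n)" by (simp add: adj_mat[OF B])
  also have "\<dots> = 0"
    using adj_mat(1)[OF B] B by (subst index_mult_mat_sum) (auto simp: B_def)
  finally obtain v where v: "v \<in> carrier_vec (Suc n)" "v \<noteq> 0\<^sub>v (Suc n)" "B *\<^sub>v v = 0\<^sub>v (Suc n)"
    using det_0_iff_vec_prod_zero_field[OF B] by auto
  show thesis
  proof (rule that[of "\<lambda>i. v $ i"])
    show "\<exists>i\<le>n. v $ i \<noteq> 0" using v(1,2) by (auto simp: vec_eq_iff less_Suc_eq_le)
    fix j assume j: "j < n"
    then have "0 = (B *\<^sub>v v) $ j" by (simp add: v(3))
    also have "\<dots> = (\<Sum>i<Suc n. (if j < n then f i j else 0) * v $ i)"
      using j v(1) by (auto simp: B_def scalar_prod_def atLeast0LessThan intro!: sum.cong)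
    finally show "(\<Sum>i\<le>n. v $ i * f i j) = 0"
      using j by (simp add: lessThan_Suc_atMost mult.commute)
  qed
qed

lemma sum_lessThan_add:
  "(\<Sum>k<a + b. f k) = (\<Sum>k<a. f k) + (\<Sum>k<(b :: nat). f (a + k) :: 'k :: comm_monoid_add)"
  by (induction b) (simp_all add: add_ac)

definition hcat :: "'k mat \<Rightarrow> 'k mat \<Rightarrow> 'k :: semiring_1 mat" where
  "hcat A B = mat (dim_row A) (dim_col A + dim_col B)
     (\<lambda>(i, j). if j < dim_col A then A $$ (i, j) else B $$ (i, j - dim_col A))"

definition vcat :: "'k mat \<Rightarrow> 'k mat \<Rightarrow> 'k :: semiring_1 mat" where
  "vcat A B = mat (dim_row A + dim_row B) (dim_col A)
     (\<lambda>(i, j). if i < dim_row A then A $$ (i, j) else B $$ (i - dim_row A, j))"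

lemma hcat_dim [simp]: "dim_row (hcat A B) = dim_row A" "dim_col (hcat A B) = dim_col A + dim_col B"
  by (simp_all add: hcat_def)

lemma vcat_dim [simp]: "dim_row (vcat A B) = dim_row A + dim_row B" "dim_col (vcat A B) = dim_col A"
  by (simp_all add: vcat_def)

lemma mult_hcat:
  "dim_col X = dim_row A \<Longrightarrow> dim_row A = dim_row B \<Longrightarrow> X * hcat A B = hcat (X * A) (X * B)"
  by (rule eq_matI) (auto simp: hcat_def index_mult_mat_sum simp del: index_mult_mat(1) intro!: sum.cong)

lemma vcat_mult:
  "dim_row X = dim_col A \<Longrightarrow> dim_col A = dim_col B \<Longrightarrow> vcat A B * X = vcat (A * X) (B * X)"
  by (rule eq_matI) (auto simp: vcat_def index_mult_mat_sum simp del: index_mult_mat(1) intro!: sum.cong)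

lemma hcat_mult_vcat:
  assumes "dim_col A = dim_row C" "dim_col B = dim_row D" "dim_row A = dim_row B" "dim_col C = dim_col D"
  shows "hcat A B * vcat C D = A * C + B * D"
proof (rule eq_matI)
  fix i j assume "i < dim_row (A * C + B * D)" "j < dim_col (A * C + B * D)"
  then have ij: "i < dim_row A" "j < dim_col C" using assms by auto
  have "(hcat A B * vcat C D) $$ (i, j) =
      (\<Sum>k<dim_row C + dim_row D. hcat A B $$ (i, k) * vcat C D $$ (k, j))"
    using ij assms by (subst index_mult_mat_sum) auto
  also have "\<dots> = (\<Sum>k<dim_row C. A $$ (i, k) * C $$ (k, j)) + (\<Sum>k<dim_row D. B $$ (i, k) * D $$ (k, j))"
    unfolding sum_lessThan_add using ij assms
    by (intro arg_cong2[of _ _ _ _ "(+)"] sum.cong) (auto simp: hcat_def vcat_def)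
  also have "\<dots> = (A * C + B * D) $$ (i, j)"
    using ij assms by (simp add: index_mult_mat_sum del: index_mult_mat(1))
  finally show "(hcat A B * vcat C D) $$ (i, j) = (A * C + B * D) $$ (i, j)" .
qed (use assms in auto)

lemma vcat_mult_hcat:
  assumes "dim_col C = dim_row A" "dim_col D = dim_col C" "dim_row B = dim_row A"
  shows "vcat C D * hcat A B = four_block_mat (C * A) (C * B) (D * A) (D * B)"
  by (rule eq_matI) (use assms in \<open>auto simp: hcat_def vcat_def index_mult_mat_sum
    simp del: index_mult_mat(1) intro!: sum.cong\<close>)

lemma hcat_mult_diag:
  assumes "A \<in> carrier_mat r e" "B \<in> carrier_mat r f" "M \<in> carrier_mat e e" "N \<in> carrier_mat f f"
  shows "hcat A B * four_block_mat M (0\<^sub>m e f) (0\<^sub>m f e) N = hcat (A * M) (B * N :: 'k :: ring_1 mat)"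
proof (rule eq_matI)
  fix i j assume "i < dim_row (hcat (A * M) (B * N))" "j < dim_col (hcat (A * M) (B * N))"
  then have ij: "i < r" "j < e + f" using assms by auto
  have "(hcat A B * four_block_mat M (0\<^sub>m e f) (0\<^sub>m f e) N) $$ (i, j) =
      (\<Sum>k<e + f. hcat A B $$ (i, k) * four_block_mat M (0\<^sub>m e f) (0\<^sub>m f e) N $$ (k, j))"
    using ij assms by (subst index_mult_mat_sum) auto
  also have "\<dots> = hcat (A * M) (B * N) $$ (i, j)"
    unfolding sum_lessThan_add using ij assms
    by (cases "j < e") (auto simp: hcat_def index_mult_mat_sum simp del: index_mult_mat(1))
  finally show "(hcat A B * four_block_mat M (0\<^sub>m e f) (0\<^sub>m f e) N) $$ (i, j) = hcat (A * M) (B * N) $$ (i, j)" .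
qed (use assms in auto)

lemma diag_mult_vcat:
  assumes "A \<in> carrier_mat e r" "B \<in> carrier_mat f r" "M \<in> carrier_mat e e" "N \<in> carrier_mat f f"
  shows "four_block_mat M (0\<^sub>m e f) (0\<^sub>m f e) N * vcat A B = vcat (M * A) (N * B :: 'k :: ring_1 mat)"
proof (rule eq_matI)
  fix i j assume "i < dim_row (vcat (M * A) (N * B))" "j < dim_col (vcat (M * A) (N * B))"
  then have ij: "i < e + f" "j < r" using assms by auto
  have "(four_block_mat M (0\<^sub>m e f) (0\<^sub>m f e) N * vcat A B) $$ (i, j) =
      (\<Sum>k<e + f. four_block_mat M (0\<^sub>m e f) (0\<^sub>m f e) N $$ (i, k) * vcat A B $$ (k, j))"
    using ij assms by (subst index_mult_mat_sum) auto
  also have "\<dots> = vcat (M * A) (N * B) $$ (i, j)"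
    unfolding sum_lessThan_add using ij assms
    by (cases "i < e") (auto simp: vcat_def index_mult_mat_sum simp del: index_mult_mat(1))
  finally show "(four_block_mat M (0\<^sub>m e f) (0\<^sub>m f e) N * vcat A B) $$ (i, j) = vcat (M * A) (N * B) $$ (i, j)" .
qed (use assms in auto)

section \<open>Direct sum decompositions of modules\<close>

definition mat_family :: "nat \<Rightarrow> ('a \<Rightarrow> 'k mat) \<Rightarrow> bool" where
  "mat_family d m \<longleftrightarrow> (\<forall>a. m a \<in> carrier_mat d d)"

lemma mat_familyD:
  assumes "mat_family d m"
  shows "m a \<in> carrier_mat d d" "dim_row (m a) = d" "dim_col (m a) = d"
  using assms unfolding mat_family_def carrier_mat_def by blast+

lemma mat_family_diag:
  assumes "mat_family e m" "mat_family f n"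
  shows "mat_family (e + f) (\<lambda>a. four_block_mat (m a) (0\<^sub>m e f) (0\<^sub>m f e) (n a))"
  using assms unfolding mat_family_def by (auto intro!: four_block_carrier_mat)

definition mod_iso :: "nat \<Rightarrow> ('a \<Rightarrow> 'k :: field mat) \<Rightarrow> nat \<Rightarrow> ('a \<Rightarrow> 'k mat) \<Rightarrow> bool" where
  "mod_iso d m e n \<longleftrightarrow> mat_family d m \<and> mat_family e n \<and>
     (\<exists>u v. u \<in> carrier_mat e d \<and> v \<in> carrier_mat d e \<and> u * v = 1\<^sub>m e \<and> v * u = 1\<^sub>m d \<and>
        (\<forall>a. u * m a = n a * u))"

lemma mod_isoI:
  "mat_family d m \<Longrightarrow> mat_family e n \<Longrightarrow> u \<in> carrier_mat e d \<Longrightarrow> v \<in> carrier_mat d e \<Longrightarrow>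
    u * v = 1\<^sub>m e \<Longrightarrow> v * u = 1\<^sub>m d \<Longrightarrow> (\<And>a. u * m a = n a * u) \<Longrightarrow> mod_iso d m e n"
  unfolding mod_iso_def by blast

lemma mod_isoE:
  assumes "mod_iso d m e n"
  obtains u v where "mat_family d m" "mat_family e n" "u \<in> carrier_mat e d" "v \<in> carrier_mat d e"
    "u * v = 1\<^sub>m e" "v * u = 1\<^sub>m d" "\<forall>a. u * m a = n a * u" "\<forall>a. v * n a = m a * v"
proof -
  obtain u v where *: "mat_family d m" "mat_family e n" "u \<in> carrier_mat e d" "v \<in> carrier_mat d e"
    "u * v = 1\<^sub>m e" "v * u = 1\<^sub>m d" "\<And>a. u * m a = n a * u"
    using assms unfolding mod_iso_def by auto
  note [simp] = mat_familyD[OF *(1)] mat_familyD[OF *(2)] carrier_matD[OF *(3)] carrier_matD[OF *(4)]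
  have "v * n a = m a * v" for a
  proof -
    have "v * n a = v * (n a * (u * v))" by (simp add: *(5) mat_dim_rules)
    also have "\<dots> = v * ((u * m a) * v)" by (simp add: *(7) mult_mat_assoc_dim)
    also have "\<dots> = (v * u) * (m a * v)" by (simp add: mult_mat_assoc_dim)
    also have "\<dots> = m a * v" by (simp add: *(6) mat_dim_rules)
    finally show ?thesis .
  qed
  then show thesis by (intro that[OF *(1-6)]) (simp_all add: *(7))
qed

lemma mod_iso_dim: "mod_iso d m e n \<Longrightarrow> d = e"
  by (elim mod_isoE) (metis le_antisym right_inverse_mat_dim_le)

lemma mod_iso_refl: "mat_family d m \<Longrightarrow> mod_iso d m d m"
  by (rule mod_isoI[of _ _ _ _ "1\<^sub>m d" "1\<^sub>m d"]) (auto simp: mat_dim_rules mat_familyD[of d m])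

lemma mod_iso_sym: "mod_iso d m e n \<Longrightarrow> mod_iso e n d m"
  by (elim mod_isoE, rule mod_isoI) auto

lemma mod_iso_trans:
  assumes "mod_iso d m e n" "mod_iso e n f l"
  shows "mod_iso d m f l"
proof -
  obtain u v where *: "mat_family d m" "mat_family e n" "u \<in> carrier_mat e d" "v \<in> carrier_mat d e"
    "u * v = 1\<^sub>m e" "v * u = 1\<^sub>m d" "\<forall>a. u * m a = n a * u" "\<forall>a. v * n a = m a * v"
    using assms(1) by (rule mod_isoE)
  note * = *[rule_format]
  obtain u' v' where "mat_family e n" and **: "mat_family f l" "u' \<in> carrier_mat f e" "v' \<in> carrier_mat e f"
    "u' * v' = 1\<^sub>m f" "v' * u' = 1\<^sub>m e" "\<forall>a. u' * n a = l a * u'" "\<forall>a. v' * l a = n a * v'"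
    using assms(2) by (rule mod_isoE)
  note ** = **[rule_format]
  note [simp] = mat_familyD[OF *(1)] mat_familyD[OF *(2)] carrier_matD[OF *(3)] carrier_matD[OF *(4)]
    mat_familyD[OF **(1)] carrier_matD[OF **(2)] carrier_matD[OF **(3)]
  show ?thesis
  proof (rule mod_isoI[OF *(1) **(1), of "u' * u" "v * v'"])
    have "u' * u * (v * v') = u' * ((u * v) * v')" by (simp add: mult_mat_assoc_dim)
    then show "u' * u * (v * v') = 1\<^sub>m f" by (simp add: * ** mat_dim_rules)
    have "v * v' * (u' * u) = v * ((v' * u') * u)" by (simp add: mult_mat_assoc_dim)
    then show "v * v' * (u' * u) = 1\<^sub>m d" by (simp add: * ** mat_dim_rules)
    fix a
    have "u' * u * m a = u' * n a * u" by (simp add: mult_mat_assoc_dim *(7))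
    then show "u' * u * m a = l a * (u' * u)" by (simp add: mult_mat_assoc_dim **(6))
  qed (use * ** in auto)
qed

lemma mod_iso_iff_conj_orbit:
  assumes m: "mat_family d m"
  shows "mod_iso d m d n \<longleftrightarrow> n \<in> conj_orbit d m"
proof
  assume "mod_iso d m d n"
  then obtain u v where "mat_family d m" and *: "mat_family d n" "u \<in> carrier_mat d d" "v \<in> carrier_mat d d"
    "u * v = 1\<^sub>m d" "v * u = 1\<^sub>m d" "\<forall>a. u * m a = n a * u" "\<forall>a. v * n a = m a * v" by (rule mod_isoE)
  note * = *[rule_format]
  note [simp] = mat_familyD[OF m] mat_familyD[OF *(1)] carrier_matD[OF *(2)] carrier_matD[OF *(3)]
  have "n = (\<lambda>a. u * m a * v)" by (simp add: *(6) fun_eq_iff mult_mat_assoc_dim *(4) mult_one_mat_dim)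
  then show "n \<in> conj_orbit d m" unfolding conj_orbit_def using * by blast
next
  assume "n \<in> conj_orbit d m"
  then obtain g h where *: "g \<in> carrier_mat d d" "h \<in> carrier_mat d d" "g * h = 1\<^sub>m d" "h * g = 1\<^sub>m d"
    and n: "n = (\<lambda>a. g * m a * h)" unfolding conj_orbit_def by blast
  note [simp] = mat_familyD[OF m] carrier_matD[OF *(1)] carrier_matD[OF *(2)]
  show "mod_iso d m d n"
  proof (rule mod_isoI[OF m _ * ])
    show "mat_family d n" unfolding mat_family_def n by (auto intro!: carrier_matI)
    show "g * m a = n a * g" for a by (simp add: n mult_mat_assoc_dim * mult_one_mat_dim)
  qed
qed

locale mod_split =
  fixes d :: nat and m :: "'a \<Rightarrow> 'k :: field mat"
    and e1 :: nat and m1 :: "'a \<Rightarrow> 'k mat" and e2 :: nat and m2 :: "'a \<Rightarrow> 'k mat"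
    and i1 p1 i2 p2 :: "'k mat"
  assumes fam: "mat_family d m" and fam1: "mat_family e1 m1" and fam2: "mat_family e2 m2"
    and i1: "i1 \<in> carrier_mat d e1" and p1: "p1 \<in> carrier_mat e1 d"
    and i2: "i2 \<in> carrier_mat d e2" and p2: "p2 \<in> carrier_mat e2 d"
    and p1_i1: "p1 * i1 = 1\<^sub>m e1" and p2_i2: "p2 * i2 = 1\<^sub>m e2"
    and p1_i2: "p1 * i2 = 0\<^sub>m e1 e2" and p2_i1: "p2 * i1 = 0\<^sub>m e2 e1"
    and complete: "i1 * p1 + i2 * p2 = 1\<^sub>m d"
    and hom_i1: "m a * i1 = i1 * m1 a" and hom_i2: "m a * i2 = i2 * m2 a"
    and hom_p1: "p1 * m a = m1 a * p1" and hom_p2: "p2 * m a = m2 a * p2"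
begin

lemma dims [simp]:
  "dim_row i1 = d" "dim_col i1 = e1" "dim_row p1 = e1" "dim_col p1 = d"
  "dim_row i2 = d" "dim_col i2 = e2" "dim_row p2 = e2" "dim_col p2 = d"
  "dim_row (m a) = d" "dim_col (m a) = d" "dim_row (m1 a) = e1" "dim_col (m1 a) = e1"
  "dim_row (m2 a) = e2" "dim_col (m2 a) = e2"
  using i1 p1 i2 p2 mat_familyD[OF fam] mat_familyD[OF fam1] mat_familyD[OF fam2] by auto

lemma complete_between:
  "dim_col A = d \<Longrightarrow> dim_row B = d \<Longrightarrow> (A * i1) * (p1 * B) + (A * i2) * (p2 * B) = A * B"
proof -
  assume [simp]: "dim_col A = d" "dim_row B = d"
  have "A * B = A * ((i1 * p1 + i2 * p2) * B)" by (simp add: complete mat_dim_rules)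
  also have "\<dots> = (A * i1) * (p1 * B) + (A * i2) * (p2 * B)"
    by (simp add: add_mat_mult_dim mult_mat_add_dim mult_mat_assoc_dim)
  finally show ?thesis by (rule sym)
qed

lemma iso_diag:
  "mod_iso d m (e1 + e2) (\<lambda>a. four_block_mat (m1 a) (0\<^sub>m e1 e2) (0\<^sub>m e2 e1) (m2 a))"
proof (rule mod_isoI[OF fam, of _ _ "vcat p1 p2" "hcat i1 i2"])
  show "mat_family (e1 + e2) (\<lambda>a. four_block_mat (m1 a) (0\<^sub>m e1 e2) (0\<^sub>m e2 e1) (m2 a))"
    by (rule mat_family_diag[OF fam1 fam2])
  show "vcat p1 p2 * hcat i1 i2 = 1\<^sub>m (e1 + e2)"
    by (simp add: vcat_mult_hcat p1_i1 p2_i2 p1_i2 p2_i1)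
  show "hcat i1 i2 * vcat p1 p2 = 1\<^sub>m d" by (simp add: hcat_mult_vcat complete)
  show "vcat p1 p2 * m a = four_block_mat (m1 a) (0\<^sub>m e1 e2) (0\<^sub>m e2 e1) (m2 a) * vcat p1 p2" for a
    by (subst diag_mult_vcat[of _ e1 d _ e2])
      (use p1 p2 fam1[unfolded mat_family_def] fam2[unfolded mat_family_def] in \<open>auto simp: vcat_mult hom_p1 hom_p2\<close>)
qed (auto intro!: carrier_matI)

lemma dim_eq: "d = e1 + e2" by (rule mod_iso_dim[OF iso_diag])

end

lemma mod_split_diag:
  fixes m1 m2 :: "'a \<Rightarrow> 'k :: field mat"
  assumes "mat_family e1 m1" "mat_family e2 m2"
  shows "mod_split (e1 + e2) (\<lambda>a. four_block_mat (m1 a) (0\<^sub>m e1 e2) (0\<^sub>m e2 e1) (m2 a)) e1 m1 e2 m2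
    (vcat (1\<^sub>m e1) (0\<^sub>m e2 e1)) (hcat (1\<^sub>m e1) (0\<^sub>m e1 e2))
    (vcat (0\<^sub>m e1 e2) (1\<^sub>m e2)) (hcat (0\<^sub>m e2 e1) (1\<^sub>m e2))"
proof
  note [simp] = mat_familyD[OF assms(1)] mat_familyD[OF assms(2)]
  show "mat_family (e1 + e2) (\<lambda>a. four_block_mat (m1 a) (0\<^sub>m e1 e2) (0\<^sub>m e2 e1) (m2 a))"
    by (rule mat_family_diag[OF assms])
  show "vcat (1\<^sub>m e1) (0\<^sub>m e2 e1) * hcat (1\<^sub>m e1) (0\<^sub>m e1 e2) +
      vcat (0\<^sub>m e1 e2) (1\<^sub>m e2) * hcat (0\<^sub>m e2 e1) (1\<^sub>m e2) = (1\<^sub>m (e1 + e2) :: 'k mat)"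
    by (rule eq_matI) (auto simp: vcat_mult_hcat mat_dim_rules)
  fix a
  show "four_block_mat (m1 a) (0\<^sub>m e1 e2) (0\<^sub>m e2 e1) (m2 a) * vcat (1\<^sub>m e1) (0\<^sub>m e2 e1) =
      vcat (1\<^sub>m e1) (0\<^sub>m e2 e1) * m1 a"
    by (subst diag_mult_vcat[of _ e1 e1 _ e2]) (auto simp: vcat_mult mat_dim_rules)
  show "four_block_mat (m1 a) (0\<^sub>m e1 e2) (0\<^sub>m e2 e1) (m2 a) * vcat (0\<^sub>m e1 e2) (1\<^sub>m e2) =
      vcat (0\<^sub>m e1 e2) (1\<^sub>m e2) * m2 a"
    by (subst diag_mult_vcat[of _ e1 e2 _ e2]) (auto simp: vcat_mult mat_dim_rules)
  show "hcat (1\<^sub>m e1) (0\<^sub>m e1 e2) * four_block_mat (m1 a) (0\<^sub>m e1 e2) (0\<^sub>m e2 e1) (m2 a) =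
      m1 a * hcat (1\<^sub>m e1) (0\<^sub>m e1 e2)"
    by (subst hcat_mult_diag[of _ e1 e1 _ e2]) (auto simp: mult_hcat mat_dim_rules)
  show "hcat (0\<^sub>m e2 e1) (1\<^sub>m e2) * four_block_mat (m1 a) (0\<^sub>m e1 e2) (0\<^sub>m e2 e1) (m2 a) =
      m2 a * hcat (0\<^sub>m e2 e1) (1\<^sub>m e2)"
    by (subst hcat_mult_diag[of _ e2 e1 _ e2]) (auto simp: mult_hcat mat_dim_rules)
qed (use assms in \<open>auto simp: hcat_mult_vcat mat_dim_rules intro!: carrier_matI\<close>)

lemma mod_split_iso_whole:
  assumes "mod_split d m e1 m1 e2 m2 i1 p1 i2 p2" "mod_iso d m d' m'"
  obtains i1' p1' i2' p2' where "mod_split d' m' e1 m1 e2 m2 i1' p1' i2' p2'"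
proof -
  interpret mod_split d m e1 m1 e2 m2 i1 p1 i2 p2 by fact
  obtain u v where "mat_family d m" and *: "mat_family d' m'" "u \<in> carrier_mat d' d" "v \<in> carrier_mat d d'"
    "u * v = 1\<^sub>m d'" "v * u = 1\<^sub>m d" "\<forall>a. u * m a = m' a * u" "\<forall>a. v * m' a = m a * v"
    using assms(2) by (rule mod_isoE)
  note * = *[rule_format]
  note [simp] = mat_familyD[OF *(1)] carrier_matD[OF *(2)] carrier_matD[OF *(3)]
  have vu: "v * (u * X) = X" if "dim_row X = d" for X
    using that by (subst mult_mat_assoc_dim[symmetric]) (auto simp: * one_mat_mult_dim)
  have "mod_split d' m' e1 m1 e2 m2 (u * i1) (p1 * v) (u * i2) (p2 * v)"
  proof
    have "u * i1 * (p1 * v) + u * i2 * (p2 * v) = u * v" by (rule complete_between) auto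
    then show "u * i1 * (p1 * v) + u * i2 * (p2 * v) = 1\<^sub>m d'" by (simp add: *(4))
    fix a
    have "m' a * (u * X) = u * (m a * X)" if "dim_row X = d" for X
      using that by (subst mult_mat_assoc_dim[symmetric]) (auto simp: *(6)[symmetric] mult_mat_assoc_dim)
    then show "m' a * (u * i1) = u * i1 * m1 a" "m' a * (u * i2) = u * i2 * m2 a"
      by (simp_all add: hom_i1 hom_i2 mult_mat_assoc_dim)
    have "p1 * m a * v = m1 a * p1 * v" "p2 * m a * v = m2 a * p2 * v"
      by (simp_all add: hom_p1 hom_p2)
    then show "p1 * v * m' a = m1 a * (p1 * v)" "p2 * v * m' a = m2 a * (p2 * v)"
      by (simp_all add: mult_mat_assoc_dim *(7))
  qed (use * fam1 fam2 in \<open>auto simp: mult_mat_assoc_dim vu p1_i1 p2_i2 p1_i2 p2_i1 intro!: carrier_matI\<close>)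
  then show thesis by (rule that)
qed

lemma mod_split_iso_summand:
  assumes "mod_split d m e1 m1 e2 m2 i1 p1 i2 p2" "mod_iso e2 m2 f n"
  obtains i p where "mod_split d m e1 m1 f n i1 p1 i p"
proof -
  interpret mod_split d m e1 m1 e2 m2 i1 p1 i2 p2 by fact
  obtain u v where "mat_family e2 m2" and *: "mat_family f n" "u \<in> carrier_mat f e2" "v \<in> carrier_mat e2 f"
    "u * v = 1\<^sub>m f" "v * u = 1\<^sub>m e2" "\<forall>a. u * m2 a = n a * u" "\<forall>a. v * n a = m2 a * v"
    using assms(2) by (rule mod_isoE)
  note * = *[rule_format]
  note [simp] = mat_familyD[OF *(1)] carrier_matD[OF *(2)] carrier_matD[OF *(3)]
  have vu: "v * (u * X) = X" if "dim_row X = e2" for X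
    using that by (subst mult_mat_assoc_dim[symmetric]) (auto simp: * one_mat_mult_dim)
  have p2i2: "p2 * (i2 * X) = X" if "dim_row X = e2" for X
    using that by (subst mult_mat_assoc_dim[symmetric]) (auto simp: p2_i2 one_mat_mult_dim)
  have p1i2: "p1 * (i2 * X) = 0\<^sub>m e1 (dim_col X)" if "dim_row X = e2" for X
    using that by (subst mult_mat_assoc_dim[symmetric]) (auto simp: p1_i2 zero_mat_mult_dim)
  have "mod_split d m e1 m1 f n i1 p1 (i2 * v) (u * p2)"
  proof
    show "i1 * p1 + i2 * v * (u * p2) = 1\<^sub>m d" by (simp add: mult_mat_assoc_dim vu complete)
    fix a
    have "m a * i2 * v = i2 * m2 a * v" "u * (p2 * m a) = u * (m2 a * p2)"
      by (simp_all add: hom_i2 hom_p2)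
    moreover have "u * (m2 a * p2) = n a * (u * p2)"
      by (subst mult_mat_assoc_dim[symmetric]) (auto simp: *(6) mult_mat_assoc_dim)
    ultimately show "m a * (i2 * v) = i2 * v * n a" "u * p2 * m a = n a * (u * p2)"
      by (simp_all add: mult_mat_assoc_dim *(7))
  qed (use * fam fam1 i1 p1 in \<open>auto simp: mult_mat_assoc_dim p2i2 p1i2 p1_i1 p2_i1 hom_i1 hom_p1
      mult_zero_mat_dim intro!: carrier_matI\<close>)
  then show thesis by (rule that)
qed

text \<open>Schur complement: if the component \<open>m \<rightarrow> n\<close> is invertible, the complements are isomorphic.\<close>

lemma mod_split_cancel:
  assumes "mod_split d x e1 m e2 m' i1 p1 i2 p2" "mod_split d x f1 n f2 n' j1 q1 j2 q2"
    and b: "b \<in> carrier_mat e1 f1" and qb: "q1 * i1 * b = 1\<^sub>m f1" and bq: "b * (q1 * i1) = 1\<^sub>m e1"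
  shows "mod_iso e2 m' f2 n'"
proof -
  interpret M: mod_split d x e1 m e2 m' i1 p1 i2 p2 by fact
  interpret N: mod_split d x f1 n f2 n' j1 q1 j2 q2 by fact
  note [simp] = carrier_matD[OF b]
  define w where "w = 1\<^sub>m d - i1 * (b * q1)"
  have [simp]: "dim_row w = d" "dim_col w = d" by (simp_all add: w_def)
  have wi: "w * i1 = 0\<^sub>m d e1"
    by (simp add: w_def minus_mat_mult_dim mult_mat_assoc_dim bq one_mat_mult_dim mult_one_mat_dim minus_self_mat)
  have qib: "q1 * (i1 * (b * X)) = X" if "dim_row X = f1" for X
    using that qb by (simp add: mult_mat_assoc_dim[symmetric] one_mat_mult_dim)
  have qw: "q1 * w = 0\<^sub>m f1 d"
    by (simp add: w_def mult_mat_minus_dim mult_one_mat_dim qib minus_self_mat)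
  have hom_b: "b * n a = m a * b" for a
  proof -
    have "b * n a = b * (n a * (q1 * i1 * b))" by (simp add: qb mult_one_mat_dim)
    also have "\<dots> = b * ((n a * q1) * (i1 * b))" by (simp add: mult_mat_assoc_dim)
    also have "\<dots> = b * (q1 * ((x a * i1) * b))" by (simp add: N.hom_p1[symmetric] mult_mat_assoc_dim)
    also have "\<dots> = (b * (q1 * i1)) * (m a * b)" by (simp add: M.hom_i1 mult_mat_assoc_dim)
    also have "\<dots> = m a * b" by (simp add: bq one_mat_mult_dim)
    finally show ?thesis .
  qed
  have hom_w: "w * x a = x a * w" for a
  proof -
    have "i1 * (b * q1) * x a = i1 * ((b * n a) * q1)" by (simp add: mult_mat_assoc_dim N.hom_p1)
    also have "\<dots> = (x a * i1) * (b * q1)" by (simp add: hom_b M.hom_i1 mult_mat_assoc_dim)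
    finally have "i1 * (b * q1) * x a = x a * (i1 * (b * q1))" by (simp add: mult_mat_assoc_dim)
    then show ?thesis
      by (simp add: w_def minus_mat_mult_dim mult_mat_minus_dim one_mat_mult_dim mult_one_mat_dim)
  qed
  show ?thesis
  proof (rule mod_isoI[OF M.fam2 N.fam2, of "q2 * w * i2" "p2 * j2"])
    have "(w * i1) * (p1 * j2) + (w * i2) * (p2 * j2) = w * j2" by (rule M.complete_between) auto
    then have "w * i2 * (p2 * j2) = w * j2" by (simp add: wi zero_mat_mult_dim zero_plus_mat_dim)
    then have "q2 * w * i2 * (p2 * j2) = q2 * (w * j2)" by (simp add: mult_mat_assoc_dim)
    also have "w * j2 = j2"
      by (simp add: w_def minus_mat_mult_dim one_mat_mult_dim mult_mat_assoc_dim N.p1_i2 mult_zero_mat_dim minus_zero_mat_dim)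
    finally show "q2 * w * i2 * (p2 * j2) = 1\<^sub>m f2" by (simp add: N.p2_i2)
    have "(p2 * j1) * (q1 * w) + (p2 * j2) * (q2 * w) = p2 * w" by (rule N.complete_between) auto
    then have "p2 * j2 * (q2 * w) = p2 * w" by (simp add: qw mult_zero_mat_dim zero_plus_mat_dim)
    then have "p2 * j2 * (q2 * w * i2) = p2 * w * i2" by (simp add: mult_mat_assoc_dim[symmetric])
    also have "p2 * w = p2"
    proof -
      have "p2 * (i1 * (b * q1)) = (p2 * i1) * (b * q1)" by (simp add: mult_mat_assoc_dim)
      then show ?thesis
        by (simp add: w_def mult_mat_minus_dim mult_one_mat_dim M.p2_i1 zero_mat_mult_dim minus_zero_mat_dim)
    qed
    finally show "p2 * j2 * (q2 * w * i2) = 1\<^sub>m e2" by (simp add: M.p2_i2)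
    fix a
    have "q2 * w * i2 * m' a = q2 * (w * x a) * i2" by (simp add: mult_mat_assoc_dim M.hom_i2)
    also have "\<dots> = (q2 * x a) * (w * i2)" by (simp add: hom_w mult_mat_assoc_dim)
    also have "\<dots> = n' a * (q2 * w * i2)" by (simp add: N.hom_p2 mult_mat_assoc_dim)
    finally show "q2 * w * i2 * m' a = n' a * (q2 * w * i2)" .
  qed (auto intro!: carrier_matI)
qed

lemma mod_split_section:
  fixes y :: "'a \<Rightarrow> 'k :: field mat"
  assumes y: "mat_family d y" and m: "mat_family e m"
    and c: "c \<in> carrier_mat d e" and s: "s \<in> carrier_mat e d" and sc: "s * c = 1\<^sub>m e"
    and hom_c: "\<And>a. y a * c = c * m a" and hom_s: "\<And>a. s * y a = m a * s"
  obtains f n q p where "mod_split d y e m f n c s q p"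
proof -
  note [simp] = mat_familyD[OF y] mat_familyD[OF m] carrier_matD[OF c] carrier_matD[OF s]
  define E where "E = 1\<^sub>m d - c * s"
  have Ec [simp]: "dim_row E = d" "dim_col E = d" by (simp_all add: E_def)
  have csc: "c * (s * c) = c" by (simp add: sc mult_one_mat_dim)
  have scs: "s * (c * s) = s" by (simp add: mult_mat_assoc_dim[symmetric] sc one_mat_mult_dim)
  have E_c: "E * c = 0\<^sub>m d e"
    by (simp add: E_def minus_mat_mult_dim mult_mat_assoc_dim one_mat_mult_dim csc minus_self_mat)
  have s_E: "s * E = 0\<^sub>m e d"
    by (simp add: E_def mult_mat_minus_dim mult_one_mat_dim scs minus_self_mat)
  have "E * (c * s) = 0\<^sub>m d d"
    by (simp add: mult_mat_assoc_dim[symmetric] E_c zero_mat_mult_dim)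
  then have EE: "E * E = E"
    by (subst (2) E_def) (simp add: mult_mat_minus_dim mult_one_mat_dim minus_zero_mat_dim)
  obtain f p q where pq: "p \<in> carrier_mat f d" "q \<in> carrier_mat d f" "p * q = 1\<^sub>m f" "q * p = E"
    by (rule idempotent_factorization[OF _ EE, of d]) (auto intro: carrier_matI)
  note [simp] = carrier_matD[OF pq(1)] carrier_matD[OF pq(2)]
  have pqX: "p * (q * X) = X" if "dim_row X = f" for X
    using that by (simp add: mult_mat_assoc_dim[symmetric] pq(3) one_mat_mult_dim)
  have qpX: "q * (p * X) = E * X" if "dim_row X = d" for X
    using that by (simp add: mult_mat_assoc_dim[symmetric] pq(4))
  have p_E: "p * E = p" by (simp add: pq(4)[symmetric] pqX)
  have E_q: "E * q = q" by (simp add: pq(4)[symmetric] mult_mat_assoc_dim pq(3) mult_one_mat_dim)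
  have hom_E: "E * y a = y a * E" for a
  proof -
    have "c * s * y a = (c * m a) * s" by (simp add: mult_mat_assoc_dim hom_s)
    also have "\<dots> = y a * (c * s)" by (simp add: hom_c[symmetric] mult_mat_assoc_dim)
    finally show ?thesis
      by (simp add: E_def minus_mat_mult_dim mult_mat_minus_dim one_mat_mult_dim mult_one_mat_dim)
  qed
  have "mod_split d y e m f (\<lambda>a. p * y a * q) c s q p"
  proof
    show "mat_family f (\<lambda>a. p * y a * q)" unfolding mat_family_def by (intro allI carrier_matI) simp_all
    have "s * q = s * (E * q)" by (simp add: E_q)
    also have "\<dots> = 0\<^sub>m e f" by (simp add: mult_mat_assoc_dim[symmetric] s_E zero_mat_mult_dim)
    finally show "s * q = 0\<^sub>m e f" .
    have "p * c = p * E * c" by (simp add: p_E)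
    also have "\<dots> = 0\<^sub>m f e" by (simp add: mult_mat_assoc_dim E_c mult_zero_mat_dim)
    finally show "p * c = 0\<^sub>m f e" .
    show "c * s + q * p = 1\<^sub>m d" unfolding pq(4) E_def by (rule eq_matI) auto
    fix a
    have "q * (p * y a * q) = E * y a * q" by (simp add: mult_mat_assoc_dim qpX)
    then show "y a * q = q * (p * y a * q)" by (simp add: hom_E mult_mat_assoc_dim E_q)
    have "p * y a * q * p = p * (y a * E)" by (simp add: mult_mat_assoc_dim pq(4))
    also have "\<dots> = p * E * y a" by (simp add: hom_E[symmetric] mult_mat_assoc_dim)
    finally show "p * y a = p * y a * q * p" by (simp add: p_E)
  qed (use assms pq in auto)
  then show thesis by (rule that)
qed

lemma mod_split_regroup:
  assumes "mod_split d x e1 n e2 y j1 q1 j2 q2" "mod_split e2 y f1 m f2 z c s q p"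
  obtains i r where "mod_split d x f1 m (e1 + f2)
    (\<lambda>a. four_block_mat (n a) (0\<^sub>m e1 f2) (0\<^sub>m f2 e1) (z a)) (j2 * c) (s * q2) i r"
proof -
  interpret X: mod_split d x e1 n e2 y j1 q1 j2 q2 by fact
  interpret Y: mod_split e2 y f1 m f2 z c s q p by fact
  have q2j2: "q2 * (j2 * X) = X" if "dim_row X = e2" for X
    using that by (simp add: mult_mat_assoc_dim[symmetric] X.p2_i2 one_mat_mult_dim)
  have q1j2: "q1 * (j2 * X) = 0\<^sub>m e1 (dim_col X)" if "dim_row X = e2" for X
    using that by (simp add: mult_mat_assoc_dim[symmetric] X.p1_i2 zero_mat_mult_dim)
  have "mod_split d x f1 m (e1 + f2) (\<lambda>a. four_block_mat (n a) (0\<^sub>m e1 f2) (0\<^sub>m f2 e1) (z a))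
    (j2 * c) (s * q2) (hcat j1 (j2 * q)) (vcat q1 (p * q2))"
  proof
    show "mat_family (e1 + f2) (\<lambda>a. four_block_mat (n a) (0\<^sub>m e1 f2) (0\<^sub>m f2 e1) (z a))"
      by (rule mat_family_diag[OF X.fam1 Y.fam2])
    show "s * q2 * (j2 * c) = 1\<^sub>m f1" by (simp add: mult_mat_assoc_dim q2j2 Y.p1_i1)
    show "vcat q1 (p * q2) * hcat j1 (j2 * q) = 1\<^sub>m (e1 + f2)"
      by (simp add: vcat_mult_hcat mult_mat_assoc_dim q2j2 q1j2 X.p1_i1 X.p2_i1 Y.p2_i2 mult_zero_mat_dim)
    show "s * q2 * hcat j1 (j2 * q) = 0\<^sub>m f1 (e1 + f2)"
      by (subst mult_hcat) (auto simp: mult_mat_assoc_dim q2j2 X.p2_i1 Y.p1_i2 mult_zero_mat_dim hcat_def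
          intro!: eq_matI)
    show "vcat q1 (p * q2) * (j2 * c) = 0\<^sub>m (e1 + f2) f1"
      by (subst vcat_mult) (auto simp: mult_mat_assoc_dim q2j2 q1j2 Y.p2_i1 vcat_def intro!: eq_matI)
    have "j2 * c * (s * q2) + j2 * q * (p * q2) = j2 * q2"
      using arg_cong[OF Y.complete_between[of j2 q2], of id] by simp
    moreover have "hcat j1 (j2 * q) * vcat q1 (p * q2) = j1 * q1 + j2 * q * (p * q2)"
      by (simp add: hcat_mult_vcat)
    ultimately have "j2 * c * (s * q2) + hcat j1 (j2 * q) * vcat q1 (p * q2) = j1 * q1 + j2 * q2"
      by (auto simp: mat_eq_iff algebra_simps)
    then show "j2 * c * (s * q2) + hcat j1 (j2 * q) * vcat q1 (p * q2) = 1\<^sub>m d"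
      by (simp add: X.complete)
    fix a
    have xj: "x a * (j2 * X) = j2 * (y a * X)" if "dim_row X = e2" for X
      using that by (simp add: mult_mat_assoc_dim[symmetric] X.hom_i2)
    show "x a * (j2 * c) = j2 * c * m a" by (simp add: xj Y.hom_i1 mult_mat_assoc_dim)
    show "x a * hcat j1 (j2 * q) = hcat j1 (j2 * q) * four_block_mat (n a) (0\<^sub>m e1 f2) (0\<^sub>m f2 e1) (z a)"
      by (subst hcat_mult_diag[of _ d e1 _ f2])
        (auto simp: mult_hcat xj Y.hom_i2 X.hom_i1 mult_mat_assoc_dim intro!: carrier_matI)
    have qx: "s * q2 * x a = (s * y a) * q2" "p * q2 * x a = (p * y a) * q2"
      by (simp_all add: mult_mat_assoc_dim X.hom_p2)
    then show "s * q2 * x a = m a * (s * q2)" by (simp add: Y.hom_p1 mult_mat_assoc_dim)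
    show "vcat q1 (p * q2) * x a = four_block_mat (n a) (0\<^sub>m e1 f2) (0\<^sub>m f2 e1) (z a) * vcat q1 (p * q2)"
      by (subst diag_mult_vcat[of _ e1 d _ f2])
        (auto simp: vcat_mult X.hom_p1 qx Y.hom_p2 mult_mat_assoc_dim intro!: carrier_matI)
  qed (use X.fam Y.fam1 in \<open>auto intro!: carrier_matI\<close>)
  then show thesis by (rule that)
qed

section \<open>Endomorphisms of indecomposable modules\<close>

lemma mult_smult_dim: "dim_col A = dim_row B \<Longrightarrow> A * (c \<cdot>\<^sub>m B) = c \<cdot>\<^sub>m (A * (B :: 'k :: comm_semiring_0 mat))"
  by (rule mult_smult_distrib[of A "dim_row A" "dim_col A" B "dim_col B"]) (auto intro: carrier_matI)

lemma smult_mult_dim: "dim_col A = dim_row B \<Longrightarrow> (c \<cdot>\<^sub>m A) * B = c \<cdot>\<^sub>m (A * (B :: 'k :: comm_semiring_0 mat))"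
  by (rule mult_smult_assoc_mat[of A "dim_row A" "dim_col A" B "dim_col B"]) (auto intro: carrier_matI)

lemma commute_mult:
  fixes X :: "'k :: semiring_0 mat"
  assumes "X * A = A * X" "X * B = B * X" "X \<in> carrier_mat d d" "A \<in> carrier_mat d d" "B \<in> carrier_mat d d"
  shows "X * (A * B) = A * B * X"
proof -
  note [simp] = carrier_matD[OF assms(3)] carrier_matD[OF assms(4)] carrier_matD[OF assms(5)]
  have "X * (A * B) = X * A * B" by (simp add: mult_mat_assoc_dim)
  also have "\<dots> = A * (X * B)" unfolding assms(1) by (simp add: mult_mat_assoc_dim)
  also have "\<dots> = A * B * X" unfolding assms(2) by (simp add: mult_mat_assoc_dim)
  finally show ?thesis .
qed

lemma commute_pow:
  fixes X :: "'k :: semiring_1 mat"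
  assumes "X * A = A * X" "X \<in> carrier_mat d d" "A \<in> carrier_mat d d"
  shows "X * A ^\<^sub>m n = A ^\<^sub>m n * X"
proof (induction n)
  case 0
  then show ?case using assms by simp
next
  case (Suc n)
  have "A ^\<^sub>m n \<in> carrier_mat d d" using assms(3) by (rule pow_carrier_mat)
  with Suc assms show ?case by (simp add: commute_mult[of X "A ^\<^sub>m n" A d])
qed

lemma mult_pow_commute:
  fixes A :: "'k :: semiring_1 mat"
  assumes "A * B = B * A" and A: "A \<in> carrier_mat d d" and B: "B \<in> carrier_mat d d"
  shows "(A * B) ^\<^sub>m n = A ^\<^sub>m n * B ^\<^sub>m n"
proof (induction n)
  case 0
  then show ?case using A B by simp
next
  case (Suc n)
  have An: "A ^\<^sub>m n \<in> carrier_mat d d" and Bn: "B ^\<^sub>m n \<in> carrier_mat d d"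
    using A B by (auto intro: pow_carrier_mat)
  note [simp] = carrier_matD[OF A] carrier_matD[OF B] carrier_matD[OF An] carrier_matD[OF Bn]
  have "B ^\<^sub>m n * A = A * B ^\<^sub>m n" by (rule commute_pow[OF assms, symmetric])
  then have BA: "B ^\<^sub>m n * (A * X) = A * (B ^\<^sub>m n * X)" if "dim_row X = d" for X
    using that by (simp add: mult_mat_assoc_dim[symmetric])
  show ?case by (simp add: Suc mult_mat_assoc_dim BA)
qed

primrec mat_horner :: "'k :: semiring_1 mat \<Rightarrow> 'k list \<Rightarrow> 'k mat" where
  "mat_horner A [] = 0\<^sub>m (dim_row A) (dim_row A)"
| "mat_horner A (c # cs) = c \<cdot>\<^sub>m 1\<^sub>m (dim_row A) + A * mat_horner A cs"

lemma mat_horner_carrier: "A \<in> carrier_mat d d \<Longrightarrow> mat_horner A cs \<in> carrier_mat d d"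
  by (induction cs) auto

lemma mat_horner_commute:
  fixes X :: "'k :: field mat"
  assumes "X * A = A * X" and X: "X \<in> carrier_mat d d" and A: "A \<in> carrier_mat d d"
  shows "X * mat_horner A cs = mat_horner A cs * X"
proof (induction cs)
  case Nil
  then show ?case using A X by simp
next
  case (Cons c cs)
  note H = mat_horner_carrier[OF A, of cs]
  note [simp] = carrier_matD[OF A] carrier_matD[OF X] carrier_matD[OF H]
  show ?case
    by (simp add: mult_mat_add_dim add_mat_mult_dim mult_smult_dim smult_mult_dim one_mat_mult_dim
        mult_one_mat_dim commute_mult[OF assms(1) Cons X A H])
qed

lemma pow_mat_Suc_left: "A \<in> carrier_mat d d \<Longrightarrow> A * A ^\<^sub>m n = A ^\<^sub>m (Suc n :: nat)"
  for A :: "'k :: semiring_1 mat"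
  using commute_pow[of A A d n] by simp

lemma mat_horner_replicate:
  fixes A :: "'k :: field mat"
  assumes A: "A \<in> carrier_mat d d"
  shows "mat_horner A (replicate N 0 @ cs) = A ^\<^sub>m N * mat_horner A cs"
proof (induction N)
  case 0
  show ?case using left_mult_one_mat[OF mat_horner_carrier[OF A, of cs]] carrier_matD[OF A] by simp
next
  case (Suc N)
  note H = mat_horner_carrier[OF A, of cs]
  have AN: "A ^\<^sub>m N \<in> carrier_mat d d" using A by (rule pow_carrier_mat)
  note [simp] = carrier_matD[OF A] carrier_matD[OF H] carrier_matD[OF AN]
  have "mat_horner A (replicate (Suc N) 0 @ cs) = A * (A ^\<^sub>m N * mat_horner A cs)"
    by (simp add: Suc) (rule eq_matI; simp)
  also have "\<dots> = A * A ^\<^sub>m N * mat_horner A cs" by (simp add: mult_mat_assoc_dim)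
  finally show ?case unfolding pow_mat_Suc_left[OF A] .
qed

lemma mat_horner_entry:
  fixes A :: "'k :: field mat"
  assumes A: "A \<in> carrier_mat d d" and "X \<in> carrier_mat d d" "r < d" "s < d"
  shows "(X * mat_horner A cs) $$ (r, s) = (\<Sum>i<length cs. cs ! i * (X * A ^\<^sub>m i) $$ (r, s))"
  using assms(2)
proof (induction cs arbitrary: X)
  case Nil
  then show ?case using A assms(3,4) by (simp add: mult_zero_mat_dim del: index_mult_mat(1))
next
  case (Cons c cs)
  note H = mat_horner_carrier[OF A, of cs]
  have AN: "A ^\<^sub>m i \<in> carrier_mat d d" for i using A by (rule pow_carrier_mat)
  note [simp] = carrier_matD[OF A] carrier_matD[OF H] carrier_matD[OF AN] carrier_matD[OF Cons.prems]
  have "X * mat_horner A (c # cs) = c \<cdot>\<^sub>m X + X * A * mat_horner A cs"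
    by (simp add: mult_mat_add_dim mult_smult_dim mult_one_mat_dim mult_mat_assoc_dim)
  moreover have "X * A * A ^\<^sub>m i = X * A ^\<^sub>m Suc i" for i
    unfolding pow_mat_Suc_left[OF A, symmetric] by (simp add: mult_mat_assoc_dim)
  moreover have "X * A ^\<^sub>m 0 = X" by (simp add: mult_one_mat_dim)
  ultimately show ?case
    using Cons.IH[of "X * A"] Cons.prems A assms(3,4)
    by (simp add: sum.lessThan_Suc_shift del: index_mult_mat(1) pow_mat.simps sum.lessThan_Suc)
qed

lemma mat_annihilating_list:
  fixes A :: "'k :: field mat"
  assumes A: "A \<in> carrier_mat d d"
  obtains N c cs where "c \<noteq> 0" "A ^\<^sub>m N * mat_horner A (c # cs) = 0\<^sub>m d d"
proof -
  obtain c where c: "\<exists>i\<le>d * d. c i \<noteq> 0"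
    "\<And>j. j < d * d \<Longrightarrow> (\<Sum>i\<le>d * d. c i * (A ^\<^sub>m i) $$ (j div d, j mod d)) = 0"
    by (rule linear_relation[of "d * d" "\<lambda>i j. (A ^\<^sub>m i) $$ (j div d, j mod d)"]) blast
  define cs where "cs = map c [0..<Suc (d * d)]"
  note H = mat_horner_carrier[OF A, of cs]
  have "mat_horner A cs = 0\<^sub>m d d"
  proof (rule eq_matI)
    fix r s assume "r < dim_row (0\<^sub>m d d :: 'k mat)" "s < dim_col (0\<^sub>m d d :: 'k mat)"
    then have rs: "r < d" "s < d" by auto
    have "r * d + s < Suc r * d" using rs by simp
    also have "\<dots> \<le> d * d" using rs by (intro mult_le_mono1) simp
    finally have j: "r * d + s < d * d" .
    have AN: "A ^\<^sub>m i \<in> carrier_mat d d" for i using A by (rule pow_carrier_mat)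
    have "mat_horner A cs $$ (r, s) = (1\<^sub>m d * mat_horner A cs) $$ (r, s)"
      using H by (simp add: one_mat_mult_dim)
    also have "\<dots> = (\<Sum>i<length cs. cs ! i * (1\<^sub>m d * A ^\<^sub>m i) $$ (r, s))"
      by (rule mat_horner_entry[OF A _ rs]) simp
    also have "\<dots> = (\<Sum>i\<le>d * d. c i * (A ^\<^sub>m i) $$ (r, s))"
      by (intro sum.cong) (auto simp: cs_def left_mult_one_mat[OF AN] nth_append less_Suc_eq_le simp del: upt_Suc)
    also have "\<dots> = 0" using c(2)[OF j] rs by simp
    finally show "mat_horner A cs $$ (r, s) = 0\<^sub>m d d $$ (r, s)" using rs by simp
  qed (use H in auto)
  note H0 = this
  have "\<exists>x\<in>set cs. x \<noteq> 0" using c(1) by (auto simp: cs_def less_Suc_eq_le simp del: upt_Suc)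
  then have "\<exists>N x xs. cs = replicate N 0 @ x # xs \<and> x \<noteq> 0"
  proof (induction cs)
    case (Cons y ys)
    show ?case
    proof (cases "y = 0")
      case True
      with Cons obtain N x xs where "ys = replicate N 0 @ x # xs" "x \<noteq> 0" by auto
      with True show ?thesis by (intro exI[of _ "Suc N"] exI[of _ x] exI[of _ xs]) simp
    next
      case False
      then show ?thesis by (intro exI[of _ 0] exI[of _ y] exI[of _ ys]) simp
    qed
  qed simp
  then obtain N x xs where cs: "cs = replicate N 0 @ x # xs" "x \<noteq> 0" by blast
  show thesis using H0 unfolding cs(1) mat_horner_replicate[OF A] by (rule that[OF cs(2)])
qed

text \<open>Fitting's lemma: a suitable power of a polynomial in \<open>A\<close> is the projection onto the part on which
  \<open>A\<close> is invertible.\<close>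

lemma fitting_idempotent:
  fixes A :: "'k :: field mat"
  assumes A: "A \<in> carrier_mat d d"
  obtains e where "e \<in> carrier_mat d d" "e * e = e"
    "\<forall>X\<in>carrier_mat d d. X * A = A * X \<longrightarrow> X * e = e * X"
    "e = 1\<^sub>m d \<longrightarrow> (\<exists>B\<in>carrier_mat d d. A * B = 1\<^sub>m d)"
    "e = 0\<^sub>m d d \<longrightarrow> (\<exists>n. A ^\<^sub>m n = 0\<^sub>m d d)"
proof -
  obtain N c cs where c: "c \<noteq> 0" "A ^\<^sub>m N * mat_horner A (c # cs) = 0\<^sub>m d d"
    using A by (rule mat_annihilating_list)
  define H where "H = (- 1 / c) \<cdot>\<^sub>m mat_horner A cs"
  have H: "H \<in> carrier_mat d d" using mat_horner_carrier[OF A] by (simp add: H_def)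
  have AN: "A ^\<^sub>m i \<in> carrier_mat d d" for i using A by (rule pow_carrier_mat)
  have HN: "H ^\<^sub>m i \<in> carrier_mat d d" for i using H by (rule pow_carrier_mat)
  have BN: "(A * H) ^\<^sub>m i \<in> carrier_mat d d" for i using A H by (intro pow_carrier_mat) auto
  note [simp] = carrier_matD[OF A] carrier_matD[OF H] carrier_matD[OF AN] carrier_matD[OF HN]
    carrier_matD[OF BN] carrier_matD[OF mat_horner_carrier[OF A]]
  have comH: "X * H = H * X" if "X \<in> carrier_mat d d" "X * A = A * X" for X
    using mat_horner_commute[OF that(2,1) A, of cs] that(1)
    by (simp add: H_def mult_smult_dim smult_mult_dim)
  have comB: "X * (A * H) = A * H * X" if "X \<in> carrier_mat d d" "X * A = A * X" for X
    by (rule commute_mult[OF that(2) comH[OF that] that(1) A H])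
  have "c \<cdot>\<^sub>m A ^\<^sub>m N + A ^\<^sub>m N * (A * mat_horner A cs) = 0\<^sub>m d d"
    using c(2) by (simp add: mult_mat_add_dim mult_smult_dim mult_one_mat_dim)
  note c2 = this
  have rel: "(A ^\<^sub>m N) $$ (i, j) = - (1 / c) * (A ^\<^sub>m N * (A * mat_horner A cs)) $$ (i, j)"
    if ij: "i < d" "j < d" for i j
  proof -
    have "(c \<cdot>\<^sub>m A ^\<^sub>m N + A ^\<^sub>m N * (A * mat_horner A cs)) $$ (i, j) = 0"
      unfolding c2 using ij by simp
    then have "c * (A ^\<^sub>m N) $$ (i, j) + (A ^\<^sub>m N * (A * mat_horner A cs)) $$ (i, j) = 0"
      using ij by (simp del: index_mult_mat(1))
    then show ?thesis using c(1) by (simp add: field_simps eq_neg_iff_add_eq_0 del: index_mult_mat(1))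
  qed
  have relN: "A ^\<^sub>m N = A ^\<^sub>m N * (A * H)"
  proof (rule eq_matI)
    fix i j assume "i < dim_row (A ^\<^sub>m N * (A * H))" "j < dim_col (A ^\<^sub>m N * (A * H))"
    then have ij: "i < d" "j < d" by simp_all
    have "A ^\<^sub>m N * (A * H) = (- 1 / c) \<cdot>\<^sub>m (A ^\<^sub>m N * (A * mat_horner A cs))"
      by (simp add: H_def mult_smult_dim)
    then show "(A ^\<^sub>m N) $$ (i, j) = (A ^\<^sub>m N * (A * H)) $$ (i, j)"
      using rel[OF ij] ij by (simp del: index_mult_mat(1))
  qed simp_all
  have "A ^\<^sub>m Suc N = A ^\<^sub>m N * (A * H) * A" using relN by simp
  also have "\<dots> = A ^\<^sub>m Suc N * (A * H)" using comB[OF A refl] by (simp add: mult_mat_assoc_dim)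
  finally have rel1: "A ^\<^sub>m Suc N * (A * H) = A ^\<^sub>m Suc N" ..
  have relk: "A ^\<^sub>m Suc N * (A * H) ^\<^sub>m k = A ^\<^sub>m Suc N" for k
  proof (induction k)
    case 0
    then show ?case by (simp add: mult_one_mat_dim)
  next
    case (Suc k)
    have "A ^\<^sub>m Suc N * (A * H) ^\<^sub>m Suc k = (A ^\<^sub>m Suc N * (A * H) ^\<^sub>m k) * (A * H)"
      by (simp add: mult_mat_assoc_dim)
    then show ?case using rel1 by (simp only: Suc)
  qed
  define e where "e = (A * H) ^\<^sub>m Suc N"
  have e: "e \<in> carrier_mat d d" unfolding e_def by (rule BN)
  have e_eq: "e = A ^\<^sub>m Suc N * H ^\<^sub>m Suc N"
    unfolding e_def by (rule mult_pow_commute[OF comH[OF A refl] A H])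
  show thesis
  proof (rule that[OF e])
    have HB: "H * (A * H) = A * H * H" by (rule commute_mult[of _ _ _ d]) (use comH[OF A refl] H A in auto)
    have com: "H ^\<^sub>m Suc N * e = e * H ^\<^sub>m Suc N"
      unfolding e_def
      by (intro commute_pow[of _ _ d] commute_pow[of "A * H" H d, symmetric] HB[symmetric] HN) (use A H in auto)
    have "e * e = A ^\<^sub>m Suc N * (H ^\<^sub>m Suc N * e)"
      using e by (subst (1) e_eq) (simp add: mult_mat_assoc_dim del: pow_mat.simps)
    also have "\<dots> = (A ^\<^sub>m Suc N * e) * H ^\<^sub>m Suc N"
      unfolding com using e by (simp add: mult_mat_assoc_dim del: pow_mat.simps)
    also have "\<dots> = e" unfolding e_def relk by (simp only: e_eq[unfolded e_def])
    finally show "e * e = e" .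
    have "X * e = e * X" if "X \<in> carrier_mat d d" "X * A = A * X" for X
      unfolding e_def by (rule commute_pow[OF comB[OF that] that(1)]) (use A H in auto)
    then show "\<forall>X\<in>carrier_mat d d. X * A = A * X \<longrightarrow> X * e = e * X" by simp
    have "\<exists>B\<in>carrier_mat d d. A * B = 1\<^sub>m d" if "e = 1\<^sub>m d"
    proof
      show "A * (A ^\<^sub>m N * H ^\<^sub>m Suc N) = 1\<^sub>m d"
        using that unfolding e_eq pow_mat_Suc_left[OF A, symmetric]
        by (simp add: mult_mat_assoc_dim del: pow_mat.simps)
    qed (auto intro!: carrier_matI)
    then show "e = 1\<^sub>m d \<longrightarrow> (\<exists>B\<in>carrier_mat d d. A * B = 1\<^sub>m d)" ..
    have "\<exists>n. A ^\<^sub>m n = 0\<^sub>m d d" if "e = 0\<^sub>m d d"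
      using relk[of "Suc N"] that unfolding e_def[symmetric]
      by (intro exI[of _ "Suc N"]) (simp add: mult_zero_mat_dim del: pow_mat.simps)
    then show "e = 0\<^sub>m d d \<longrightarrow> (\<exists>n. A ^\<^sub>m n = 0\<^sub>m d d)" ..
  qed
qed

lemma nilpotent_one_minus_inverse:
  fixes A :: "'k :: field mat"
  assumes A: "A \<in> carrier_mat d d" and "A ^\<^sub>m n = 0\<^sub>m d d"
  shows "\<exists>B\<in>carrier_mat d d. (1\<^sub>m d - A) * B = 1\<^sub>m d"
proof -
  have AN: "A ^\<^sub>m i \<in> carrier_mat d d" for i using A by (rule pow_carrier_mat)
  note [simp] = carrier_matD[OF A] carrier_matD[OF AN]
  have "\<exists>B\<in>carrier_mat d d. (1\<^sub>m d - A) * B = 1\<^sub>m d - A ^\<^sub>m k" for k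
  proof (induction k)
    case 0
    show ?case by (intro bexI[of _ "0\<^sub>m d d"]) (simp_all add: mult_zero_mat_dim minus_self_mat)
  next
    case (Suc k)
    then obtain B where B: "B \<in> carrier_mat d d" "(1\<^sub>m d - A) * B = 1\<^sub>m d - A ^\<^sub>m k" by blast
    note [simp] = carrier_matD[OF B(1)]
    have "(1\<^sub>m d - A) * (B + A ^\<^sub>m k) = (1\<^sub>m d - A ^\<^sub>m k) + (A ^\<^sub>m k - A * A ^\<^sub>m k)"
      by (simp add: mult_mat_add_dim B(2) minus_mat_mult_dim one_mat_mult_dim)
    also have "\<dots> = 1\<^sub>m d - A ^\<^sub>m Suc k"
      unfolding pow_mat_Suc_left[OF A] by (rule eq_matI) (simp_all del: pow_mat.simps index_mult_mat(1))
    finally show ?case using B(1) by (intro bexI[of _ "B + A ^\<^sub>m k"]) (simp_all add: AN)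
  qed
  from this[of n] assms(2) show ?thesis by (simp add: minus_zero_mat_dim)
qed

lemma module_variety_family: "m \<in> module_variety scale d \<Longrightarrow> mat_family d m"
  by (simp add: module_variety_def mat_family_def)

lemma module_variety_compress:
  fixes m :: "'a :: {ring, monoid_mult} \<Rightarrow> 'k :: field mat"
  assumes m: "m \<in> module_variety scale d" and n: "mat_family e n"
    and p: "p \<in> carrier_mat e d" and i: "i \<in> carrier_mat d e" and pi: "p * i = 1\<^sub>m e"
    and hom: "\<And>a. m a * i = i * n a"
  shows "n \<in> module_variety scale e"
proof -
  note [simp] = carrier_matD[OF p] carrier_matD[OF i] mat_familyD[OF n] mat_familyD[OF module_variety_family[OF m]]
  have n_eq: "n a = p * (m a * i)" for a
    by (simp add: hom) (simp add: mult_mat_assoc_dim[symmetric] pi one_mat_mult_dim)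
  have M: "m 1 = 1\<^sub>m d" "m (a + b) = m a + m b" "m (a * b) = m a * m b" "m (scale c a) = c \<cdot>\<^sub>m m a" for a b c
    using m by (simp_all add: module_variety_def)
  have "n (a * b) = n a * n b" for a b
  proof -
    have mi: "m a * (i * X) = i * (n a * X)" if "dim_row X = e" for X
      using that by (simp add: mult_mat_assoc_dim[symmetric] hom)
    have "n (a * b) = p * (m a * (m b * i))" by (simp add: n_eq[of "a * b"] M mult_mat_assoc_dim)
    also have "\<dots> = p * (i * (n a * n b))" by (simp add: hom mi)
    also have "\<dots> = n a * n b" by (simp add: mult_mat_assoc_dim[symmetric] pi one_mat_mult_dim)
    finally show ?thesis .
  qed
  moreover have "n 1 = 1\<^sub>m e" by (simp add: n_eq M pi one_mat_mult_dim)
  moreover have "n (a + b) = n a + n b" for a b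
    by (simp add: n_eq M add_mat_mult_dim mult_mat_add_dim)
  moreover have "n (scale c a) = c \<cdot>\<^sub>m n a" for c a
    by (simp add: n_eq M smult_mult_dim mult_smult_dim)
  ultimately show ?thesis using mat_familyD(1)[OF n] by (simp add: module_variety_def)
qed

lemma direct_sum_Cons:
  assumes "mat_family e n" "mat_family f (direct_sum ns)"
  shows "direct_sum (n # ns) = (\<lambda>a. four_block_mat (n a) (0\<^sub>m e f) (0\<^sub>m f e) (direct_sum ns a))"
  using mat_familyD[OF assms(1)] mat_familyD[OF assms(2)] by (simp add: direct_sum_def Let_def fun_eq_iff)

lemma direct_sum_single: "direct_sum [n] = n"
  by (simp add: direct_sum_def diag_block_mat_singleton del: diag_block_mat.simps)

lemma indecomposable_idempotent:
  fixes m :: "'a :: {ring, monoid_mult} \<Rightarrow> 'k :: field mat"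
  assumes m: "m \<in> module_variety scale d" and ind: "indecomposable scale d m"
    and E: "E \<in> carrier_mat d d" and EE: "E * E = E" and hom: "\<And>a. E * m a = m a * E"
  shows "E = 0\<^sub>m d d \<or> E = 1\<^sub>m d"
proof -
  note fm = module_variety_family[OF m]
  obtain f p q where p: "p \<in> carrier_mat f d" and q: "q \<in> carrier_mat d f" and pq: "p * q = 1\<^sub>m f"
    and qp: "q * p = E"
    by (rule idempotent_factorization[OF E EE])
  note [simp] = carrier_matD[OF p] carrier_matD[OF q] carrier_matD[OF E] mat_familyD[OF fm]
  have Eq: "E * q = q" unfolding qp[symmetric] by (simp add: mult_mat_assoc_dim pq mult_one_mat_dim)
  have pE: "p * E = p" unfolding qp[symmetric]
    by (simp add: mult_mat_assoc_dim[symmetric] pq one_mat_mult_dim)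
  have fn: "mat_family f (\<lambda>a. p * m a * q)" unfolding mat_family_def by (intro allI carrier_matI) simp_all
  have hq: "m a * q = q * (p * m a * q)" for a
  proof -
    have "q * (p * m a * q) = E * m a * q" unfolding qp[symmetric] by (simp add: mult_mat_assoc_dim)
    then show ?thesis by (simp add: hom mult_mat_assoc_dim Eq)
  qed
  have hp: "p * m a = p * m a * q * p" for a
  proof -
    have "p * m a * q * p = p * (m a * E)" unfolding qp[symmetric] by (simp add: mult_mat_assoc_dim)
    also have "\<dots> = p * E * m a" by (simp add: hom[symmetric] mult_mat_assoc_dim)
    finally show ?thesis by (simp add: pE)
  qed
  obtain f' n' q' p' where split: "mod_split d m f (\<lambda>a. p * m a * q) f' n' q p q' p'"
    by (rule mod_split_section[OF fm fn q p pq hq hp])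
  then interpret S: mod_split d m f "\<lambda>a. p * m a * q" f' n' q p q' p' .
  have "f = 0 \<or> f' = 0"
  proof (rule ccontr)
    assume "\<not> (f = 0 \<or> f' = 0)"
    then have ge: "f \<ge> 1" "f' \<ge> 1" by auto
    have "(\<lambda>a. p * m a * q) \<in> module_variety scale f"
      by (rule module_variety_compress[OF m fn p q pq hq])
    moreover have "n' \<in> module_variety scale f'"
      by (rule module_variety_compress[OF m S.fam2 S.p2 S.i2 S.p2_i2 S.hom_i2])
    moreover
    have "direct_sum [\<lambda>a. p * m a * q, n'] =
        (\<lambda>a. four_block_mat (p * m a * q) (0\<^sub>m f f') (0\<^sub>m f' f) (n' a))"
      using direct_sum_Cons[OF fn, of f' "[n']"] S.fam2 by (simp add: direct_sum_single)
    then have "mod_iso d (direct_sum [\<lambda>a. p * m a * q, n']) d m"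
      using mod_iso_sym[OF S.iso_diag] S.dim_eq by simp
    then have "m \<in> conj_orbit d (direct_sum [\<lambda>a. p * m a * q, n'])"
      using mod_iso_iff_conj_orbit[of d "direct_sum [\<lambda>a. p * m a * q, n']" m]
      by (simp add: mod_iso_def)
    ultimately have "\<exists>e f m1 m2. e \<ge> 1 \<and> f \<ge> 1 \<and> d = e + f \<and> m1 \<in> module_variety scale e \<and>
        m2 \<in> module_variety scale f \<and> m \<in> conj_orbit d (direct_sum [m1, m2])"
      using ge S.dim_eq by (intro exI conjI)
    with ind show False unfolding indecomposable_def by (elim conjE notE)
  qed
  then show ?thesis
  proof
    assume "f = 0"
    then have "q * p = 0\<^sub>m d d" by (intro eq_matI) (auto simp: index_mult_mat_sum simp del: index_mult_mat(1))
    then show ?thesis by (simp add: qp)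
  next
    assume "f' = 0"
    then have "q' * p' = 0\<^sub>m d d" by (intro eq_matI) (auto simp: index_mult_mat_sum simp del: index_mult_mat(1))
    then show ?thesis using S.complete by (simp add: qp plus_zero_mat_dim)
  qed
qed

lemma indecomposable_local:
  fixes m :: "'a :: {ring, monoid_mult} \<Rightarrow> 'k :: field mat"
  assumes m: "m \<in> module_variety scale d" and ind: "indecomposable scale d m"
    and A: "A \<in> carrier_mat d d" and hom: "\<And>a. A * m a = m a * A"
  shows "(\<exists>B\<in>carrier_mat d d. A * B = 1\<^sub>m d) \<or> (\<exists>B\<in>carrier_mat d d. (1\<^sub>m d - A) * B = 1\<^sub>m d)"
proof -
  obtain e where e: "e \<in> carrier_mat d d" "e * e = e"
    and com: "\<forall>X\<in>carrier_mat d d. X * A = A * X \<longrightarrow> X * e = e * X"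
    and one: "e = 1\<^sub>m d \<longrightarrow> (\<exists>B\<in>carrier_mat d d. A * B = 1\<^sub>m d)"
    and zero: "e = 0\<^sub>m d d \<longrightarrow> (\<exists>n. A ^\<^sub>m n = 0\<^sub>m d d)"
    by (rule fitting_idempotent[OF A])
  have "e * m a = m a * e" for a
    using com[rule_format, of "m a"] hom mat_familyD(1)[OF module_variety_family[OF m]] by simp
  from indecomposable_idempotent[OF m ind e this] show ?thesis
  proof
    assume "e = 0\<^sub>m d d"
    with zero obtain n where "A ^\<^sub>m n = 0\<^sub>m d d" by auto
    from nilpotent_one_minus_inverse[OF A this] show ?thesis ..
  next
    assume "e = 1\<^sub>m d"
    with one show ?thesis by simp
  qed
qed

section \<open>The Krull--Remak--Schmidt theorem\<close>

definition total_dim :: "(nat \<times> ('a \<Rightarrow> 'k mat)) list \<Rightarrow> nat" where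
  "total_dim ns = sum_list (map fst ns)"

definition total_sum :: "(nat \<times> ('a \<Rightarrow> 'k :: zero mat)) list \<Rightarrow> 'a \<Rightarrow> 'k mat" where
  "total_sum ns = direct_sum (map snd ns)"

lemma total_sum_family:
  "(\<And>e n. (e, n) \<in> set ns \<Longrightarrow> mat_family e n) \<Longrightarrow> mat_family (total_dim ns) (total_sum ns)"
proof (induction ns)
  case Nil
  then show ?case by (simp add: mat_family_def total_dim_def total_sum_def direct_sum_def)
next
  case (Cons z ns)
  obtain e n where z: "z = (e, n)" by (cases z)
  have n: "mat_family e n" and ns: "mat_family (total_dim ns) (total_sum ns)"
    using Cons by (simp_all add: z)
  show ?case
    using mat_family_diag[OF n ns] direct_sum_Cons[OF n ns[unfolded total_sum_def]]
    by (simp add: z total_dim_def total_sum_def)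
qed

lemma total_Cons:
  assumes "mat_family e n" "mat_family (total_dim ns) (total_sum ns)"
  shows "total_dim ((e, n) # ns) = e + total_dim ns"
    "total_sum ((e, n) # ns) =
      (\<lambda>a. four_block_mat (n a) (0\<^sub>m e (total_dim ns)) (0\<^sub>m (total_dim ns) e) (total_sum ns a))"
  using direct_sum_Cons[OF assms(1) assms(2)[unfolded total_sum_def]]
  by (simp_all add: total_dim_def total_sum_def)

lemma mod_split_total_Cons:
  assumes "mat_family e n" "mat_family (total_dim ns) (total_sum ns)"
  obtains i1 p1 i2 p2 where
    "mod_split (total_dim ((e, n) # ns)) (total_sum ((e, n) # ns)) e n (total_dim ns) (total_sum ns) i1 p1 i2 p2"
  using mod_split_diag[OF assms] unfolding total_Cons[OF assms, symmetric] by (rule that)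

lemma mod_iso_diag_cong:
  assumes "mat_family e n" "mod_iso f z g w"
  shows "mod_iso (e + f) (\<lambda>a. four_block_mat (n a) (0\<^sub>m e f) (0\<^sub>m f e) (z a))
    (e + g) (\<lambda>a. four_block_mat (n a) (0\<^sub>m e g) (0\<^sub>m g e) (w a))"
proof -
  have z: "mat_family f z" using assms(2) by (simp add: mod_iso_def)
  obtain i p where "mod_split (e + f) (\<lambda>a. four_block_mat (n a) (0\<^sub>m e f) (0\<^sub>m f e) (z a)) e n g w
    (vcat (1\<^sub>m e) (0\<^sub>m f e)) (hcat (1\<^sub>m e) (0\<^sub>m e f)) i p"
    by (rule mod_split_iso_summand[OF mod_split_diag[OF assms(1) z] assms(2)])
  then show ?thesis by (rule mod_split.iso_diag)
qed

lemma krull_schmidt_exchange: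
  fixes m :: "'a :: {ring, monoid_mult} \<Rightarrow> 'k :: field mat"
  assumes m: "m \<in> module_variety scale e" and ind: "indecomposable scale e m"
    and "\<And>f n. (f, n) \<in> set ns \<Longrightarrow> n \<in> module_variety scale f \<and> indecomposable scale f n"
    and "mod_split d x e m e' m' i1 p1 i2 p2"
    and "mod_iso d x (total_dim ns) (total_sum ns)"
  shows "\<exists>ys f n zs. ns = ys @ (f, n) # zs \<and> mod_iso e m f n \<and>
    mod_iso e' m' (total_dim (ys @ zs)) (total_sum (ys @ zs))"
  using assms(3-5)
proof (induction ns arbitrary: d x e' m' i1 p1 i2 p2)
  case Nil
  have "d = e + e'" using Nil.prems(2) by (rule mod_split.dim_eq)
  moreover have "d = 0" using mod_iso_dim[OF Nil.prems(3)] by (simp add: total_dim_def)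
  ultimately show ?case using ind by (simp add: indecomposable_def)
next
  case (Cons fn ns)
  obtain f n where fn: "fn = (f, n)" by (cases fn)
  have nv: "n \<in> module_variety scale f" and nind: "indecomposable scale f n"
    using Cons.prems(1)[of f n] by (simp_all add: fn)
  have fams: "mat_family g l" if "(g, l) \<in> set ns" for g l
    using Cons.prems(1)[of g l] that module_variety_family[of l scale g] by simp
  note famn = module_variety_family[OF nv]
  define h where "h = total_dim ns"
  define y where "y = total_sum ns"
  have famy: "mat_family h y" unfolding h_def y_def using fams by (rule total_sum_family)
  obtain k1 r1 k2 r2 where "mod_split (total_dim (fn # ns)) (total_sum (fn # ns)) f n h y k1 r1 k2 r2"
    unfolding fn h_def y_def by (rule mod_split_total_Cons[OF famn famy[unfolded h_def y_def]])
  then obtain j1 q1 j2 q2 where N: "mod_split d x f n h y j1 q1 j2 q2"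
    by (rule mod_split_iso_whole[OF _ mod_iso_sym[OF Cons.prems(3)]])
  note M = Cons.prems(2)
  interpret M: mod_split d x e m e' m' i1 p1 i2 p2 by (rule M)
  interpret N: mod_split d x f n h y j1 q1 j2 q2 by (rule N)
  define \<phi> where "\<phi> = p1 * j1 * (q1 * i1)"
  have \<phi>c: "\<phi> \<in> carrier_mat e e" by (auto simp: \<phi>_def intro!: carrier_matI)
  have sum: "\<phi> + p1 * j2 * (q2 * i1) = 1\<^sub>m e"
    unfolding \<phi>_def using N.complete_between[of p1 i1] by (simp add: M.p1_i1)
  have \<psi>: "1\<^sub>m e - \<phi> = p1 * j2 * (q2 * i1)"
    unfolding sum[symmetric] by (rule eq_matI) (use \<phi>c in \<open>auto simp del: index_mult_mat(1)\<close>)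
  have hom_pj: "p1 * j1 * n a = m a * (p1 * j1)" "p1 * j2 * y a = m a * (p1 * j2)" for a
  proof -
    have "p1 * j1 * n a = p1 * x a * j1" by (simp add: mult_mat_assoc_dim N.hom_i1)
    then show "p1 * j1 * n a = m a * (p1 * j1)" by (simp add: M.hom_p1 mult_mat_assoc_dim)
    have "p1 * j2 * y a = p1 * x a * j2" by (simp add: mult_mat_assoc_dim N.hom_i2)
    then show "p1 * j2 * y a = m a * (p1 * j2)" by (simp add: M.hom_p1 mult_mat_assoc_dim)
  qed
  have hom_qi: "q1 * i1 * m a = n a * (q1 * i1)" "q2 * i1 * m a = y a * (q2 * i1)" for a
  proof -
    have "q1 * i1 * m a = q1 * x a * i1" by (simp add: mult_mat_assoc_dim M.hom_i1)
    then show "q1 * i1 * m a = n a * (q1 * i1)" by (simp add: N.hom_p1 mult_mat_assoc_dim)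
    have "q2 * i1 * m a = q2 * x a * i1" by (simp add: mult_mat_assoc_dim M.hom_i1)
    then show "q2 * i1 * m a = y a * (q2 * i1)" by (simp add: N.hom_p2 mult_mat_assoc_dim)
  qed
  have inv: "B * m a = m a * B \<and> B * A = 1\<^sub>m e"
    if A: "A \<in> carrier_mat e e" and B: "B \<in> carrier_mat e e" and AB: "A * B = 1\<^sub>m e"
      and hom: "A * m a = m a * A" for A B :: "'k mat" and a
  proof -
    note [simp] = carrier_matD[OF A] carrier_matD[OF B]
    have BA: "B * A = 1\<^sub>m e" by (rule mat_mult_left_right_inverse[OF A B AB])
    have "B * m a = B * (m a * (A * B))" by (simp add: AB mult_one_mat_dim)
    also have "\<dots> = B * (A * m a) * B" by (simp add: hom mult_mat_assoc_dim)
    also have "\<dots> = B * A * (m a * B)" by (simp add: mult_mat_assoc_dim)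
    also have "\<dots> = m a * B" by (simp add: BA one_mat_mult_dim)
    finally show ?thesis using BA by simp
  qed
  have hom_\<phi>: "\<phi> * m a = m a * \<phi>" for a
  proof -
    have "\<phi> * m a = p1 * j1 * n a * (q1 * i1)"
      unfolding \<phi>_def by (simp add: mult_mat_assoc_dim hom_qi[unfolded mult_mat_assoc_dim[of q1 i1 "m _", simplified]])
    then show ?thesis by (simp add: hom_pj \<phi>_def) (simp add: mult_mat_assoc_dim)
  qed
  from indecomposable_local[OF m ind \<phi>c hom_\<phi>] show ?case
  proof
    assume "\<exists>B\<in>carrier_mat e e. \<phi> * B = 1\<^sub>m e"
    then obtain t where t: "t \<in> carrier_mat e e" "\<phi> * t = 1\<^sub>m e" by blast
    note [simp] = carrier_matD[OF t(1)]
    have tm: "t * m a = m a * t" and t\<phi>: "t * \<phi> = 1\<^sub>m e" for a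
      using inv[OF \<phi>c t(1,2) hom_\<phi>] by blast+
    define b where "b = t * (p1 * j1)"
    have b: "b \<in> carrier_mat e f" by (auto simp: b_def intro!: carrier_matI)
    note [simp] = carrier_matD[OF b]
    have bq: "b * (q1 * i1) = 1\<^sub>m e"
      using t\<phi> unfolding b_def \<phi>_def by (simp add: mult_mat_assoc_dim)
    have hom_b: "b * n a = m a * b" for a
    proof -
      have "b * n a = t * (p1 * j1 * n a)" unfolding b_def by (simp add: mult_mat_assoc_dim)
      also have "\<dots> = t * m a * (p1 * j1)" unfolding hom_pj by (simp add: mult_mat_assoc_dim)
      finally show ?thesis unfolding tm b_def by (simp add: mult_mat_assoc_dim)
    qed
    have E: "q1 * i1 * b \<in> carrier_mat f f" by (auto intro!: carrier_matI)
    have "q1 * i1 * b * (q1 * i1 * b) = q1 * i1 * (b * (q1 * i1)) * b" by (simp add: mult_mat_assoc_dim)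
    then have EE: "q1 * i1 * b * (q1 * i1 * b) = q1 * i1 * b" by (simp add: bq mult_one_mat_dim)
    have hom_E: "q1 * i1 * b * n a = n a * (q1 * i1 * b)" for a
    proof -
      have "q1 * i1 * b * n a = q1 * i1 * m a * b" by (simp add: mult_mat_assoc_dim hom_b)
      then show ?thesis unfolding hom_qi by (simp add: mult_mat_assoc_dim)
    qed
    have "q1 * i1 * b \<noteq> 0\<^sub>m f f"
    proof
      assume 0: "q1 * i1 * b = 0\<^sub>m f f"
      have "1\<^sub>m e = b * (q1 * i1) * (b * (q1 * i1))" by (simp add: bq)
      also have "\<dots> = b * (q1 * i1 * b) * (q1 * i1)" by (simp add: mult_mat_assoc_dim)
      also have "\<dots> = 0\<^sub>m e e" by (simp add: 0 mult_zero_mat_dim zero_mat_mult_dim)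
      finally have "(1\<^sub>m e :: 'k mat) $$ (0, 0) = 0\<^sub>m e e $$ (0, 0)" by simp
      then show False using ind by (simp add: indecomposable_def)
    qed
    with indecomposable_idempotent[OF nv nind E EE hom_E] have qb: "q1 * i1 * b = 1\<^sub>m f" by blast
    have "mod_iso e m f n"
      by (rule mod_isoI[OF M.fam1 N.fam1, of "q1 * i1" b])
        (use b qb bq hom_qi in \<open>auto intro!: carrier_matI\<close>)
    moreover have "mod_iso e' m' h y" by (rule mod_split_cancel[OF M N b qb bq])
    ultimately show ?thesis
      by (intro exI[of _ "[]"] exI[of _ f] exI[of _ n] exI[of _ ns]) (simp add: fn h_def y_def)
  next
    assume "\<exists>B\<in>carrier_mat e e. (1\<^sub>m e - \<phi>) * B = 1\<^sub>m e"
    then obtain t where t: "t \<in> carrier_mat e e" "p1 * j2 * (q2 * i1) * t = 1\<^sub>m e" unfolding \<psi> by blast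
    note [simp] = carrier_matD[OF t(1)]
    have \<psi>c: "p1 * j2 * (q2 * i1) \<in> carrier_mat e e" by (auto intro!: carrier_matI)
    have hom_\<psi>: "p1 * j2 * (q2 * i1) * m a = m a * (p1 * j2 * (q2 * i1))" for a
    proof -
      have "p1 * j2 * (q2 * i1) * m a = p1 * j2 * (q2 * i1 * m a)" by (simp add: mult_mat_assoc_dim)
      also have "\<dots> = p1 * j2 * y a * (q2 * i1)" unfolding hom_qi by (simp add: mult_mat_assoc_dim)
      finally show ?thesis unfolding hom_pj by (simp add: mult_mat_assoc_dim)
    qed
    have tm: "t * m a = m a * t" and t\<psi>: "t * (p1 * j2 * (q2 * i1)) = 1\<^sub>m e" for a
      using inv[OF \<psi>c t(1,2) hom_\<psi>] by blast+
    define c where "c = q2 * i1"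
    define s where "s = t * (p1 * j2)"
    have c: "c \<in> carrier_mat h e" by (auto simp: c_def intro!: carrier_matI)
    have s: "s \<in> carrier_mat e h" by (auto simp: s_def intro!: carrier_matI)
    note [simp] = carrier_matD[OF c] carrier_matD[OF s]
    have sc: "s * c = 1\<^sub>m e" using t\<psi> unfolding s_def c_def by (simp add: mult_mat_assoc_dim)
    have hom_c: "y a * c = c * m a" for a unfolding c_def hom_qi ..
    have hom_s: "s * y a = m a * s" for a
    proof -
      have "s * y a = t * (p1 * j2 * y a)" unfolding s_def by (simp add: mult_mat_assoc_dim)
      also have "\<dots> = t * m a * (p1 * j2)" unfolding hom_pj by (simp add: mult_mat_assoc_dim)
      finally show ?thesis unfolding tm s_def by (simp add: mult_mat_assoc_dim)
    qed
    obtain g z q p where Y: "mod_split h y e m g z c s q p"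
      by (rule mod_split_section[OF famy M.fam1 c s sc hom_c hom_s])
    then have famz: "mat_family g z" by (rule mod_split.fam2)
    have "mod_iso h y (total_dim ns) (total_sum ns)"
      unfolding h_def[symmetric] y_def[symmetric] by (rule mod_iso_refl[OF famy])
    with Y Cons.prems(1) obtain ys f' n' zs where IH: "ns = ys @ (f', n') # zs" "mod_iso e m f' n'"
      "mod_iso g z (total_dim (ys @ zs)) (total_sum (ys @ zs))"
      using Cons.IH[of h y g z c s q p] by auto
    obtain i r where R: "mod_split d x e m (f + g) (\<lambda>a. four_block_mat (n a) (0\<^sub>m f g) (0\<^sub>m g f) (z a))
      (j2 * c) (s * q2) i r"
      by (rule mod_split_regroup[OF N Y])
    have 1: "s * q2 * i1 = 1\<^sub>m e" using sc unfolding c_def by (simp add: mult_mat_assoc_dim)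
    have "mod_iso e' m' (f + g) (\<lambda>a. four_block_mat (n a) (0\<^sub>m f g) (0\<^sub>m g f) (z a))"
      by (rule mod_split_cancel[OF M R, of "1\<^sub>m e"]) (simp_all add: 1)
    moreover have "mod_iso (f + g) (\<lambda>a. four_block_mat (n a) (0\<^sub>m f g) (0\<^sub>m g f) (z a))
      (total_dim ((f, n) # ys @ zs)) (total_sum ((f, n) # ys @ zs))"
    proof -
      have "mat_family (total_dim (ys @ zs)) (total_sum (ys @ zs))"
        using IH(3) by (simp add: mod_iso_def)
      then show ?thesis
        using mod_iso_diag_cong[OF famn IH(3)] total_Cons[OF famn, of "ys @ zs"] by simp
    qed
    ultimately have "mod_iso e' m' (total_dim (((f, n) # ys) @ zs)) (total_sum (((f, n) # ys) @ zs))"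
      unfolding append_Cons by (rule mod_iso_trans)
    then show ?thesis using IH(1,2)
      by (intro exI[of _ "(f, n) # ys"] exI[of _ f'] exI[of _ n'] exI[of _ zs]) (simp add: fn)
  qed
qed

theorem krull_remak_schmidt:
  fixes ms ns :: "(nat \<times> ('a :: {ring, monoid_mult} \<Rightarrow> 'k :: field mat)) list"
  assumes "\<And>e m. (e, m) \<in> set ms \<Longrightarrow> m \<in> module_variety scale e \<and> indecomposable scale e m"
    and "\<And>f n. (f, n) \<in> set ns \<Longrightarrow> n \<in> module_variety scale f \<and> indecomposable scale f n"
    and "mod_iso (total_dim ms) (total_sum ms) (total_dim ns) (total_sum ns)"
  shows "\<exists>ls. mset ls = mset ns \<and> list_all2 (\<lambda>(e, m) (f, n). mod_iso e m f n) ms ls"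
  using assms
proof (induction ms arbitrary: ns)
  case Nil
  have "total_dim ns = 0" using mod_iso_dim[OF Nil.prems(3)] by (simp add: total_dim_def)
  have "ns = []"
  proof (cases ns)
    case (Cons z zs)
    obtain f n where z: "z = (f, n)" by (cases z)
    have "indecomposable scale f n" using Nil.prems(2)[of f n] by (simp add: Cons z)
    then have "f > 0" by (simp add: indecomposable_def)
    with \<open>total_dim ns = 0\<close> show ?thesis by (simp add: total_dim_def Cons z)
  qed
  then show ?case by simp
next
  case (Cons em ms)
  obtain e m where em: "em = (e, m)" by (cases em)
  have m: "m \<in> module_variety scale e" "indecomposable scale e m"
    using Cons.prems(1)[of e m] by (simp_all add: em)
  have "mat_family (total_dim ms) (total_sum ms)"
  proof (rule total_sum_family)
    show "mat_family e m" if "(e, m) \<in> set ms" for e m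
      using Cons.prems(1)[of e m] that module_variety_family[of m scale e] by simp
  qed
  then obtain i1 p1 i2 p2 where split: "mod_split (total_dim (em # ms)) (total_sum (em # ms)) e m
      (total_dim ms) (total_sum ms) i1 p1 i2 p2"
    unfolding em by (rule mod_split_total_Cons[OF module_variety_family[OF m(1)]])
  obtain ys f n zs where ns: "ns = ys @ (f, n) # zs" "mod_iso e m f n"
    "mod_iso (total_dim ms) (total_sum ms) (total_dim (ys @ zs)) (total_sum (ys @ zs))"
    using krull_schmidt_exchange[OF m Cons.prems(2) split Cons.prems(3)] by blast
  have "\<exists>ls. mset ls = mset (ys @ zs) \<and> list_all2 (\<lambda>(e, m) (f, n). mod_iso e m f n) ms ls"
    using Cons.prems(1,2) by (intro Cons.IH ns(3)) (auto simp: ns(1))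
  then obtain ls where "mset ls = mset (ys @ zs)" "list_all2 (\<lambda>(e, m) (f, n). mod_iso e m f n) ms ls"
    by blast
  then show ?case using ns(1,2) by (intro exI[of _ "(f, n) # ls"]) (simp add: em)
qed

section \<open>Irreducible sets\<close>

abbreviation top_closure :: "'x topology \<Rightarrow> 'x set \<Rightarrow> 'x set" where
  "top_closure \<equiv> Abstract_Topology.closure_of"

lemma irreducible_inD:
  "irreducible_in X S \<Longrightarrow> closedin X Y \<Longrightarrow> closedin X Z \<Longrightarrow> S \<subseteq> Y \<union> Z \<Longrightarrow> S \<subseteq> Y \<or> S \<subseteq> Z"
  unfolding irreducible_in_def by simp

lemma irreducible_in_subset: "irreducible_in X S \<Longrightarrow> S \<subseteq> topspace X"
  by (simp add: irreducible_in_def)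

lemma irreducible_in_nonempty: "irreducible_in X S \<Longrightarrow> S \<noteq> {}"
  by (simp add: irreducible_in_def)

lemma irreducible_in_closure:
  assumes "irreducible_in X S"
  shows "irreducible_in X (top_closure X S)"
  unfolding irreducible_in_def
proof (intro conjI allI impI)
  have sub: "S \<subseteq> top_closure X S"
    by (rule closure_of_subset[OF irreducible_in_subset[OF assms]])
  then show "top_closure X S \<noteq> {}" using irreducible_in_nonempty[OF assms] by auto
  show "top_closure X S \<subseteq> topspace X" by (rule closure_of_subset_topspace)
  fix Y Z assume YZ: "closedin X Y \<and> closedin X Z \<and> top_closure X S \<subseteq> Y \<union> Z"
  with sub have "S \<subseteq> Y \<or> S \<subseteq> Z" by (intro irreducible_inD[OF assms]) auto
  with YZ show "top_closure X S \<subseteq> Y \<or> top_closure X S \<subseteq> Z"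
    by (auto dest: closure_of_minimal)
qed

lemma irreducible_in_image:
  assumes f: "continuous_map X Y f" and S: "irreducible_in X S"
  shows "irreducible_in Y (f ` S)"
  unfolding irreducible_in_def
proof (intro conjI allI impI)
  note sub = irreducible_in_subset[OF S]
  show "f ` S \<subseteq> topspace Y" using f sub unfolding continuous_map_closedin by blast
  show "f ` S \<noteq> {}" using irreducible_in_nonempty[OF S] by simp
  fix A B assume AB: "closedin Y A \<and> closedin Y B \<and> f ` S \<subseteq> A \<union> B"
  have "S \<subseteq> {x \<in> topspace X. f x \<in> A} \<or> S \<subseteq> {x \<in> topspace X. f x \<in> B}"
    using AB f sub unfolding continuous_map_closedin by (intro irreducible_inD[OF S]) auto
  then show "f ` S \<subseteq> A \<or> f ` S \<subseteq> B" by auto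
qed

text \<open>Only continuity in each variable separately is used, so no topology on the product is needed.\<close>

lemma irreducible_in_image2:
  assumes A: "irreducible_in X A"
    and cont: "\<And>b. b \<in> B \<Longrightarrow> continuous_map X Z (\<lambda>a. \<phi> a b)"
    and irr: "\<And>a. a \<in> A \<Longrightarrow> irreducible_in Z (\<phi> a ` B)"
  shows "irreducible_in Z (\<Union>a\<in>A. \<phi> a ` B)"
  unfolding irreducible_in_def
proof (intro conjI allI impI)
  show "(\<Union>a\<in>A. \<phi> a ` B) \<subseteq> topspace Z" using irreducible_in_subset[OF irr] by auto
  obtain a where a: "a \<in> A" using irreducible_in_nonempty[OF A] by blast
  then have B: "B \<noteq> {}" using irreducible_in_nonempty[OF irr] by auto
  then show "(\<Union>a\<in>A. \<phi> a ` B) \<noteq> {}" using a by auto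
  fix P Q assume PQ: "closedin Z P \<and> closedin Z Q \<and> (\<Union>a\<in>A. \<phi> a ` B) \<subseteq> P \<union> Q"
  define R where "R P = (\<Inter>b\<in>B. {a \<in> topspace X. \<phi> a b \<in> P})" for P
  have R: "closedin X (R P)" if "closedin Z P" for P
    unfolding R_def using B cont that unfolding continuous_map_closedin
    by (intro closedin_INT) auto
  have "A \<subseteq> R P \<union> R Q"
  proof
    fix a assume a: "a \<in> A"
    have "\<phi> a ` B \<subseteq> P \<union> Q" using PQ a by auto
    then have "\<phi> a ` B \<subseteq> P \<or> \<phi> a ` B \<subseteq> Q"
      using PQ by (intro irreducible_inD[OF irr[OF a]]) auto
    then show "a \<in> R P \<union> R Q" using a irreducible_in_subset[OF A] by (auto simp: R_def)
  qed
  then have "A \<subseteq> R P \<or> A \<subseteq> R Q" using PQ by (intro irreducible_inD[OF A] R) auto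
  then show "(\<Union>a\<in>A. \<phi> a ` B) \<subseteq> P \<or> (\<Union>a\<in>A. \<phi> a ` B) \<subseteq> Q"
    by (auto simp: R_def)
qed

lemma irreducible_in_finite_cover:
  assumes S: "irreducible_in X S" and fin: "finite \<K>"
    and "\<And>K. K \<in> \<K> \<Longrightarrow> closedin X K" and "S \<subseteq> \<Union>\<K>"
  shows "\<exists>K\<in>\<K>. S \<subseteq> K"
  using fin assms(3,4)
proof induction
  case empty
  then show ?case using irreducible_in_nonempty[OF S] by simp
next
  case (insert K \<K>)
  have "closedin X (\<Union>\<K>)" using insert by (intro closedin_Union) auto
  then have "S \<subseteq> K \<or> S \<subseteq> \<Union>\<K>" using insert by (intro irreducible_inD[OF S]) auto
  then show ?case using insert by auto
qed

lemma irreducible_open_dense: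
  assumes C: "irreducible_in X C" and V: "openin X V" and ne: "V \<inter> C \<noteq> {}"
  shows "C \<subseteq> top_closure X (V \<inter> C)"
proof -
  have sub: "V \<inter> C \<subseteq> top_closure X (V \<inter> C)"
    using irreducible_in_subset[OF C] by (intro closure_of_subset) auto
  have "C \<subseteq> (topspace X - V) \<or> C \<subseteq> top_closure X (V \<inter> C)"
    using irreducible_in_subset[OF C] V sub by (intro irreducible_inD[OF C]) auto
  then show ?thesis using ne by auto
qed

lemma irreducible_open_Int:
  assumes C: "irreducible_in X C" and V: "openin X V" "V \<inter> C \<noteq> {}" and W: "openin X W" "W \<inter> C \<noteq> {}"
  shows "V \<inter> W \<inter> C \<noteq> {}"
proof
  assume "V \<inter> W \<inter> C = {}"
  then have "C \<subseteq> (topspace X - V) \<or> C \<subseteq> (topspace X - W)"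
    using irreducible_in_subset[OF C] V W by (intro irreducible_inD[OF C]) auto
  then show False using V(2) W(2) by auto
qed

lemma general_in_irreducible_iff:
  assumes C: "irreducible_in X C"
  shows "general_in X C P \<longleftrightarrow> (\<exists>V. openin X V \<and> V \<inter> C \<noteq> {} \<and> (\<forall>x\<in>V \<inter> C. P x))"
proof
  assume "general_in X C P"
  then obtain U where U: "openin (subtopology X C) U" "top_closure (subtopology X C) U = C" "\<forall>x\<in>U. P x"
    unfolding general_in_def by blast
  obtain V where V: "openin X V" "U = V \<inter> C" using U(1) unfolding openin_subtopology by blast
  have "U \<noteq> {}" using U(2) irreducible_in_nonempty[OF C] by auto
  then show "\<exists>V. openin X V \<and> V \<inter> C \<noteq> {} \<and> (\<forall>x\<in>V \<inter> C. P x)" using V U(3) by blast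
next
  assume "\<exists>V. openin X V \<and> V \<inter> C \<noteq> {} \<and> (\<forall>x\<in>V \<inter> C. P x)"
  then obtain V where V: "openin X V" "V \<inter> C \<noteq> {}" "\<forall>x\<in>V \<inter> C. P x" by blast
  have "C \<inter> (V \<inter> C) = V \<inter> C" by blast
  then have "top_closure (subtopology X C) (V \<inter> C) = C"
    using irreducible_open_dense[OF C V(1,2)] unfolding closure_of_subtopology by auto
  moreover have "openin (subtopology X C) (V \<inter> C)" using V(1) unfolding openin_subtopology by blast
  ultimately show "general_in X C P" unfolding general_in_def using V(3) by blast
qed

lemma irreducible_component_irreducible: "irreducible_component X C \<Longrightarrow> irreducible_in X C"
  by (simp add: irreducible_component_def)

lemma irreducible_component_maximal:
  "irreducible_component X C \<Longrightarrow> irreducible_in X S \<Longrightarrow> C \<subseteq> S \<Longrightarrow> C = S"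
  by (auto simp: irreducible_component_def)

lemma irreducible_component_closed:
  assumes "irreducible_component X C"
  shows "closedin X C"
proof -
  have C: "irreducible_in X C" using assms by (rule irreducible_component_irreducible)
  have "C = top_closure X C"
    by (rule irreducible_component_maximal[OF assms irreducible_in_closure[OF C]
          closure_of_subset[OF irreducible_in_subset[OF C]]])
  then show ?thesis by (metis closedin_closure_of)
qed

lemma irreducible_in_component:
  assumes "irreducible_in X S"
  shows "\<exists>C. irreducible_component X C \<and> S \<subseteq> C"
proof -
  define \<A> where "\<A> = {T. irreducible_in X T \<and> S \<subseteq> T}"
  have "\<exists>M\<in>\<A>. \<forall>T\<in>\<A>. M \<subseteq> T \<longrightarrow> T = M"
  proof (rule subset_Zorn_nonempty)
    show "\<A> \<noteq> {}" using assms by (auto simp: \<A>_def)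
    fix \<C> assume ne: "\<C> \<noteq> {}" and "subset.chain \<A> \<C>"
    then have sub: "\<C> \<subseteq> \<A>" and lin: "\<And>T U. T \<in> \<C> \<Longrightarrow> U \<in> \<C> \<Longrightarrow> T \<subseteq> U \<or> U \<subseteq> T"
      by (auto simp: subset_chain_def)
    have irr: "irreducible_in X T" "S \<subseteq> T" if "T \<in> \<C>" for T using that sub by (auto simp: \<A>_def)
    have "irreducible_in X (\<Union>\<C>)"
      unfolding irreducible_in_def
    proof (intro conjI allI impI)
      show "\<Union>\<C> \<subseteq> topspace X" using irreducible_in_subset[OF irr(1)] by auto
      show "\<Union>\<C> \<noteq> {}" using ne irr(2) irreducible_in_nonempty[OF assms] by auto
      fix Y Z assume YZ: "closedin X Y \<and> closedin X Z \<and> \<Union>\<C> \<subseteq> Y \<union> Z"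
      show "\<Union>\<C> \<subseteq> Y \<or> \<Union>\<C> \<subseteq> Z"
      proof (rule ccontr)
        assume "\<not> (\<Union>\<C> \<subseteq> Y \<or> \<Union>\<C> \<subseteq> Z)"
        then obtain T U where TU: "T \<in> \<C>" "U \<in> \<C>" "\<not> T \<subseteq> Y" "\<not> U \<subseteq> Z" by auto
        then obtain V where V: "V \<in> \<C>" "T \<subseteq> V" "U \<subseteq> V" using lin[OF TU(1,2)] by blast
        have "V \<subseteq> Y \<or> V \<subseteq> Z" using YZ V(1) by (intro irreducible_inD[OF irr(1)]) auto
        then show False using TU V by auto
      qed
    qed
    moreover have "S \<subseteq> \<Union>\<C>" using ne irr(2) by auto
    ultimately show "\<Union>\<C> \<in> \<A>" by (simp add: \<A>_def)
  qed
  then obtain M where M: "irreducible_in X M" "S \<subseteq> M"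
    and max: "\<forall>T. irreducible_in X T \<and> S \<subseteq> T \<longrightarrow> M \<subseteq> T \<longrightarrow> T = M"
    by (auto simp: \<A>_def)
  then have "irreducible_component X M" unfolding irreducible_component_def by (meson subset_trans)
  with M(2) show ?thesis by blast
qed

lemma noetherian_irreducible_cover:
  assumes wf: "wf {(A, B). closedin X A \<and> closedin X B \<and> A \<subset> B}" and "closedin X Z"
  shows "\<exists>\<K>. finite \<K> \<and> (\<forall>K\<in>\<K>. irreducible_in X K) \<and> Z = \<Union>\<K>"
  using wf assms(2)
proof (induction Z rule: wf_induct_rule)
  case (less Z)
  show ?case
  proof (cases "Z = {} \<or> irreducible_in X Z")
    case True
    then show ?thesis
    proof
      assume "Z = {}"
      then show ?thesis by (intro exI[of _ "{}"]) simp
    next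
      assume "irreducible_in X Z"
      then show ?thesis by (intro exI[of _ "{Z}"]) simp
    qed
  next
    case False
    then obtain Y W where YW: "closedin X Y" "closedin X W" "Z \<subseteq> Y \<union> W" "\<not> Z \<subseteq> Y" "\<not> Z \<subseteq> W"
      using closedin_subset[OF less.prems] unfolding irreducible_in_def by auto
    have "closedin X (Z \<inter> Y)" "closedin X (Z \<inter> W)" using YW less.prems by auto
    moreover have "Z \<inter> Y \<subset> Z" "Z \<inter> W \<subset> Z" using YW by auto
    ultimately have
      "\<exists>\<K>. finite \<K> \<and> (\<forall>K\<in>\<K>. irreducible_in X K) \<and> Z \<inter> Y = \<Union>\<K>"
      "\<exists>\<K>. finite \<K> \<and> (\<forall>K\<in>\<K>. irreducible_in X K) \<and> Z \<inter> W = \<Union>\<K>"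
      using less.prems by (auto intro!: less.IH)
    then obtain \<K> \<L> where KL: "finite \<K>" "\<forall>K\<in>\<K>. irreducible_in X K" "Z \<inter> Y = \<Union>\<K>"
      "finite \<L>" "\<forall>K\<in>\<L>. irreducible_in X K" "Z \<inter> W = \<Union>\<L>"
      by (elim exE conjE)
    have "Z = (Z \<inter> Y) \<union> (Z \<inter> W)" using YW(3) by auto
    also have "\<dots> = \<Union>(\<K> \<union> \<L>)" unfolding KL(3,6) by (rule Union_Un_distrib[symmetric])
    finally have "Z = \<Union>(\<K> \<union> \<L>)" .
    then show ?thesis using KL by (intro exI[of _ "\<K> \<union> \<L>"]) auto
  qed
qed

lemma noetherian_component_cover:
  assumes wf: "wf {(A, B). closedin X A \<and> closedin X B \<and> A \<subset> B}"
  obtains \<K> where "finite \<K>" "\<forall>K\<in>\<K>. irreducible_component X K" "topspace X = \<Union>\<K>"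
proof -
  obtain \<K> where K: "finite \<K>" "\<forall>K\<in>\<K>. irreducible_in X K" "topspace X = \<Union>\<K>"
    using noetherian_irreducible_cover[OF wf closedin_topspace] by (elim exE conjE)
  have "\<forall>K\<in>\<K>. \<exists>C. irreducible_component X C \<and> K \<subseteq> C"
    using K(2) irreducible_in_component by metis
  from bchoice[OF this] obtain f where
    f: "\<forall>K\<in>\<K>. irreducible_component X (f K) \<and> K \<subseteq> f K" by blast
  have "\<Union> (f ` \<K>) \<subseteq> topspace X"
  proof (rule UN_least)
    show "f K \<subseteq> topspace X" if "K \<in> \<K>" for K
      using f that irreducible_in_subset[OF irreducible_component_irreducible, of X "f K"] by simp
  qed
  moreover have "topspace X \<subseteq> \<Union> (f ` \<K>)" unfolding K(3) using f by (auto simp: subset_iff)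
  ultimately show thesis using f K(1) by (intro that[of "f ` \<K>"]) auto
qed

section \<open>The topology of module varieties\<close>

definition conj_mod :: "'k mat \<Rightarrow> 'k mat \<Rightarrow> ('a \<Rightarrow> 'k :: field mat) \<Rightarrow> 'a \<Rightarrow> 'k mat" where
  "conj_mod g h m = (\<lambda>a. g * m a * h)"

definition GL :: "nat \<Rightarrow> ('k :: field mat \<times> 'k mat) set" where
  "GL d = {(g, h). g \<in> carrier_mat d d \<and> h \<in> carrier_mat d d \<and> g * h = 1\<^sub>m d \<and> h * g = 1\<^sub>m d}"

definition mod_sum :: "nat \<Rightarrow> ('a \<Rightarrow> 'k mat) \<Rightarrow> nat \<Rightarrow> ('a \<Rightarrow> 'k :: zero mat) \<Rightarrow> 'a \<Rightarrow> 'k mat" where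
  "mod_sum e m f n = (\<lambda>a. four_block_mat (m a) (0\<^sub>m e f) (0\<^sub>m f e) (n a))"

lemma conj_orbit_eq: "conj_orbit d m = (\<lambda>(g, h). conj_mod g h m) ` GL d"
  unfolding conj_orbit_def conj_mod_def GL_def image_def by auto

lemma GL_D:
  assumes "(g, h) \<in> GL d"
  shows "g \<in> carrier_mat d d" "h \<in> carrier_mat d d" "g * h = 1\<^sub>m d" "h * g = 1\<^sub>m d"
  using assms by (auto simp: GL_def)

lemma one_GL: "(1\<^sub>m d, 1\<^sub>m d) \<in> GL d"
  by (simp add: GL_def)

lemma module_varietyI:
  assumes "\<And>a. m a \<in> carrier_mat d d" "m 1 = 1\<^sub>m d" "\<And>a b. m (a + b) = m a + m b"
    "\<And>a b. m (a * b) = m a * m b" "\<And>c a. m (scale c a) = c \<cdot>\<^sub>m m a"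
  shows "m \<in> module_variety scale d"
  using assms by (simp add: module_variety_def)

lemma module_varietyD:
  assumes "m \<in> module_variety scale d"
  shows "m a \<in> carrier_mat d d" "m 1 = 1\<^sub>m d" "m (a + b) = m a + m b"
    "m (a * b) = m a * m b" "m (scale c a) = c \<cdot>\<^sub>m m a"
  using assms by (simp_all add: module_variety_def)

lemma mod_iso_module_variety:
  assumes "m \<in> module_variety scale d" "mod_iso d m e n"
  shows "n \<in> module_variety scale e"
proof -
  obtain u v where *: "mat_family d m" "mat_family e n" "u \<in> carrier_mat e d" "v \<in> carrier_mat d e"
    "u * v = 1\<^sub>m e" "v * u = 1\<^sub>m d" "\<forall>a. u * m a = n a * u" "\<forall>a. v * n a = m a * v"
    using assms(2) by (rule mod_isoE)
  show ?thesis
    by (rule module_variety_compress[OF assms(1) *(2,3,4,5)]) (simp add: *(8))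
qed

lemma conj_mod_iso:
  assumes "mat_family d m" "(g, h) \<in> GL d"
  shows "mod_iso d m d (conj_mod g h m)"
  using assms by (auto simp: mod_iso_iff_conj_orbit conj_orbit_eq)

lemma conj_mod_module_variety:
  assumes "m \<in> module_variety scale d" "(g, h) \<in> GL d"
  shows "conj_mod g h m \<in> module_variety scale d"
  by (rule mod_iso_module_variety[OF assms(1) conj_mod_iso[OF module_variety_family[OF assms(1)] assms(2)]])

lemma mult_diag_block_mat:
  fixes A B C D :: "'k :: semiring_1 mat"
  assumes "A \<in> carrier_mat p q" "B \<in> carrier_mat r s" "C \<in> carrier_mat q x" "D \<in> carrier_mat s y"
  shows "four_block_mat A (0\<^sub>m p s) (0\<^sub>m r q) B * four_block_mat C (0\<^sub>m q y) (0\<^sub>m s x) D =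
    four_block_mat (A * C) (0\<^sub>m p y) (0\<^sub>m r x) (B * D)"
proof -
  have "A * C + 0\<^sub>m p s * 0\<^sub>m s x = A * C" "A * 0\<^sub>m q y + 0\<^sub>m p s * D = 0\<^sub>m p y"
    "0\<^sub>m r q * C + B * 0\<^sub>m s x = 0\<^sub>m r x" "0\<^sub>m r q * 0\<^sub>m q y + B * D = B * D"
    using assms by auto
  then show ?thesis
    using mult_four_block_mat[OF assms(1) zero_carrier_mat zero_carrier_mat assms(2,3)
        zero_carrier_mat zero_carrier_mat assms(4)] by simp
qed

lemma mod_sum_module_variety:
  fixes m n :: "'a :: {ring, monoid_mult} \<Rightarrow> 'k :: field mat"
  assumes m: "m \<in> module_variety scale e" and n: "n \<in> module_variety scale f"
  shows "mod_sum e m f n \<in> module_variety scale (e + f)"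
proof (rule module_varietyI)
  note M = module_varietyD[OF m] and N = module_varietyD[OF n]
  fix a b c
  note [simp] = carrier_matD[OF M(1)] carrier_matD[OF N(1)]
  show "mod_sum e m f n a \<in> carrier_mat (e + f) (e + f)"
    unfolding mod_sum_def by (rule four_block_carrier_mat[OF M(1) N(1)])
  show "mod_sum e m f n 1 = 1\<^sub>m (e + f)" by (simp add: mod_sum_def M N)
  show "mod_sum e m f n (a + b) = mod_sum e m f n a + mod_sum e m f n b"
    unfolding mod_sum_def M N by (rule eq_matI) auto
  show "mod_sum e m f n (a * b) = mod_sum e m f n a * mod_sum e m f n b"
    unfolding mod_sum_def M N
    by (subst mult_diag_block_mat[OF M(1) N(1) M(1) N(1)]) (rule refl)
  show "mod_sum e m f n (scale c a) = c \<cdot>\<^sub>m mod_sum e m f n a"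
    unfolding mod_sum_def M N by (rule eq_matI) auto
qed

lemma mod_iso_mod_sum:
  assumes "mod_iso e m e' m'" "mod_iso f n f' n'"
  shows "mod_iso (e + f) (mod_sum e m f n) (e' + f') (mod_sum e' m' f' n')"
proof -
  obtain u v where *: "mat_family e m" "mat_family e' m'" "u \<in> carrier_mat e' e" "v \<in> carrier_mat e e'"
    "u * v = 1\<^sub>m e'" "v * u = 1\<^sub>m e" "\<forall>a. u * m a = m' a * u" "\<forall>a. v * m' a = m a * v"
    using assms(1) by (rule mod_isoE)
  obtain s t where **: "mat_family f n" "mat_family f' n'" "s \<in> carrier_mat f' f" "t \<in> carrier_mat f f'"
    "s * t = 1\<^sub>m f'" "t * s = 1\<^sub>m f" "\<forall>a. s * n a = n' a * s" "\<forall>a. t * n' a = n a * t"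
    using assms(2) by (rule mod_isoE)
  note [simp] = *(3,4) **(3,4) mat_familyD[OF *(1)] mat_familyD[OF *(2)]
    mat_familyD[OF **(1)] mat_familyD[OF **(2)]
  show ?thesis
  proof (rule mod_isoI[of _ _ _ _ "four_block_mat u (0\<^sub>m e' f) (0\<^sub>m f' e) s" "four_block_mat v (0\<^sub>m e f') (0\<^sub>m f e') t"])
    show "mat_family (e + f) (mod_sum e m f n)" "mat_family (e' + f') (mod_sum e' m' f' n')"
      unfolding mod_sum_def using * ** by (auto intro: mat_family_diag)
    show "four_block_mat u (0\<^sub>m e' f) (0\<^sub>m f' e) s * four_block_mat v (0\<^sub>m e f') (0\<^sub>m f e') t = 1\<^sub>m (e' + f')"
      by (subst mult_diag_block_mat) (auto simp: *(5) **(5))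
    show "four_block_mat v (0\<^sub>m e f') (0\<^sub>m f e') t * four_block_mat u (0\<^sub>m e' f) (0\<^sub>m f' e) s = 1\<^sub>m (e + f)"
      by (subst mult_diag_block_mat) (auto simp: *(6) **(6))
    fix a
    show "four_block_mat u (0\<^sub>m e' f) (0\<^sub>m f' e) s * mod_sum e m f n a =
        mod_sum e' m' f' n' a * four_block_mat u (0\<^sub>m e' f) (0\<^sub>m f' e) s"
      unfolding mod_sum_def
      by (subst mult_diag_block_mat[of _ e' e _ f' f], simp_all)
        (subst mult_diag_block_mat[of _ e' e' _ f' f'], simp_all add: *(7) **(7))
  qed (auto intro: four_block_carrier_mat)
qed

locale fg_alg_closed = fg_algebra scale gens
  for scale :: "'k :: alg_closed_field \<Rightarrow> 'a :: {ring, monoid_mult} \<Rightarrow> 'a" and gens :: "'a set"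
begin

abbreviation mv :: "nat \<Rightarrow> ('a \<Rightarrow> 'k mat) set" where "mv \<equiv> module_variety scale"
abbreviation mt :: "nat \<Rightarrow> ('a \<Rightarrow> 'k mat) topology" where "mt \<equiv> module_topology scale gens"
abbreviation gv :: "nat \<Rightarrow> ('a \<Rightarrow> 'k mat) \<Rightarrow> 'a \<times> nat \<times> nat \<Rightarrow> 'k" where "gv \<equiv> gen_values gens"
abbreviation ci :: "nat \<Rightarrow> ('a \<times> nat \<times> nat) set" where "ci \<equiv> coord_index gens"

lemma finite_ci: "finite (ci d)"
  by (simp add: coord_index_def finite_gens)

lemma gv_extensional: "gv d m \<in> ci d \<rightarrow>\<^sub>E UNIV"
  by (auto simp: gen_values_def)

lemma closedin_mt:
  "closedin (mt d) Z \<longleftrightarrow> (\<exists>F \<subseteq> poly_fun (ci d). Z = {m \<in> mv d. \<forall>f\<in>F. f (gv d m) = 0})"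
proof
  assume "closedin (mt d) Z"
  then have Z: "Z \<subseteq> mv d" "openin (mt d) (mv d - Z)"
    by (auto simp: closedin_def topspace_module_topology)
  obtain U where U: "openin (zariski (ci d)) U" "mv d - Z = gv d -` U \<inter> mv d"
    using Z(2) unfolding module_topology_def openin_pullback_topology by blast
  obtain F where F: "F \<subseteq> poly_fun (ci d)" "U = (ci d \<rightarrow>\<^sub>E UNIV) - zero_locus (ci d) F"
    using U(1) unfolding openin_zariski by blast
  have "Z = {m \<in> mv d. \<forall>f\<in>F. f (gv d m) = 0}"
    using Z(1) U(2) gv_extensional unfolding F(2) zero_locus_def by blast
  with F(1) show "\<exists>F \<subseteq> poly_fun (ci d). Z = {m \<in> mv d. \<forall>f\<in>F. f (gv d m) = 0}" by blast
next
  assume "\<exists>F \<subseteq> poly_fun (ci d). Z = {m \<in> mv d. \<forall>f\<in>F. f (gv d m) = 0}"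
  then obtain F where F: "F \<subseteq> poly_fun (ci d)" "Z = {m \<in> mv d. \<forall>f\<in>F. f (gv d m) = 0}" by blast
  have "mv d - Z = gv d -` ((ci d \<rightarrow>\<^sub>E UNIV) - zero_locus (ci d) F) \<inter> mv d"
    unfolding F(2) zero_locus_def using gv_extensional by blast
  moreover have "openin (zariski (ci d)) ((ci d \<rightarrow>\<^sub>E UNIV) - zero_locus (ci d) F)"
    unfolding openin_zariski using F(1) by blast
  ultimately have "openin (mt d) (mv d - Z)"
    unfolding module_topology_def openin_pullback_topology by blast
  then show "closedin (mt d) Z" using F(2) by (auto simp: closedin_def topspace_module_topology)
qed

lemma wf_closed_mt: "wf {(A, B). closedin (mt d) A \<and> closedin (mt d) B \<and> A \<subset> B}"
  unfolding wf_iff_no_infinite_down_chain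
proof
  assume "\<exists>Z. \<forall>i. (Z (Suc i), Z i) \<in> {(A, B). closedin (mt d) A \<and> closedin (mt d) B \<and> A \<subset> B}"
  then obtain Z where Z0: "\<forall>i. (Z (Suc i), Z i) \<in> {(A, B). closedin (mt d) A \<and> closedin (mt d) B \<and> A \<subset> B}" ..
  have Z: "closedin (mt d) (Z i)" "Z (Suc i) \<subset> Z i" for i
    using spec[OF Z0, of i] unfolding mem_Collect_eq prod.case by (rule conjunct1[OF conjunct2], rule conjunct2[OF conjunct2])
  define S where "S i = {p \<in> poly_fun (ci d). \<forall>m\<in>Z i. p (gv d m) = 0}" for i
  have anti: "Z j \<subseteq> Z i" if "i \<le> j" for i j
    using that
  proof (induction rule: dec_induct)
    case (step k)
    then show ?case using Z(2)[of k] by auto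
  qed simp
  have Smono: "S i \<subseteq> S j" if "i \<le> j" for i j using anti[OF that] by (auto simp: S_def)
  have "(\<Union>i. S i) \<subseteq> poly_fun (ci d)" by (auto simp: S_def)
  then obtain F where F: "F \<subseteq> (\<Union>i. S i)" "finite F"
    "\<And>x. (\<forall>f\<in>(\<Union>i. S i). f x = 0) \<longleftrightarrow> (\<forall>f\<in>F. f x = 0)"
    by (rule finite_equations[OF finite_ci]) auto
  have "\<exists>n. F \<subseteq> S n" using F(2,1)
  proof induction
    case empty
    then show ?case by simp
  next
    case (insert f F)
    then obtain n k where "F \<subseteq> S n" "f \<in> S k" by auto
    then have "insert f F \<subseteq> S (max n k)" 
      using Smono[of n "max n k", simplified] Smono[of k "max n k", simplified] by auto
    then show ?case ..
  qed
  then obtain n where n: "F \<subseteq> S n" ..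
  have "Z n \<subseteq> Z (Suc n)"
  proof
    fix m assume m: "m \<in> Z n"
    have "\<forall>f\<in>F. f (gv d m) = 0" using n m by (auto simp: S_def)
    then have *: "\<forall>f\<in>(\<Union>i. S i). f (gv d m) = 0" by (simp only: F(3))
    obtain G where G: "G \<subseteq> poly_fun (ci d)" "Z (Suc n) = {m \<in> mv d. \<forall>f\<in>G. f (gv d m) = 0}"
      using Z(1)[of "Suc n"] unfolding closedin_mt by blast
    have "G \<subseteq> S (Suc n)" using G by (auto simp: S_def)
    moreover have "m \<in> mv d" using closedin_subset[OF Z(1)] m by (auto simp: topspace_module_topology)
    ultimately show "m \<in> Z (Suc n)" unfolding G(2) using * by auto
  qed
  with Z(2)[of n] show False by blast
qed

lemma continuous_map_mtI:
  assumes \<Phi>: "\<And>m. m \<in> mv e \<Longrightarrow> \<Phi> m \<in> mv d"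
    and p: "\<And>i. i \<in> ci d \<Longrightarrow> p i \<in> poly_fun (ci e)"
      "\<And>i m. i \<in> ci d \<Longrightarrow> m \<in> mv e \<Longrightarrow> gv d (\<Phi> m) i = p i (gv e m)"
  shows "continuous_map (mt e) (mt d) \<Phi>"
  unfolding continuous_map_closedin topspace_module_topology
proof (intro conjI allI impI)
  show "\<Phi> \<in> mv e \<rightarrow> mv d" using \<Phi> by blast
  fix Z assume "closedin (mt d) Z"
  then obtain F where F: "F \<subseteq> poly_fun (ci d)" "Z = {m \<in> mv d. \<forall>f\<in>F. f (gv d m) = 0}"
    unfolding closedin_mt by blast
  define G where "G = (\<lambda>f x. f (\<lambda>i. p i x)) ` F"
  have "G \<subseteq> poly_fun (ci e)"
  proof
    fix g assume "g \<in> G"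
    then obtain f where f: "f \<in> F" "g = (\<lambda>x. f (\<lambda>i. p i x))" unfolding G_def by (elim imageE)
    have "f \<in> poly_fun (ci d)" using f(1) F(1) by (rule rev_subsetD)
    then show "g \<in> poly_fun (ci e)" unfolding f(2) by (rule poly_fun_subst) (rule p(1))
  qed
  moreover have "{m \<in> mv e. \<Phi> m \<in> Z} = {m \<in> mv e. \<forall>f\<in>G. f (gv e m) = 0}"
  proof (rule Collect_cong, rule conj_cong[OF refl])
    fix m assume m: "m \<in> mv e"
    have "(\<forall>f\<in>F. f (gv d (\<Phi> m)) = 0) \<longleftrightarrow> (\<forall>f\<in>F. f (\<lambda>i. p i (gv e m)) = 0)"
    proof (rule ball_cong[OF refl])
      fix f assume "f \<in> F"
      then have "f (gv d (\<Phi> m)) = f (\<lambda>i. p i (gv e m))"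
        using F(1) p(2)[OF _ m] by (intro poly_fun_cong[of f "ci d"]) auto
      then show "f (gv d (\<Phi> m)) = 0 \<longleftrightarrow> f (\<lambda>i. p i (gv e m)) = 0" by (simp only:)
    qed
    then show "\<Phi> m \<in> Z \<longleftrightarrow> (\<forall>f\<in>G. f (gv e m) = 0)"
      using \<Phi>[OF m] by (simp add: F(2) G_def)
  qed
  ultimately show "closedin (mt e) {m \<in> mv e. \<Phi> m \<in> Z}" unfolding closedin_mt by blast
qed

end

definition poly_mat :: "'v set \<Rightarrow> nat \<Rightarrow> nat \<Rightarrow> (('v \<Rightarrow> 'k :: field) \<Rightarrow> 'k mat) \<Rightarrow> bool" where
  "poly_mat I r c M \<longleftrightarrow> (\<forall>x. M x \<in> carrier_mat r c) \<and> (\<forall>i<r. \<forall>j<c. (\<lambda>x. M x $$ (i, j)) \<in> poly_fun I)"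

lemma poly_mat_carrier: "poly_mat I r c M \<Longrightarrow> M x \<in> carrier_mat r c"
  by (simp add: poly_mat_def)

lemma poly_mat_entry: "poly_mat I r c M \<Longrightarrow> i < r \<Longrightarrow> j < c \<Longrightarrow> (\<lambda>x. M x $$ (i, j)) \<in> poly_fun I"
  by (simp add: poly_mat_def)

lemma poly_matI:
  "(\<And>x. M x \<in> carrier_mat r c) \<Longrightarrow> (\<And>i j. i < r \<Longrightarrow> j < c \<Longrightarrow> (\<lambda>x. M x $$ (i, j)) \<in> poly_fun I) \<Longrightarrow>
    poly_mat I r c M"
  by (simp add: poly_mat_def)

lemma poly_mat_const: "A \<in> carrier_mat r c \<Longrightarrow> poly_mat I r c (\<lambda>_. A)"
  by (intro poly_matI poly_fun.const)

lemma poly_mat_coords: "(\<And>i j. i < r \<Longrightarrow> j < c \<Longrightarrow> v i j \<in> I) \<Longrightarrow> poly_mat I r c (\<lambda>x. mat r c (\<lambda>(i, j). x (v i j)))"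
proof (rule poly_matI)
  fix i j assume "i < r" "j < c" "\<And>i j. i < r \<Longrightarrow> j < c \<Longrightarrow> v i j \<in> I"
  then show "(\<lambda>x. mat r c (\<lambda>(i, j). x (v i j)) $$ (i, j)) \<in> poly_fun I"
    by (simp add: poly_fun.coord)
qed simp

lemma poly_mat_mult:
  assumes M: "poly_mat I r s M" and N: "poly_mat I s c N"
  shows "poly_mat I r c (\<lambda>x. M x * N x)"
proof (rule poly_matI)
  note [simp] = carrier_matD[OF poly_mat_carrier[OF M]] carrier_matD[OF poly_mat_carrier[OF N]]
  show "M x * N x \<in> carrier_mat r c" for x by (intro carrier_matI) simp_all
  fix i j assume ij: "i < r" "j < c"
  have "(\<lambda>x. (M x * N x) $$ (i, j)) = (\<lambda>x. \<Sum>k<s. M x $$ (i, k) * N x $$ (k, j))"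
    using ij by (intro ext) (subst index_mult_mat_sum, simp_all)
  moreover have "(\<lambda>x. \<Sum>k<s. M x $$ (i, k) * N x $$ (k, j)) \<in> poly_fun I"
    using ij by (intro poly_fun_sum poly_fun.mult poly_mat_entry[OF M] poly_mat_entry[OF N]) auto
  ultimately show "(\<lambda>x. (M x * N x) $$ (i, j)) \<in> poly_fun I" by simp
qed

lemma poly_mat_add:
  assumes M: "poly_mat I r c M" and N: "poly_mat I r c N"
  shows "poly_mat I r c (\<lambda>x. M x + N x)"
proof (rule poly_matI)
  note [simp] = carrier_matD[OF poly_mat_carrier[OF M]] carrier_matD[OF poly_mat_carrier[OF N]]
  show "M x + N x \<in> carrier_mat r c" for x by (intro carrier_matI) simp_all
  fix i j assume ij: "i < r" "j < c"
  then show "(\<lambda>x. (M x + N x) $$ (i, j)) \<in> poly_fun I"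
    using poly_fun.add[OF poly_mat_entry[OF M ij] poly_mat_entry[OF N ij]] by simp
qed

lemma poly_mat_smult:
  assumes M: "poly_mat I r c M"
  shows "poly_mat I r c (\<lambda>x. k \<cdot>\<^sub>m M x)"
proof (rule poly_matI)
  note [simp] = carrier_matD[OF poly_mat_carrier[OF M]]
  show "k \<cdot>\<^sub>m M x \<in> carrier_mat r c" for x by (intro carrier_matI) simp_all
  fix i j assume ij: "i < r" "j < c"
  then show "(\<lambda>x. (k \<cdot>\<^sub>m M x) $$ (i, j)) \<in> poly_fun I"
    using poly_fun.mult[OF poly_fun.const poly_mat_entry[OF M ij], of k] by simp
qed

lemma poly_mat_diag:
  assumes M: "poly_mat I e e M" and N: "poly_mat I f f N"
  shows "poly_mat I (e + f) (e + f) (\<lambda>x. four_block_mat (M x) (0\<^sub>m e f) (0\<^sub>m f e) (N x))"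
proof (rule poly_matI)
  note [simp] = carrier_matD[OF poly_mat_carrier[OF M]] carrier_matD[OF poly_mat_carrier[OF N]]
  show "four_block_mat (M x) (0\<^sub>m e f) (0\<^sub>m f e) (N x) \<in> carrier_mat (e + f) (e + f)" for x
    by (intro four_block_carrier_mat poly_mat_carrier[OF M] poly_mat_carrier[OF N])
  fix i j assume ij: "i < e + f" "j < e + f"
  show "(\<lambda>x. four_block_mat (M x) (0\<^sub>m e f) (0\<^sub>m f e) (N x) $$ (i, j)) \<in> poly_fun I"
  proof (cases "i < e")
    case True
    then show ?thesis
      using ij poly_mat_entry[OF M, of i j] poly_fun.const[of 0 I] by (cases "j < e") simp_all
  next
    case False
    then show ?thesis
      using ij poly_mat_entry[OF N, of "i - e" "j - e"] poly_fun.const[of 0 I] by (cases "j < e") simp_all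
  qed
qed

lemma poly_fun_line:
  fixes f :: "('v \<Rightarrow> 'k :: field) \<Rightarrow> 'k" and N :: "'v \<Rightarrow> 'k poly" and D :: "'k poly"
  assumes "f \<in> poly_fun I"
  shows "\<exists>q k. \<forall>t. poly D t \<noteq> 0 \<longrightarrow> poly q t = poly D t ^ k * f (\<lambda>i. poly (N i) t / poly D t)"
  using assms
proof induction
  case (const c)
  show ?case by (intro exI[of _ "[:c:]"] exI[of _ 0]) simp
next
  case (coord v)
  show ?case by (intro exI[of _ "N v"] exI[of _ 1]) simp
next
  case (add f g)
  then obtain q k r l where
    q: "\<forall>t. poly D t \<noteq> 0 \<longrightarrow> poly q t = poly D t ^ k * f (\<lambda>i. poly (N i) t / poly D t)" and
    r: "\<forall>t. poly D t \<noteq> 0 \<longrightarrow> poly r t = poly D t ^ l * g (\<lambda>i. poly (N i) t / poly D t)"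
    by (elim exE)
  show ?case
  proof (intro exI[of _ "q * D ^ l + r * D ^ k"] exI[of _ "k + l"] allI impI)
    fix t assume "poly D t \<noteq> 0"
    then show "poly (q * D ^ l + r * D ^ k) t =
        poly D t ^ (k + l) * (f (\<lambda>i. poly (N i) t / poly D t) + g (\<lambda>i. poly (N i) t / poly D t))"
      using q[rule_format, of t] r[rule_format, of t] by (simp add: power_add algebra_simps)
  qed
next
  case (mult f g)
  then obtain q k r l where
    q: "\<forall>t. poly D t \<noteq> 0 \<longrightarrow> poly q t = poly D t ^ k * f (\<lambda>i. poly (N i) t / poly D t)" and
    r: "\<forall>t. poly D t \<noteq> 0 \<longrightarrow> poly r t = poly D t ^ l * g (\<lambda>i. poly (N i) t / poly D t)"
    by (elim exE)
  show ?case
  proof (intro exI[of _ "q * r"] exI[of _ "k + l"] allI impI)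
    fix t assume "poly D t \<noteq> 0"
    then show "poly (q * r) t =
        poly D t ^ (k + l) * (f (\<lambda>i. poly (N i) t / poly D t) * g (\<lambda>i. poly (N i) t / poly D t))"
      using q[rule_format, of t] r[rule_format, of t] by (simp add: power_add algebra_simps)
  qed
qed

lemma comm_ring_hom_poly: "comm_ring_hom (\<lambda>p. poly p (t :: 'k :: comm_ring_1))"
  by unfold_locales auto

lemma map_mat_poly_mult:
  "A \<in> carrier_mat r s \<Longrightarrow> B \<in> carrier_mat s c \<Longrightarrow>
    map_mat (\<lambda>p. poly p t) (A * B) = map_mat (\<lambda>p. poly p t) A * map_mat (\<lambda>p. poly p (t :: 'k :: comm_ring_1)) B"
  by (rule eq_matI) (auto simp: index_mult_mat_sum poly_sum simp del: index_mult_mat(1))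

text \<open>Two invertible matrices are joined by a line, all but finitely many points of which are invertible;
  the inverse is given by the adjugate.\<close>

lemma GL_line:
  fixes g1 h1 g2 h2 :: "'k :: field mat"
  assumes "(g1, h1) \<in> GL d" "(g2, h2) \<in> GL d"
  obtains G H D where "G \<in> carrier_mat d d" "H \<in> carrier_mat d d"
    "\<forall>t. poly D t \<noteq> 0 \<longrightarrow>
       (map_mat (\<lambda>p. poly p t) G, (1 / poly D t) \<cdot>\<^sub>m map_mat (\<lambda>p. poly p t) H) \<in> GL d"
    "map_mat (\<lambda>p. poly p 0) G = g1" "map_mat (\<lambda>p. poly p 1) G = g2" "poly D 0 \<noteq> 0" "poly D 1 \<noteq> 0"
proof -
  note 1 = GL_D[OF assms(1)] and 2 = GL_D[OF assms(2)]
  define G where "G = mat d d (\<lambda>(i, j). [:g1 $$ (i, j), g2 $$ (i, j) - g1 $$ (i, j):])"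
  have G: "G \<in> carrier_mat d d" by (simp add: G_def)
  note adj = adj_mat[OF G]
  have G0: "map_mat (\<lambda>p. poly p 0) G = g1" by (rule eq_matI) (use 1 in \<open>auto simp: G_def\<close>)
  have G1: "map_mat (\<lambda>p. poly p 1) G = g2" by (rule eq_matI) (use 2 in \<open>auto simp: G_def\<close>)
  have det: "det (map_mat (\<lambda>p. poly p t) G) = poly (det G) t" for t
    using comm_ring_hom.hom_det[OF comm_ring_hom_poly] .
  have nz: "det g \<noteq> 0" if "(g, h) \<in> GL d" for g h :: "'k mat"
  proof
    assume "det g = 0"
    then have "det (g * h) = 0" using det_mult[OF GL_D(1,2)[OF that]] by simp
    then show False using GL_D(3)[OF that] by simp
  qed
  have ev: "map_mat (\<lambda>p. poly p t) G * map_mat (\<lambda>p. poly p t) (adj_mat G) = poly (det G) t \<cdot>\<^sub>m 1\<^sub>m d"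
    "map_mat (\<lambda>p. poly p t) (adj_mat G) * map_mat (\<lambda>p. poly p t) G = poly (det G) t \<cdot>\<^sub>m 1\<^sub>m d" for t
    unfolding map_mat_poly_mult[OF G adj(1), symmetric] map_mat_poly_mult[OF adj(1) G, symmetric] adj(2,3)
    by (rule eq_matI; simp)+
  have inv: "\<forall>t. poly (det G) t \<noteq> 0 \<longrightarrow>
     (map_mat (\<lambda>p. poly p t) G, (1 / poly (det G) t) \<cdot>\<^sub>m map_mat (\<lambda>p. poly p t) (adj_mat G)) \<in> GL d"
  proof (intro allI impI)
    fix t assume nz: "poly (det G) t \<noteq> 0"
    have [simp]: "dim_row G = d" "dim_col G = d" "dim_row (adj_mat G) = d" "dim_col (adj_mat G) = d"
      using G adj(1) by auto
    show "(map_mat (\<lambda>p. poly p t) G, (1 / poly (det G) t) \<cdot>\<^sub>m map_mat (\<lambda>p. poly p t) (adj_mat G)) \<in> GL d"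
      unfolding GL_def using G adj(1) nz
      by (simp add: mult_smult_dim smult_mult_dim ev) (rule eq_matI; simp)
  qed
  have "poly (det G) 0 \<noteq> 0" "poly (det G) 1 \<noteq> 0"
    using nz[OF assms(1)] nz[OF assms(2)] unfolding det[symmetric] G0 G1 by simp_all
  with that[OF G adj(1) inv G0 G1] show thesis by simp
qed

context fg_alg_closed
begin

definition coord_mat :: "nat \<Rightarrow> ('a \<times> nat \<times> nat \<Rightarrow> 'k) \<Rightarrow> 'a \<Rightarrow> 'k mat" where
  "coord_mat d x a = mat d d (\<lambda>(i, j). x (a, i, j))"

lemma poly_mat_coord_mat: "a \<in> gens \<Longrightarrow> poly_mat (ci d) d d (\<lambda>x. coord_mat d x a)"
  unfolding coord_mat_def by (rule poly_mat_coords) (simp add: coord_index_def)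

lemma coord_mat_gv:
  "m \<in> mv d \<Longrightarrow> a \<in> gens \<Longrightarrow> coord_mat d (gv d m) a = m a"
  using module_varietyD(1)[of m scale d a]
  by (intro eq_matI) (auto simp: coord_mat_def gen_values_def coord_index_def)

lemma gv_entry: "(a, i, j) \<in> ci d \<Longrightarrow> gv d m (a, i, j) = m a $$ (i, j)"
  by (simp add: gen_values_def)

lemma ciE:
  assumes "v \<in> ci d"
  obtains a i j where "v = (a, i, j)" "a \<in> gens" "i < d" "j < d"
  using assms by (auto simp: coord_index_def)

lemma continuous_map_poly_mat:
  assumes \<Phi>: "\<And>m. m \<in> mv e \<Longrightarrow> \<Phi> m \<in> mv d"
    and M: "\<And>a. a \<in> gens \<Longrightarrow> poly_mat (ci e) d d (M a)"
    and eq: "\<And>a m. a \<in> gens \<Longrightarrow> m \<in> mv e \<Longrightarrow> \<Phi> m a = M a (gv e m)"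
  shows "continuous_map (mt e) (mt d) \<Phi>"
proof (rule continuous_map_mtI[OF \<Phi>])
  fix v assume v: "v \<in> ci d"
  then obtain a i j where aij: "v = (a, i, j)" "a \<in> gens" "i < d" "j < d" by (rule ciE)
  show "(\<lambda>v x. M (fst v) x $$ snd v) v \<in> poly_fun (ci e)"
    using poly_mat_entry[OF M[OF aij(2)] aij(3,4)] by (simp add: aij(1))
  show "gv d (\<Phi> m) v = (\<lambda>v x. M (fst v) x $$ snd v) v (gv e m)" if m: "m \<in> mv e" for m
    using v eq[OF aij(2) m] by (simp add: aij(1) gv_entry)
qed

lemma continuous_conj_mod:
  assumes gh: "(g, h) \<in> GL d"
  shows "continuous_map (mt d) (mt d) (conj_mod g h)"
proof (rule continuous_map_poly_mat[where M = "\<lambda>a x. g * coord_mat d x a * h"])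
  show "conj_mod g h m \<in> mv d" if "m \<in> mv d" for m by (rule conj_mod_module_variety[OF that gh])
  show "poly_mat (ci d) d d (\<lambda>x. g * coord_mat d x a * h)" if "a \<in> gens" for a
    by (intro poly_mat_mult[of _ d d] poly_mat_const poly_mat_coord_mat that GL_D(1,2)[OF gh])
  show "conj_mod g h m a = g * coord_mat d (gv d m) a * h" if "a \<in> gens" "m \<in> mv d" for a m
    using coord_mat_gv[OF that(2,1)] by (simp add: conj_mod_def)
qed

lemma continuous_mod_sum_left:
  assumes n: "n \<in> mv f"
  shows "continuous_map (mt e) (mt (e + f)) (\<lambda>m. mod_sum e m f n)"
proof (rule continuous_map_poly_mat[where M = "\<lambda>a x. four_block_mat (coord_mat e x a) (0\<^sub>m e f) (0\<^sub>m f e) (n a)"])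
  show "mod_sum e m f n \<in> mv (e + f)" if "m \<in> mv e" for m by (rule mod_sum_module_variety[OF that n])
  show "poly_mat (ci e) (e + f) (e + f) (\<lambda>x. four_block_mat (coord_mat e x a) (0\<^sub>m e f) (0\<^sub>m f e) (n a))"
    if "a \<in> gens" for a
    by (intro poly_mat_diag poly_mat_coord_mat that poly_mat_const module_varietyD(1)[OF n])
  show "mod_sum e m f n a = four_block_mat (coord_mat e (gv e m) a) (0\<^sub>m e f) (0\<^sub>m f e) (n a)"
    if "a \<in> gens" "m \<in> mv e" for a m
    using coord_mat_gv[OF that(2,1)] by (simp add: mod_sum_def)
qed

lemma continuous_mod_sum_right:
  assumes m: "m \<in> mv e"
  shows "continuous_map (mt f) (mt (e + f)) (mod_sum e m f)"
proof (rule continuous_map_poly_mat[where M = "\<lambda>a x. four_block_mat (m a) (0\<^sub>m e f) (0\<^sub>m f e) (coord_mat f x a)"])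
  show "mod_sum e m f n \<in> mv (e + f)" if "n \<in> mv f" for n by (rule mod_sum_module_variety[OF m that])
  show "poly_mat (ci f) (e + f) (e + f) (\<lambda>x. four_block_mat (m a) (0\<^sub>m e f) (0\<^sub>m f e) (coord_mat f x a))"
    if "a \<in> gens" for a
    by (intro poly_mat_diag poly_mat_coord_mat that poly_mat_const module_varietyD(1)[OF m])
  show "mod_sum e m f n a = four_block_mat (m a) (0\<^sub>m e f) (0\<^sub>m f e) (coord_mat f (gv f n) a)"
    if "a \<in> gens" "n \<in> mv f" for a n
    using coord_mat_gv[OF that(2,1)] by (simp add: mod_sum_def)
qed

lemma irreducible_conj_orbit:
  assumes m: "m \<in> mv d"
  shows "irreducible_in (mt d) (conj_orbit d m)"
  unfolding irreducible_in_def topspace_module_topology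
proof (intro conjI allI impI)
  show "conj_orbit d m \<subseteq> mv d" unfolding conj_orbit_eq using conj_mod_module_variety[OF m] by auto
  show "conj_orbit d m \<noteq> {}" unfolding conj_orbit_eq using one_GL by auto
  fix Y Z assume YZ: "closedin (mt d) Y \<and> closedin (mt d) Z \<and> conj_orbit d m \<subseteq> Y \<union> Z"
  show "conj_orbit d m \<subseteq> Y \<or> conj_orbit d m \<subseteq> Z"
  proof (rule ccontr)
    assume "\<not> (conj_orbit d m \<subseteq> Y \<or> conj_orbit d m \<subseteq> Z)"
    then obtain g1 h1 g2 h2 where gh1: "(g1, h1) \<in> GL d" "conj_mod g1 h1 m \<notin> Y"
      and gh2: "(g2, h2) \<in> GL d" "conj_mod g2 h2 m \<notin> Z"
      unfolding conj_orbit_eq by auto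
    obtain F where F: "F \<subseteq> poly_fun (ci d)" "Y = {m \<in> mv d. \<forall>f\<in>F. f (gv d m) = 0}"
      using YZ unfolding closedin_mt by auto
    obtain F' where F': "F' \<subseteq> poly_fun (ci d)" "Z = {m \<in> mv d. \<forall>f\<in>F'. f (gv d m) = 0}"
      using YZ unfolding closedin_mt by auto
    obtain f1 where f1: "f1 \<in> F" "f1 (gv d (conj_mod g1 h1 m)) \<noteq> 0"
      using gh1(2) conj_mod_module_variety[OF m gh1(1)] unfolding F(2) by auto
    obtain f2 where f2: "f2 \<in> F'" "f2 (gv d (conj_mod g2 h2 m)) \<noteq> 0"
      using gh2(2) conj_mod_module_variety[OF m gh2(1)] unfolding F'(2) by auto
    obtain G H D where G: "G \<in> carrier_mat d d" and H: "H \<in> carrier_mat d d"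
      and GH: "\<forall>t. poly D t \<noteq> 0 \<longrightarrow>
       (map_mat (\<lambda>p. poly p t) G, (1 / poly D t) \<cdot>\<^sub>m map_mat (\<lambda>p. poly p t) H) \<in> GL d"
      and G01: "map_mat (\<lambda>p. poly p 0) G = g1" "map_mat (\<lambda>p. poly p 1) G = g2"
      and D01: "poly D 0 \<noteq> 0" "poly D 1 \<noteq> 0"
      by (rule GL_line[OF gh1(1) gh2(1)])
    define M where "M t = conj_mod (map_mat (\<lambda>p. poly p t) G) ((1 / poly D t) \<cdot>\<^sub>m map_mat (\<lambda>p. poly p t) H) m" for t
    have Morb: "M t \<in> conj_orbit d m" if "poly D t \<noteq> 0" for t
      unfolding conj_orbit_eq M_def using GH[rule_format, OF that] by force
    have M0: "M 0 = conj_mod g1 h1 m" and M1: "M 1 = conj_mod g2 h2 m"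
    proof -
      have uniq: "h = h'" if "(g, h) \<in> GL d" "(g, h') \<in> GL d" for g h h' :: "'k mat"
      proof -
        note 1 = GL_D[OF that(1)] and 2 = GL_D[OF that(2)]
        have "h = h * (g * h')" using 1 2 by simp
        also have "\<dots> = (h * g) * h'" using 1 2 by (intro assoc_mult_mat[symmetric])
        finally show ?thesis using 1 2 by simp
      qed
      show "M 0 = conj_mod g1 h1 m" "M 1 = conj_mod g2 h2 m"
        unfolding M_def G01
        using uniq[OF GH[rule_format, OF D01(1), unfolded G01(1)] gh1(1)]
          uniq[OF GH[rule_format, OF D01(2), unfolded G01(2)] gh2(1)] by simp_all
    qed
    define N where "N v = (G * map_mat (\<lambda>c. [:c:]) (m (fst v)) * H) $$ snd v" for v
    have gvM: "gv d (M t) v = poly (N v) t / poly D t" if v: "v \<in> ci d" for v t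
    proof -
      obtain a i j where aij: "v = (a, i, j)" "a \<in> gens" "i < d" "j < d" using v by (rule ciE)
      note ma = module_varietyD(1)[OF m, of a]
      note [simp] = carrier_matD[OF G] carrier_matD[OF H] carrier_matD[OF ma]
      have cm: "map_mat (\<lambda>c. [:c:]) (m a) \<in> carrier_mat d d" by (auto intro!: carrier_matI)
      have "map_mat (\<lambda>p. poly p t) (map_mat (\<lambda>c. [:c:]) (m a)) = m a" by (rule eq_matI) auto
      then have "map_mat (\<lambda>p. poly p t) (G * map_mat (\<lambda>c. [:c:]) (m a) * H) =
          map_mat (\<lambda>p. poly p t) G * m a * map_mat (\<lambda>p. poly p t) H"
        using map_mat_poly_mult[OF mult_carrier_mat[OF G cm] H, of t] map_mat_poly_mult[OF G cm, of t] by simp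
      then have "M t a = (1 / poly D t) \<cdot>\<^sub>m map_mat (\<lambda>p. poly p t) (G * map_mat (\<lambda>c. [:c:]) (m a) * H)"
        by (simp add: M_def conj_mod_def mult_smult_dim)
      then show ?thesis using v aij
        by (simp add: gv_entry N_def del: index_mult_mat(1))
    qed
    have val: "f (gv d (M t)) = f (\<lambda>v. poly (N v) t / poly D t)" if "f \<in> poly_fun (ci d)" for f t
      by (rule poly_fun_cong[OF that]) (rule gvM)
    have f1p: "f1 \<in> poly_fun (ci d)" and f2p: "f2 \<in> poly_fun (ci d)" using f1(1) f2(1) F(1) F'(1) by auto
    obtain q1 k1 where q1: "\<forall>t. poly D t \<noteq> 0 \<longrightarrow> poly q1 t = poly D t ^ k1 * f1 (\<lambda>v. poly (N v) t / poly D t)"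
      using poly_fun_line[OF f1p] by blast
    obtain q2 k2 where q2: "\<forall>t. poly D t \<noteq> 0 \<longrightarrow> poly q2 t = poly D t ^ k2 * f2 (\<lambda>v. poly (N v) t / poly D t)"
      using poly_fun_line[OF f2p] by blast
    have "poly q1 0 \<noteq> 0" using q1[rule_format, OF D01(1)] f1(2) D01(1) val[OF f1p, of 0] by (simp add: M0)
    moreover have "poly q2 1 \<noteq> 0" using q2[rule_format, OF D01(2)] f2(2) D01(2) val[OF f2p, of 1] by (simp add: M1)
    ultimately have "q1 * q2 * D \<noteq> 0" using D01 by auto
    then obtain t where t: "poly (q1 * q2 * D) t \<noteq> 0" using alg_closed_ex_nonzero by blast
    then have Dt: "poly D t \<noteq> 0" by auto
    have "f1 (gv d (M t)) \<noteq> 0" using q1[rule_format, OF Dt] t by (auto simp: val[OF f1p])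
    moreover have "f2 (gv d (M t)) \<noteq> 0" using q2[rule_format, OF Dt] t by (auto simp: val[OF f2p])
    ultimately have "M t \<notin> Y \<union> Z" using f1(1) f2(1) unfolding F(2) F'(2) by auto
    with Morb[OF Dt] YZ show False by auto
  qed
qed

end

datatype ('a, 'k) alg_term =
  Gen 'a | One | Plus "('a, 'k) alg_term" "('a, 'k) alg_term"
| Times "('a, 'k) alg_term" "('a, 'k) alg_term" | Scale 'k "('a, 'k) alg_term"

primrec term_gens :: "('a, 'k) alg_term \<Rightarrow> 'a set" where
  "term_gens (Gen a) = {a}"
| "term_gens One = {}"
| "term_gens (Plus s t) = term_gens s \<union> term_gens t"
| "term_gens (Times s t) = term_gens s \<union> term_gens t"
| "term_gens (Scale c t) = term_gens t"

primrec eval_alg :: "('k \<Rightarrow> 'a \<Rightarrow> 'a) \<Rightarrow> ('a, 'k) alg_term \<Rightarrow> 'a :: {ring, monoid_mult}" where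
  "eval_alg scale (Gen a) = a"
| "eval_alg scale One = 1"
| "eval_alg scale (Plus s t) = eval_alg scale s + eval_alg scale t"
| "eval_alg scale (Times s t) = eval_alg scale s * eval_alg scale t"
| "eval_alg scale (Scale c t) = scale c (eval_alg scale t)"

primrec eval_mat :: "nat \<Rightarrow> ('a \<Rightarrow> 'k mat) \<Rightarrow> ('a, 'k) alg_term \<Rightarrow> 'k :: field mat" where
  "eval_mat d X (Gen a) = X a"
| "eval_mat d X One = 1\<^sub>m d"
| "eval_mat d X (Plus s t) = eval_mat d X s + eval_mat d X t"
| "eval_mat d X (Times s t) = eval_mat d X s * eval_mat d X t"
| "eval_mat d X (Scale c t) = c \<cdot>\<^sub>m eval_mat d X t"

lemma total_sum_append:
  assumes "mat_family (total_dim ns) (total_sum ns)" "mat_family (total_dim ls) (total_sum ls)"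
  shows "total_sum (ns @ ls) = mod_sum (total_dim ns) (total_sum ns) (total_dim ls) (total_sum ls)"
  using mat_familyD[OF assms(1)] mat_familyD[OF assms(2)]
  by (simp add: total_sum_def direct_sum_def mod_sum_def diag_block_mat_append Let_def fun_eq_iff)

lemma total_dim_append: "total_dim (ns @ ls) = total_dim ns + total_dim ls"
  by (simp add: total_dim_def)

lemma total_sum_single: "total_sum [(e, n)] = n"
  by (simp add: total_sum_def direct_sum_single)

lemma total_dim_single: "total_dim [(e, n)] = e"
  by (simp add: total_dim_def)

context fg_alg_closed
begin

subsection \<open>Sums of sets of modules\<close>

definition sum_set :: "nat \<Rightarrow> ('a \<Rightarrow> 'k mat) set \<Rightarrow> nat \<Rightarrow> ('a \<Rightarrow> 'k mat) set \<Rightarrow> ('a \<Rightarrow> 'k mat) set" where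
  "sum_set e S f T = {x. \<exists>m\<in>S. \<exists>n\<in>T. mod_iso (e + f) (mod_sum e m f n) (e + f) x}"

lemma sum_set_mono: "S \<subseteq> S' \<Longrightarrow> T \<subseteq> T' \<Longrightarrow> sum_set e S f T \<subseteq> sum_set e S' f T'"
  unfolding sum_set_def by auto

lemma sum_set_eq:
  assumes "S \<subseteq> mv e" "T \<subseteq> mv f"
  shows "sum_set e S f T = (\<Union>x\<in>(\<Union>m\<in>S. mod_sum e m f ` T). (\<lambda>(g, h). conj_mod g h x) ` GL (e + f))"
proof -
  have iff: "mod_iso (e + f) (mod_sum e m f n) (e + f) x \<longleftrightarrow> x \<in> (\<lambda>(g, h). conj_mod g h (mod_sum e m f n)) ` GL (e + f)"
    if "m \<in> S" "n \<in> T" for m n x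
    using that assms unfolding conj_orbit_eq[symmetric]
    by (intro mod_iso_iff_conj_orbit module_variety_family[of _ scale] mod_sum_module_variety) auto
  show ?thesis
  proof (intro Set.set_eqI iffI)
    fix x assume "x \<in> sum_set e S f T"
    then obtain m n where "m \<in> S" "n \<in> T" "mod_iso (e + f) (mod_sum e m f n) (e + f) x"
      unfolding sum_set_def by (elim CollectE bexE)
    then show "x \<in> (\<Union>x\<in>(\<Union>m\<in>S. mod_sum e m f ` T). (\<lambda>(g, h). conj_mod g h x) ` GL (e + f))"
      using iff[of m n x] by (intro UN_I[of "mod_sum e m f n"] UN_I[of m] imageI) simp_all
  next
    fix x assume "x \<in> (\<Union>x\<in>(\<Union>m\<in>S. mod_sum e m f ` T). (\<lambda>(g, h). conj_mod g h x) ` GL (e + f))"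
    then obtain y where y: "y \<in> (\<Union>m\<in>S. mod_sum e m f ` T)" "x \<in> (\<lambda>(g, h). conj_mod g h y) ` GL (e + f)"
      by (rule UN_E)
    from y(1) obtain m where m: "m \<in> S" "y \<in> mod_sum e m f ` T" by (rule UN_E)
    from m(2) obtain n where n: "y = mod_sum e m f n" "n \<in> T" by (rule imageE)
    show "x \<in> sum_set e S f T"
      unfolding sum_set_def using iff[of m n x] m(1) n y(2)
      by (intro CollectI bexI[of _ m] bexI[of _ n]) simp_all
  qed
qed

lemma sum_setE:
  assumes "x \<in> sum_set e S f T" "S \<subseteq> mv e" "T \<subseteq> mv f"
  obtains m n g h where "m \<in> S" "n \<in> T" "(g, h) \<in> GL (e + f)" "x = conj_mod g h (mod_sum e m f n)"
proof -
  from assms(1) obtain y where y: "y \<in> (\<Union>m\<in>S. mod_sum e m f ` T)"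
    "x \<in> (\<lambda>(g, h). conj_mod g h y) ` GL (e + f)"
    unfolding sum_set_eq[OF assms(2,3)] by (rule UN_E)
  from y(1) obtain m where m: "m \<in> S" "y \<in> mod_sum e m f ` T" by (rule UN_E)
  from m(2) obtain n where n: "y = mod_sum e m f n" "n \<in> T" by (rule imageE)
  from y(2) obtain z where z: "x = (\<lambda>(g, h). conj_mod g h y) z" "z \<in> GL (e + f)" by (rule imageE)
  show thesis
    by (rule that[OF m(1) n(2), of "fst z" "snd z"]) (use z n(1) in \<open>simp_all add: split_beta\<close>)
qed

lemma sum_setI:
  assumes "m \<in> S" "n \<in> T" "(g, h) \<in> GL (e + f)" "S \<subseteq> mv e" "T \<subseteq> mv f"
  shows "conj_mod g h (mod_sum e m f n) \<in> sum_set e S f T"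
proof -
  have "mod_sum e m f n \<in> mv (e + f)" using assms by (intro mod_sum_module_variety) auto
  then have "mod_iso (e + f) (mod_sum e m f n) (e + f) (conj_mod g h (mod_sum e m f n))"
    by (intro conj_mod_iso[OF module_variety_family] assms(3))
  then show ?thesis unfolding sum_set_def using assms(1,2) by (intro CollectI bexI[of _ m] bexI[of _ n])
qed

lemma sum_set_subset:
  assumes "S \<subseteq> mv e" "T \<subseteq> mv f"
  shows "sum_set e S f T \<subseteq> mv (e + f)"
proof
  fix x assume "x \<in> sum_set e S f T"
  then obtain m n where mn: "m \<in> S" "n \<in> T" "mod_iso (e + f) (mod_sum e m f n) (e + f) x"
    unfolding sum_set_def by (elim CollectE bexE)
  have "mod_sum e m f n \<in> mv (e + f)" using assms mn(1,2) by (intro mod_sum_module_variety) auto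
  then show "x \<in> mv (e + f)" using mn(3) by (rule mod_iso_module_variety)
qed

lemma irreducible_conj:
  assumes "irreducible_in (mt d) S"
  shows "irreducible_in (mt d) (\<Union>m\<in>S. (\<lambda>(g, h). conj_mod g h m) ` GL d)"
proof (rule irreducible_in_image2[OF assms])
  show "continuous_map (mt d) (mt d) (\<lambda>m. (\<lambda>(g, h). conj_mod g h m) b)" if "b \<in> GL d" for b
    using continuous_conj_mod[of "fst b" "snd b" d] that by (simp add: split_beta)
  show "irreducible_in (mt d) ((\<lambda>(g, h). conj_mod g h m) ` GL d)" if "m \<in> S" for m
    unfolding conj_orbit_eq[symmetric]
    using irreducible_in_subset[OF assms] that
    by (intro irreducible_conj_orbit) (auto simp: topspace_module_topology)
qed

lemma irreducible_sum_set:
  assumes S: "irreducible_in (mt e) S" and T: "irreducible_in (mt f) T"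
  shows "irreducible_in (mt (e + f)) (sum_set e S f T)"
proof -
  have sub: "S \<subseteq> mv e" "T \<subseteq> mv f"
    using irreducible_in_subset[OF S] irreducible_in_subset[OF T] by (simp_all add: topspace_module_topology)
  have "irreducible_in (mt (e + f)) (\<Union>m\<in>S. mod_sum e m f ` T)"
  proof (rule irreducible_in_image2[OF S])
    show "continuous_map (mt e) (mt (e + f)) (\<lambda>m. mod_sum e m f n)" if "n \<in> T" for n
      using that sub by (intro continuous_mod_sum_left) auto
    show "irreducible_in (mt (e + f)) (mod_sum e m f ` T)" if "m \<in> S" for m
      using that sub by (intro irreducible_in_image[OF continuous_mod_sum_right T]) auto
  qed
  then show ?thesis unfolding sum_set_eq[OF sub] by (rule irreducible_conj)
qed

lemma component_conj_stable:
  assumes C: "irreducible_component (mt d) C" and m: "m \<in> C"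
  shows "conj_orbit d m \<subseteq> C"
proof -
  note irr = irreducible_component_irreducible[OF C]
  define R where "R = (\<Union>m\<in>C. (\<lambda>(g, h). conj_mod g h m) ` GL d)"
  have "C \<subseteq> R"
  proof
    fix x assume x: "x \<in> C"
    then have "x \<in> mv d" using irreducible_in_subset[OF irr] by (auto simp: topspace_module_topology)
    then have "conj_mod (1\<^sub>m d) (1\<^sub>m d) x = x"
      using left_mult_one_mat[OF module_varietyD(1)[of x scale d]]
        right_mult_one_mat[OF module_varietyD(1)[of x scale d]]
      by (simp add: conj_mod_def fun_eq_iff)
    then have "x = (\<lambda>(g, h). conj_mod g h x) (1\<^sub>m d, 1\<^sub>m d)" by simp
    then show "x \<in> R" unfolding R_def using x one_GL by blast
  qed
  then have "C = R"
    by (rule irreducible_component_maximal[OF C irreducible_conj[OF irr, folded R_def]])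
  moreover have "conj_orbit d m \<subseteq> R" unfolding conj_orbit_eq R_def using m by blast
  ultimately show ?thesis by simp
qed

lemma component_subset_mv: "irreducible_component (mt d) C \<Longrightarrow> C \<subseteq> mv d"
  using irreducible_in_subset[OF irreducible_component_irreducible] topspace_module_topology by metis

lemma component_iso_stable:
  assumes C: "irreducible_component (mt d) C" and m: "m \<in> C" and iso: "mod_iso d m e n"
  shows "n \<in> C"
proof -
  have "e = d" using mod_iso_dim[OF iso] ..
  moreover have "mat_family d m" using iso by (simp add: mod_iso_def)
  ultimately have "n \<in> conj_orbit d m" using iso mod_iso_iff_conj_orbit by metis
  then show ?thesis using component_conj_stable[OF C m] by auto
qed

lemma sum_set_closure:
  assumes S: "S \<subseteq> mv e" and T: "T \<subseteq> mv f"
  shows "sum_set e (top_closure (mt e) S) f (top_closure (mt f) T) \<subseteq>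
    top_closure (mt (e + f)) (sum_set e S f T)"
proof
  define K where "K = top_closure (mt (e + f)) (sum_set e S f T)"
  have K: "closedin (mt (e + f)) K" unfolding K_def by (rule closedin_closure_of)
  have cS: "top_closure (mt e) S \<subseteq> mv e" and cT: "top_closure (mt f) T \<subseteq> mv f"
    using closure_of_subset_topspace[of "mt e" S] closure_of_subset_topspace[of "mt f" T]
    by (simp_all add: topspace_module_topology)
  fix x assume "x \<in> sum_set e (top_closure (mt e) S) f (top_closure (mt f) T)"
  then obtain m n g h where m: "m \<in> top_closure (mt e) S" and n: "n \<in> top_closure (mt f) T"
    and gh: "(g, h) \<in> GL (e + f)" and x: "x = conj_mod g h (mod_sum e m f n)"
    by (rule sum_setE[OF _ cS cT])
  define \<phi> where "\<phi> m n = conj_mod g h (mod_sum e m f n)" for m n :: "'a \<Rightarrow> 'k mat"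
  have x_eq: "x = \<phi> m n" unfolding x \<phi>_def ..
  have cont: "continuous_map (mt (e + f)) (mt (e + f)) (conj_mod g h)"
    using gh by (rule continuous_conj_mod)
  have c1: "continuous_map (mt e) (mt (e + f)) (\<lambda>m. \<phi> m n)" if "n \<in> mv f" for n
    using continuous_map_compose[OF continuous_mod_sum_left[OF that] cont] by (simp add: \<phi>_def o_def)
  have c2: "continuous_map (mt f) (mt (e + f)) (\<phi> m)" if "m \<in> mv e" for m
    using continuous_map_compose[OF continuous_mod_sum_right[OF that] cont] by (simp add: \<phi>_def[abs_def] o_def)
  have "sum_set e S f T \<subseteq> K"
    unfolding K_def using sum_set_subset[OF S T]
    by (intro closure_of_subset) (simp add: topspace_module_topology)
  then have base: "\<phi> m n \<in> K" if "m \<in> S" "n \<in> T" for m n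
    using sum_setI[OF that gh S T] unfolding \<phi>_def by auto
  have step: "\<phi> m n \<in> K" if n': "n \<in> T" for n
  proof -
    have "n \<in> mv f" using n' T by auto
    then have "(\<lambda>m. \<phi> m n) ` top_closure (mt e) S \<subseteq> top_closure (mt (e + f)) ((\<lambda>m. \<phi> m n) ` S)"
      by (intro continuous_map_image_closure_subset c1)
    also have "\<dots> \<subseteq> K" using base n' by (intro closure_of_minimal K) auto
    finally show ?thesis using m by auto
  qed
  have "\<phi> m ` top_closure (mt f) T \<subseteq> top_closure (mt (e + f)) (\<phi> m ` T)"
    using m cS by (intro continuous_map_image_closure_subset c2) auto
  also have "\<dots> \<subseteq> K" using step by (intro closure_of_minimal K) auto
  finally show "x \<in> top_closure (mt (e + f)) (sum_set e S f T)" using n unfolding K_def x_eq by auto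
qed

definition list_sum :: "(nat \<times> ('a \<Rightarrow> 'k mat) set) list \<Rightarrow> ('a \<Rightarrow> 'k mat) set" where
  "list_sum Cs = {x. \<exists>ns. list_all2 (\<lambda>(e, D) (f, n). f = e \<and> n \<in> D) Cs ns \<and>
     mod_iso (total_dim ns) (total_sum ns) (sum_list (map fst Cs)) x}"

lemma list_sumE:
  assumes "x \<in> list_sum Cs"
  obtains ns where "list_all2 (\<lambda>(e, D) (f, n). f = e \<and> n \<in> D) Cs ns"
    "mod_iso (total_dim ns) (total_sum ns) (sum_list (map fst Cs)) x"
  using assms unfolding list_sum_def by (elim CollectE exE conjE)

lemma list_sumI:
  "list_all2 (\<lambda>(e, D) (f, n). f = e \<and> n \<in> D) Cs ns \<Longrightarrow>
    mod_iso (total_dim ns) (total_sum ns) (sum_list (map fst Cs)) x \<Longrightarrow> x \<in> list_sum Cs"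
  unfolding list_sum_def by (intro CollectI exI conjI)

definition mod_sets :: "(nat \<times> ('a \<Rightarrow> 'k mat) set) list \<Rightarrow> bool" where
  "mod_sets Cs \<longleftrightarrow> (\<forall>(e, D)\<in>set Cs. D \<subseteq> mv e)"

lemma mod_sets_simps [simp]:
  "mod_sets []" "mod_sets ((e, D) # Cs) \<longleftrightarrow> D \<subseteq> mv e \<and> mod_sets Cs"
  "mod_sets (Cs @ Ds) \<longleftrightarrow> mod_sets Cs \<and> mod_sets Ds"
  by (auto simp: mod_sets_def)

lemma total_module_variety:
  "(\<And>e n. (e, n) \<in> set ns \<Longrightarrow> n \<in> mv e) \<Longrightarrow> total_sum ns \<in> mv (total_dim ns)"
proof (induction ns)
  case Nil
  show ?case
    by (rule module_varietyI) (auto simp: total_dim_def total_sum_def direct_sum_def)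
next
  case (Cons z ns)
  obtain e n where z: "z = (e, n)" by (cases z)
  have n: "n \<in> mv e" and ns: "total_sum ns \<in> mv (total_dim ns)" using Cons by (simp_all add: z)
  show ?case
    using mod_sum_module_variety[OF n ns]
      total_Cons[OF module_variety_family[OF n] module_variety_family[OF ns]]
    by (simp add: z mod_sum_def)
qed

lemma list_all2_mv:
  assumes "list_all2 (\<lambda>(e, D) (f, n). f = e \<and> n \<in> D) Cs ns" "mod_sets Cs"
  shows "(e, n) \<in> set ns \<Longrightarrow> n \<in> mv e" "total_dim ns = sum_list (map fst Cs)"
proof -
  have "total_dim ns = sum_list (map fst Cs) \<and> (\<forall>(e, n)\<in>set ns. n \<in> mv e)"
    using assms by (induction rule: list_all2_induct) (auto simp: total_dim_def)
  then show "(e, n) \<in> set ns \<Longrightarrow> n \<in> mv e" "total_dim ns = sum_list (map fst Cs)" by auto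
qed

lemma list_all2_family:
  assumes "list_all2 (\<lambda>(e, D) (f, n). f = e \<and> n \<in> D) Cs ns" "mod_sets Cs"
  shows "mat_family (total_dim ns) (total_sum ns)"
  by (rule module_variety_family[of _ scale]) (rule total_module_variety, rule list_all2_mv(1)[OF assms])

lemma list_sum_subset:
  assumes "mod_sets Cs"
  shows "list_sum Cs \<subseteq> mv (sum_list (map fst Cs))"
proof
  fix x assume "x \<in> list_sum Cs"
  then obtain ns where ns: "list_all2 (\<lambda>(e, D) (f, n). f = e \<and> n \<in> D) Cs ns"
    and iso: "mod_iso (total_dim ns) (total_sum ns) (sum_list (map fst Cs)) x"
    by (rule list_sumE)
  show "x \<in> mv (sum_list (map fst Cs))"
    by (rule mod_iso_module_variety[OF total_module_variety iso]) (rule list_all2_mv[OF ns assms])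
qed

lemma list_sum_append:
  assumes Cs: "mod_sets Cs" and Ds: "mod_sets Ds"
  shows "list_sum (Cs @ Ds) =
    sum_set (sum_list (map fst Cs)) (list_sum Cs) (sum_list (map fst Ds)) (list_sum Ds)"
proof (intro Set.set_eqI iffI)
  fix x assume "x \<in> list_sum (Cs @ Ds)"
  then obtain ns where "list_all2 (\<lambda>(e, D) (f, n). f = e \<and> n \<in> D) (Cs @ Ds) ns"
    and iso: "mod_iso (total_dim ns) (total_sum ns) (sum_list (map fst (Cs @ Ds))) x"
    by (rule list_sumE)
  then obtain us vs where ns: "ns = us @ vs" and "length us = length Cs" "length vs = length Ds" and us: "list_all2 (\<lambda>(e, D) (f, n). f = e \<and> n \<in> D) Cs us"
    and vs: "list_all2 (\<lambda>(e, D) (f, n). f = e \<and> n \<in> D) Ds vs"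
    unfolding list_all2_append1 by (elim exE conjE)
  note fu = list_all2_family[OF us Cs]
  note fv = list_all2_family[OF vs Ds]
  note du = list_all2_mv(2)[OF us Cs] and dv = list_all2_mv(2)[OF vs Ds]
  have "total_sum us \<in> list_sum Cs"
    by (rule list_sumI[OF us]) (use mod_iso_refl[OF fu] du in simp)
  moreover have "total_sum vs \<in> list_sum Ds"
    by (rule list_sumI[OF vs]) (use mod_iso_refl[OF fv] dv in simp)
  ultimately show "x \<in> sum_set (sum_list (map fst Cs)) (list_sum Cs) (sum_list (map fst Ds)) (list_sum Ds)"
    using iso unfolding ns total_sum_append[OF fu fv] total_dim_append sum_set_def du dv
    by (intro CollectI bexI[of _ "total_sum us"] bexI[of _ "total_sum vs"]) simp_all
next
  fix x assume "x \<in> sum_set (sum_list (map fst Cs)) (list_sum Cs) (sum_list (map fst Ds)) (list_sum Ds)"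
  then obtain y z where y: "y \<in> list_sum Cs" and z: "z \<in> list_sum Ds"
    and iso: "mod_iso (sum_list (map fst Cs) + sum_list (map fst Ds))
      (mod_sum (sum_list (map fst Cs)) y (sum_list (map fst Ds)) z) (sum_list (map fst Cs) + sum_list (map fst Ds)) x"
    unfolding sum_set_def by (elim CollectE bexE)
  obtain us where us: "list_all2 (\<lambda>(e, D) (f, n). f = e \<and> n \<in> D) Cs us"
    and iu: "mod_iso (total_dim us) (total_sum us) (sum_list (map fst Cs)) y"
    using y by (rule list_sumE)
  obtain vs where vs: "list_all2 (\<lambda>(e, D) (f, n). f = e \<and> n \<in> D) Ds vs"
    and iv: "mod_iso (total_dim vs) (total_sum vs) (sum_list (map fst Ds)) z"
    using z by (rule list_sumE)
  note fu = list_all2_family[OF us Cs]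
  note fv = list_all2_family[OF vs Ds]
  have "mod_iso (total_dim (us @ vs)) (total_sum (us @ vs)) (sum_list (map fst (Cs @ Ds))) x"
    using mod_iso_trans[OF mod_iso_mod_sum[OF iu iv] iso]
    unfolding total_sum_append[OF fu fv] total_dim_append by simp
  moreover have "list_all2 (\<lambda>(e, D) (f, n). f = e \<and> n \<in> D) (Cs @ Ds) (us @ vs)"
    using us vs by (rule list_all2_appendI)
  ultimately show "x \<in> list_sum (Cs @ Ds)" by (intro list_sumI)
qed

lemma list_sum_single: "list_sum [(e, D)] = {x. \<exists>n\<in>D. mod_iso e n e x}"
  unfolding list_sum_def by (auto simp: list_all2_Cons1 total_dim_single total_sum_single)

lemma list_sum_Cons:
  assumes D: "D \<subseteq> mv e" and Cs: "mod_sets Cs"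
  shows "list_sum ((e, D) # Cs) = sum_set e D (sum_list (map fst Cs)) (list_sum Cs)"
proof -
  let ?f = "sum_list (map fst Cs)"
  have "list_sum ([(e, D)] @ Cs) = sum_set e (list_sum [(e, D)]) ?f (list_sum Cs)"
    using list_sum_append[of "[(e, D)]" Cs] D Cs by simp
  also have "\<dots> = sum_set e D ?f (list_sum Cs)"
  proof (intro equalityI)
    have "D \<subseteq> list_sum [(e, D)]" unfolding list_sum_single
      using D mod_iso_refl[OF module_variety_family] by blast
    then show "sum_set e D ?f (list_sum Cs) \<subseteq> sum_set e (list_sum [(e, D)]) ?f (list_sum Cs)"
      by (rule sum_set_mono) simp
    show "sum_set e (list_sum [(e, D)]) ?f (list_sum Cs) \<subseteq> sum_set e D ?f (list_sum Cs)"
    proof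
      fix x assume "x \<in> sum_set e (list_sum [(e, D)]) ?f (list_sum Cs)"
      then obtain n' n m where n: "n \<in> D" "mod_iso e n e n'" and m: "m \<in> list_sum Cs"
        and iso: "mod_iso (e + ?f) (mod_sum e n' ?f m) (e + ?f) x"
        unfolding sum_set_def list_sum_single by auto
      have "mat_family ?f m" using m list_sum_subset[OF Cs] module_variety_family by blast
      then have "mod_iso (e + ?f) (mod_sum e n ?f m) (e + ?f) x"
        by (intro mod_iso_trans[OF mod_iso_mod_sum[OF n(2) mod_iso_refl] iso])
      then show "x \<in> sum_set e D ?f (list_sum Cs)" unfolding sum_set_def using n(1) m by blast
    qed
  qed
  finally show ?thesis by simp
qed

lemma direct_sum_set_eq_list_sum:
  assumes "\<And>e D. (e, D) \<in> set Cs \<Longrightarrow> irreducible_component (mt e) D"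
  shows "direct_sum_set scale Cs = list_sum Cs"
proof -
  have ms: "mod_sets Cs" unfolding mod_sets_def by (auto dest: component_subset_mv[OF assms])
  have aux: "n \<in> mv e \<and> conj_orbit e n \<subseteq> D \<longleftrightarrow> n \<in> D" if "(e, D) \<in> set Cs"
    for e D and n :: "'a \<Rightarrow> 'k mat"
  proof
    assume n: "n \<in> mv e \<and> conj_orbit e n \<subseteq> D"
    then have fam: "mat_family e n" using module_variety_family[of n scale e] by simp
    have "n \<in> conj_orbit e n" using mod_iso_refl[OF fam] unfolding mod_iso_iff_conj_orbit[OF fam] .
    then show "n \<in> D" using n by auto
  next
    assume "n \<in> D"
    then show "n \<in> mv e \<and> conj_orbit e n \<subseteq> D"
      using component_subset_mv[OF assms[OF that]] component_conj_stable[OF assms[OF that]] by auto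
  qed
  have all2: "list_all2 (\<lambda>(e, D) n. n \<in> mv e \<and> conj_orbit e n \<subseteq> D) Cs ls \<longleftrightarrow>
    list_all2 (\<lambda>(e, D) (f, n). f = e \<and> n \<in> D) Cs (zip (map fst Cs) ls) \<and> length ls = length Cs" for ls
    unfolding list_all2_conv_all_nth using aux by (auto simp: split_beta)
  have zip_sum: "total_sum (zip (map fst Cs) ls) = direct_sum ls" "total_dim (zip (map fst Cs) ls) = sum_list (map fst Cs)"
    if "length ls = length Cs" for ls :: "('a \<Rightarrow> 'k mat) list"
    using that by (simp_all add: total_sum_def total_dim_def)
  let ?d = "sum_list (map fst Cs)"
  show ?thesis
  proof (intro Set.set_eqI iffI)
    fix x assume "x \<in> direct_sum_set scale Cs"
    then obtain ls where ls: "list_all2 (\<lambda>(e, D) n. n \<in> mv e \<and> conj_orbit e n \<subseteq> D) Cs ls"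
      and x: "x \<in> conj_orbit ?d (direct_sum ls)"
      unfolding direct_sum_set_def by blast
    define ns where "ns = zip (map fst Cs) ls"
    have ns: "list_all2 (\<lambda>(e, D) (f, n). f = e \<and> n \<in> D) Cs ns" and len: "length ls = length Cs"
      using ls unfolding all2 ns_def by auto
    have "mat_family ?d (direct_sum ls)"
      using list_all2_family[OF ns ms]
      unfolding ns_def zip_sum[OF len] by simp
    then have "mod_iso (total_dim ns) (total_sum ns) ?d x"
      using x unfolding ns_def zip_sum[OF len] by (simp add: mod_iso_iff_conj_orbit)
    then show "x \<in> list_sum Cs" by (rule list_sumI[OF ns])
  next
    fix x assume x: "x \<in> list_sum Cs"
    then obtain ns where ns: "list_all2 (\<lambda>(e, D) (f, n). f = e \<and> n \<in> D) Cs ns"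
      and iso: "mod_iso (total_dim ns) (total_sum ns) ?d x"
      by (rule list_sumE)
    define ls where "ls = map snd ns"
    have len: "length ls = length Cs" using list_all2_lengthD[OF ns] by (simp add: ls_def)
    have "map fst ns = map fst Cs"
      using ns by (induction rule: list_all2_induct) auto
    then have zip: "zip (map fst Cs) ls = ns" unfolding ls_def by (metis zip_map_fst_snd)
    have "list_all2 (\<lambda>(e, D) n. n \<in> mv e \<and> conj_orbit e n \<subseteq> D) Cs ls"
      unfolding all2 zip using ns len by simp
    moreover have "x \<in> conj_orbit ?d (direct_sum ls)"
    proof -
      have "mod_iso ?d (direct_sum ls) ?d x" using iso zip_sum[OF len] unfolding zip by simp
      moreover from this have "mat_family ?d (direct_sum ls)" by (simp add: mod_iso_def)
      ultimately show ?thesis using mod_iso_iff_conj_orbit by metis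
    qed
    moreover have "x \<in> mv ?d" using x list_sum_subset[OF ms] by auto
    ultimately show "x \<in> direct_sum_set scale Cs" unfolding direct_sum_set_def by blast
  qed
qed

lemma list_sum_dense:
  assumes "list_all2 (\<lambda>(e, D) (f, W). f = e \<and> D \<subseteq> mv e \<and> W \<subseteq> D \<and> D \<subseteq> top_closure (mt e) W) Cs Ws"
  shows "mod_sets Cs \<and> mod_sets Ws \<and> map fst Ws = map fst Cs \<and> list_sum Ws \<subseteq> list_sum Cs \<and>
    list_sum Cs \<subseteq> top_closure (mt (sum_list (map fst Cs))) (list_sum Ws)"
  using assms
proof (induction rule: list_all2_induct)
  case Nil
  have "list_sum [] \<subseteq> topspace (mt 0)" using list_sum_subset[of "[]"] by (simp add: topspace_module_topology)
  then show ?case using closure_of_subset by simp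
next
  case (Cons z Cs w Ws)
  obtain e D where z: "z = (e, D)" by (cases z)
  obtain W where w: "w = (e, W)" and W: "D \<subseteq> mv e" "W \<subseteq> D" "D \<subseteq> top_closure (mt e) W"
    using Cons.hyps(1) unfolding z by (cases w) auto
  let ?f = "sum_list (map fst Cs)"
  have IH: "mod_sets Cs" "mod_sets Ws" "map fst Ws = map fst Cs" "list_sum Ws \<subseteq> list_sum Cs"
    "list_sum Cs \<subseteq> top_closure (mt ?f) (list_sum Ws)" using Cons.IH by auto
  have Wmv: "W \<subseteq> mv e" using W by auto
  have eqs: "list_sum (z # Cs) = sum_set e D ?f (list_sum Cs)" "list_sum (w # Ws) = sum_set e W ?f (list_sum Ws)"
    using list_sum_Cons[OF W(1) IH(1)] list_sum_Cons[OF Wmv IH(2)] IH(3) unfolding z w by simp_all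
  have "list_sum Ws \<subseteq> mv ?f" using list_sum_subset[OF IH(2)] IH(3) by simp
  from sum_set_mono[OF W(3) IH(5)] sum_set_closure[OF Wmv this]
  have "sum_set e D ?f (list_sum Cs) \<subseteq> top_closure (mt (e + ?f)) (sum_set e W ?f (list_sum Ws))"
    by (rule subset_trans)
  then show ?case using eqs sum_set_mono[OF W(2) IH(4)] W(1) Wmv IH(1-3) by (simp add: z w)
qed

end

context fg_alg_closed
begin

subsection \<open>Constructible sets of modules\<close>

lemma eval_mat_module:
  assumes m: "m \<in> mv d" and X: "\<And>a. a \<in> gens \<Longrightarrow> X a = m a" and t: "term_gens t \<subseteq> gens"
  shows "eval_mat d X t = m (eval_alg scale t)"
  using t by (induction t) (simp_all add: X module_varietyD[OF m])

lemma ex_alg_term: "\<exists>t. term_gens t \<subseteq> gens \<and> eval_alg scale t = a"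
proof -
  have "a \<in> generated_subalgebra scale gens" by (simp add: generated_gens)
  then show ?thesis
  proof induction
    case (gen x)
    then show ?case by (intro exI[of _ "Gen x"]) simp
  next
    case one
    show ?case by (intro exI[of _ One]) simp
  next
    case (add x y)
    then obtain s t where "term_gens s \<subseteq> gens" "eval_alg scale s = x" "term_gens t \<subseteq> gens" "eval_alg scale t = y"
      by (elim exE conjE)
    then show ?case by (intro exI[of _ "Plus s t"]) simp
  next
    case (mult x y)
    then obtain s t where "term_gens s \<subseteq> gens" "eval_alg scale s = x" "term_gens t \<subseteq> gens" "eval_alg scale t = y"
      by (elim exE conjE)
    then show ?case by (intro exI[of _ "Times s t"]) simp
  next
    case (scale x c)
    then obtain t where "term_gens t \<subseteq> gens" "eval_alg scale t = x" by (elim exE conjE)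
    then show ?case by (intro exI[of _ "Scale c t"]) simp
  qed
qed

lemma poly_mat_eval:
  "term_gens t \<subseteq> gens \<Longrightarrow> poly_mat (ci d) d d (\<lambda>x. eval_mat d (coord_mat d x) t)"
proof (induction t)
  case (Gen a)
  then show ?case by (simp add: poly_mat_coord_mat)
next
  case One
  show ?case by (simp add: poly_mat_const)
next
  case (Plus s t)
  then show ?case by (simp add: poly_mat_add)
next
  case (Times s t)
  then show ?case by (simp add: poly_mat_mult)
next
  case (Scale c t)
  then show ?case by (simp add: poly_mat_smult)
qed

lemma module_point_iff:
  "(\<exists>m\<in>mv d. \<forall>i\<in>ci d. x i = gv d m i) \<longleftrightarrow>
   (\<forall>s t. term_gens s \<subseteq> gens \<longrightarrow> term_gens t \<subseteq> gens \<longrightarrow> eval_alg scale s = eval_alg scale t \<longrightarrow>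
      eval_mat d (coord_mat d x) s = eval_mat d (coord_mat d x) t)" (is "?L \<longleftrightarrow> ?R")
proof
  assume ?L
  then obtain m where m: "m \<in> mv d" "\<forall>i\<in>ci d. x i = gv d m i" ..
  have X: "coord_mat d x a = m a" if "a \<in> gens" for a
  proof -
    have "coord_mat d x a = coord_mat d (gv d m) a"
      using m(2) that by (intro eq_matI) (auto simp: coord_mat_def coord_index_def)
    then show ?thesis using coord_mat_gv[OF m(1) that] by simp
  qed
  show ?R
  proof (intro allI impI)
    fix s t assume st: "term_gens s \<subseteq> gens" "term_gens t \<subseteq> gens" "eval_alg scale s = eval_alg scale t"
    have "eval_mat d (coord_mat d x) s = m (eval_alg scale s)" by (rule eval_mat_module[OF m(1) X st(1)])
    also have "\<dots> = eval_mat d (coord_mat d x) t"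
      unfolding st(3) by (rule eval_mat_module[OF m(1) X st(2), symmetric])
    finally show "eval_mat d (coord_mat d x) s = eval_mat d (coord_mat d x) t" .
  qed
next
  assume R: ?R
  have "\<forall>a. \<exists>t. term_gens t \<subseteq> gens \<and> eval_alg scale t = a" by (rule allI, rule ex_alg_term)
  from choice[OF this] obtain t where t: "\<forall>a. term_gens (t a) \<subseteq> gens \<and> eval_alg scale (t a) = a" ..
  define m where "m a = eval_mat d (coord_mat d x) (t a)" for a
  have ev: "m (eval_alg scale s) = eval_mat d (coord_mat d x) s" if "term_gens s \<subseteq> gens" for s
    unfolding m_def by (rule R[rule_format, OF _ that]) (simp_all add: t)
  have "m \<in> mv d"
  proof (rule module_varietyI)
    show "m a \<in> carrier_mat d d" for a
      unfolding m_def by (rule poly_mat_carrier[OF poly_mat_eval]) (simp add: t)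
    show "m 1 = 1\<^sub>m d" using ev[of One] by simp
    show "m (a + b) = m a + m b" for a b using ev[of "Plus (t a) (t b)"] t by (simp add: m_def)
    show "m (a * b) = m a * m b" for a b using ev[of "Times (t a) (t b)"] t by (simp add: m_def)
    show "m (scale c a) = c \<cdot>\<^sub>m m a" for c a using ev[of "Scale c (t a)"] t by (simp add: m_def)
  qed
  moreover have "x i = gv d m i" if i: "i \<in> ci d" for i
  proof -
    obtain a j k where a: "i = (a, j, k)" "a \<in> gens" "j < d" "k < d" using i by (rule ciE)
    have "m a = coord_mat d x a" using ev[of "Gen a"] a(2) by simp
    then show ?thesis using i a by (simp add: gv_entry coord_mat_def)
  qed
  ultimately show ?L by (intro bexI[of _ m] ballI)
qed

lemma constructible_module_points:
  obtains P where "constructible (ci d) P" "\<forall>x. P x \<longleftrightarrow> (\<exists>m\<in>mv d. \<forall>i\<in>ci d. x i = gv d m i)"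
proof -
  define Z where "Z = {(s, t, i, j). term_gens s \<subseteq> gens \<and> term_gens t \<subseteq> gens \<and>
     eval_alg scale s = eval_alg scale t \<and> i < d \<and> j < d}"
  define h where "h = (\<lambda>(s, t, i, j) x. eval_mat d (coord_mat d x) s $$ (i, j) - eval_mat d (coord_mat d x) t $$ (i, j))"
  have "h ` Z \<subseteq> poly_fun (ci d)"
  proof
    fix f assume "f \<in> h ` Z"
    then obtain z where z: "f = h z" "z \<in> Z" by (rule imageE)
    obtain s t i j where stij: "z = (s, t, i, j)" by (cases z)
    have st: "term_gens s \<subseteq> gens" "term_gens t \<subseteq> gens" "i < d" "j < d" using z(2) by (auto simp: Z_def stij)
    show "f \<in> poly_fun (ci d)"
      unfolding z(1) h_def stij prod.case
      by (intro poly_fun_diff poly_mat_entry[OF poly_mat_eval] st)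
  qed
  note hZ = this
  obtain F where F: "F \<subseteq> h ` Z" "finite F" "\<forall>x. (\<forall>f\<in>h ` Z. f x = 0) \<longleftrightarrow> (\<forall>f\<in>F. f x = 0)"
    by (rule finite_equations[OF finite_ci hZ]) (rule that, assumption, assumption, simp only: simp_thms)
  have "constructible (ci d) (\<lambda>x. \<forall>f\<in>F. f x = 0)"
  proof (rule constructible_ball[OF F(2)])
    show "constructible (ci d) (\<lambda>x. f x = 0)" if "f \<in> F" for f
      using that F(1) \<open>h ` Z \<subseteq> poly_fun (ci d)\<close> by (intro constructible.zero) auto
  qed
  moreover have "(\<forall>f\<in>F. f x = 0) \<longleftrightarrow> (\<exists>m\<in>mv d. \<forall>i\<in>ci d. x i = gv d m i)" for x
  proof -
    have "(\<forall>f\<in>h ` Z. f x = 0) \<longleftrightarrow>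
      (\<forall>s t. term_gens s \<subseteq> gens \<longrightarrow> term_gens t \<subseteq> gens \<longrightarrow> eval_alg scale s = eval_alg scale t \<longrightarrow>
      eval_mat d (coord_mat d x) s = eval_mat d (coord_mat d x) t)" (is "?A \<longleftrightarrow> ?B")
    proof
      assume A: ?A
      show ?B
      proof (intro allI impI)
        fix s t assume st: "term_gens s \<subseteq> gens" "term_gens t \<subseteq> gens" "eval_alg scale s = eval_alg scale t"
        note c1 = carrier_matD[OF poly_mat_carrier[OF poly_mat_eval[OF st(1)]]]
        note c2 = carrier_matD[OF poly_mat_carrier[OF poly_mat_eval[OF st(2)]]]
        show "eval_mat d (coord_mat d x) s = eval_mat d (coord_mat d x) t"
        proof (rule eq_matI)
          fix i j assume "i < dim_row (eval_mat d (coord_mat d x) t)" "j < dim_col (eval_mat d (coord_mat d x) t)"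
          then have "(s, t, i, j) \<in> Z" using st by (simp add: Z_def c2)
          from imageI[OF this, of h] have "h (s, t, i, j) x = 0" by (rule A[rule_format])
          then show "eval_mat d (coord_mat d x) s $$ (i, j) = eval_mat d (coord_mat d x) t $$ (i, j)"
            by (simp add: h_def)
        qed (simp_all add: c1 c2)
      qed
    next
      assume B: ?B
      show ?A
      proof
        fix f assume "f \<in> h ` Z"
        then obtain z where z: "f = h z" "z \<in> Z" by (rule imageE)
        obtain s t i j where stij: "z = (s, t, i, j)" by (cases z)
        have "eval_mat d (coord_mat d x) s = eval_mat d (coord_mat d x) t"
          by (rule B[rule_format]) (use z(2) in \<open>simp_all add: Z_def stij\<close>)
        then show "f x = 0" by (simp add: z(1) h_def stij)
      qed
    qed
    then show ?thesis unfolding F(3)[rule_format, symmetric] module_point_iff .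
  qed
  ultimately show thesis using that[of "\<lambda>x. \<forall>f\<in>F. f x = 0"] by simp
qed

definition constructible_set :: "nat \<Rightarrow> ('a \<Rightarrow> 'k mat) set \<Rightarrow> bool" where
  "constructible_set d S \<longleftrightarrow> S \<subseteq> mv d \<and>
     (\<exists>P. constructible (ci d) P \<and> (\<forall>x. P x \<longleftrightarrow> (\<exists>m\<in>S. \<forall>i\<in>ci d. x i = gv d m i)))"

lemma constructible_setE:
  assumes "constructible_set d S"
  obtains P where "S \<subseteq> mv d" "constructible (ci d) P" "\<forall>x. P x \<longleftrightarrow> (\<exists>m\<in>S. \<forall>i\<in>ci d. x i = gv d m i)"
  using assms unfolding constructible_set_def by (elim conjE exE)

lemma constructible_set_Collect:
  assumes Q: "constructible (ci d) Q"
  shows "constructible_set d {m \<in> mv d. Q (gv d m)}"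
proof -
  obtain P where P: "constructible (ci d) P" "\<forall>x. P x \<longleftrightarrow> (\<exists>m\<in>mv d. \<forall>i\<in>ci d. x i = gv d m i)"
    by (rule constructible_module_points)
  have "P x \<and> Q x \<longleftrightarrow> (\<exists>m\<in>{m \<in> mv d. Q (gv d m)}. \<forall>i\<in>ci d. x i = gv d m i)" for x
  proof -
    have Q_iff: "Q x = Q (gv d m)" if "\<forall>i\<in>ci d. x i = gv d m i" for m
      by (rule constructible_cong_on[OF Q]) (use that in simp)
    show ?thesis
    proof
      assume "P x \<and> Q x"
      then obtain m where m: "m \<in> mv d" "\<forall>i\<in>ci d. x i = gv d m i" using P(2) by auto
      then have "Q (gv d m)" using Q_iff[OF m(2)] \<open>P x \<and> Q x\<close> by simp
      then have "m \<in> {m \<in> mv d. Q (gv d m)}" using m(1) by (intro CollectI conjI)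
      with m(2) show "\<exists>m\<in>{m \<in> mv d. Q (gv d m)}. \<forall>i\<in>ci d. x i = gv d m i" by (rule bexI)
    next
      assume "\<exists>m\<in>{m \<in> mv d. Q (gv d m)}. \<forall>i\<in>ci d. x i = gv d m i"
      then obtain m where m: "m \<in> mv d" "Q (gv d m)" "\<forall>i\<in>ci d. x i = gv d m i" by auto
      from m(3,1) have "\<exists>m\<in>mv d. \<forall>i\<in>ci d. x i = gv d m i" by (rule bexI)
      then have "P x" using P(2) by simp
      then show "P x \<and> Q x" using Q_iff[OF m(3)] m(2) by simp
    qed
  qed
  then show ?thesis
    unfolding constructible_set_def
    by (intro conjI exI[of _ "\<lambda>x. P x \<and> Q x"] constructible.conj P(1) Q allI) (rule Collect_restrict)
qed

lemma closed_constructible: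
  assumes "closedin (mt d) Z"
  obtains Q where "constructible (ci d) Q" "Z = {m \<in> mv d. Q (gv d m)}"
proof -
  obtain F where F: "F \<subseteq> poly_fun (ci d)" "Z = {m \<in> mv d. \<forall>f\<in>F. f (gv d m) = 0}"
    using assms unfolding closedin_mt by auto
  obtain F0 where F0: "F0 \<subseteq> F" "finite F0" "\<forall>x. (\<forall>f\<in>F. f x = 0) \<longleftrightarrow> (\<forall>f\<in>F0. f x = 0)"
    by (rule finite_equations[OF finite_ci F(1)]) (rule that, assumption, assumption, simp only: simp_thms)
  have "constructible (ci d) (\<lambda>x. \<forall>f\<in>F0. f x = 0)"
  proof (rule constructible_ball[OF F0(2)])
    show "constructible (ci d) (\<lambda>x. f x = 0)" if "f \<in> F0" for f
      using that F0(1) F(1) by (intro constructible.zero) auto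
  qed
  moreover have "Z = {m \<in> mv d. \<forall>f\<in>F0. f (gv d m) = 0}" by (simp add: F(2) F0(3))
  ultimately show thesis by (rule that)
qed

lemma constructible_set_open_Int_closed:
  assumes V: "openin (mt d) V" and C: "closedin (mt d) C"
  shows "constructible_set d (V \<inter> C)"
proof -
  have "closedin (mt d) (topspace (mt d) - V)" using V by auto
  then obtain Q where Q: "constructible (ci d) Q" "topspace (mt d) - V = {m \<in> mv d. Q (gv d m)}"
    by (rule closed_constructible)
  obtain R where R: "constructible (ci d) R" "C = {m \<in> mv d. R (gv d m)}"
    using C by (rule closed_constructible)
  have "V = topspace (mt d) - {m \<in> mv d. Q (gv d m)}" unfolding Q(2)[symmetric] using openin_subset[OF V] by blast
  then have "V \<inter> C = {m \<in> mv d. \<not> Q (gv d m) \<and> R (gv d m)}"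
    unfolding R(2) topspace_module_topology by auto
  then show ?thesis
    using constructible_set_Collect[of d "\<lambda>x. \<not> Q x \<and> R x"] constructible.conj[OF constructible.neg[OF Q(1)] R(1)]
    by simp
qed

lemma constructible_set_sum_set:
  assumes S: "constructible_set e S" and T: "constructible_set f T"
  shows "constructible_set (e + f) (sum_set e S f T)"
proof -
  obtain A where SA: "S \<subseteq> mv e" "constructible (ci e) A" "\<forall>x. A x \<longleftrightarrow> (\<exists>m\<in>S. \<forall>i\<in>ci e. x i = gv e m i)"
    using S by (rule constructible_setE)
  obtain B where TB: "T \<subseteq> mv f" "constructible (ci f) B" "\<forall>x. B x \<longleftrightarrow> (\<exists>m\<in>T. \<forall>i\<in>ci f. x i = gv f m i)"
    using T by (rule constructible_setE)
  define d where "d = e + f"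
  define K where "K = {..<d} \<times> {..<d}"
  define J :: "(('a \<times> nat \<times> nat) + ('a \<times> nat \<times> nat) + (nat \<times> nat) + nat \<times> nat) set"
    where "J = ci e <+> ci f <+> K <+> K"
  define xs where "xs y i = y (Inl i)" for y :: "('a \<times> nat \<times> nat) + ('a \<times> nat \<times> nat) + (nat \<times> nat) + nat \<times> nat \<Rightarrow> 'k" and i
  define xt where "xt y i = y (Inr (Inl i))" for y :: "('a \<times> nat \<times> nat) + ('a \<times> nat \<times> nat) + (nat \<times> nat) + nat \<times> nat \<Rightarrow> 'k" and i
  define g where "g y = mat d d (\<lambda>(i, j). y (Inr (Inr (Inl (i, j)))))"
    for y :: "('a \<times> nat \<times> nat) + ('a \<times> nat \<times> nat) + (nat \<times> nat) + nat \<times> nat \<Rightarrow> 'k"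
  define h where "h y = mat d d (\<lambda>(i, j). y (Inr (Inr (Inr (i, j)))))"
    for y :: "('a \<times> nat \<times> nat) + ('a \<times> nat \<times> nat) + (nat \<times> nat) + nat \<times> nat \<Rightarrow> 'k"
  define \<phi> where "\<phi> y v = (g y * four_block_mat (coord_mat e (xs y) (fst v)) (0\<^sub>m e f) (0\<^sub>m f e)
    (coord_mat f (xt y) (fst v)) * h y) $$ snd v" for y and v :: "'a \<times> nat \<times> nat"
  define P where "P y \<longleftrightarrow> A (xs y) \<and> B (xt y) \<and> (\<forall>z\<in>K. (g y * h y) $$ z = 1\<^sub>m d $$ z)" for y
  have finJ: "finite J" by (simp add: J_def K_def finite_ci)
  have g: "poly_mat J d d g" and h: "poly_mat J d d h"
    unfolding g_def h_def by (rule poly_mat_coords; auto simp: J_def K_def)+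
  have cs: "poly_mat J e e (\<lambda>y. coord_mat e (xs y) a)" and ct: "poly_mat J f f (\<lambda>y. coord_mat f (xt y) a)"
    if "a \<in> gens" for a
    unfolding coord_mat_def xs_def xt_def using that
    by (rule_tac poly_mat_coords; auto simp: J_def coord_index_def)+
  have entry: "(\<lambda>y. (g y * h y) $$ z) \<in> poly_fun J" if "z \<in> K" for z
  proof -
    obtain i j where z: "z = (i, j)" by (cases z)
    with that have "i < d" "j < d" by (simp_all add: K_def)
    then show ?thesis unfolding z by (intro poly_mat_entry[OF poly_mat_mult[OF g h]])
  qed
  have P: "constructible J P"
    unfolding P_def
  proof (intro constructible.conj)
    show "constructible J (\<lambda>y. A (xs y))"
      by (rule constructible_subst[OF SA(2)]) (auto simp: xs_def J_def intro: poly_fun.coord)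
    show "constructible J (\<lambda>y. B (xt y))"
      by (rule constructible_subst[OF TB(2)]) (auto simp: xt_def J_def intro: poly_fun.coord)
    show "constructible J (\<lambda>y. \<forall>z\<in>K. (g y * h y) $$ z = 1\<^sub>m d $$ z)"
    proof (rule constructible_ball)
      show "constructible J (\<lambda>y. (g y * h y) $$ z = 1\<^sub>m d $$ z)" if "z \<in> K" for z
        by (rule constructible_eq[OF entry[OF that] poly_fun.const])
    qed (simp add: K_def)
  qed
  have \<phi>: "(\<lambda>y. \<phi> y v) \<in> poly_fun J" if v: "v \<in> ci d" for v
  proof -
    obtain a i j where a: "v = (a, i, j)" "a \<in> gens" "i < d" "j < d" using v by (rule ciE)
    show ?thesis unfolding \<phi>_def a(1) fst_conv snd_conv
      by (rule poly_mat_entry[OF poly_mat_mult[OF poly_mat_mult[OF g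
              poly_mat_diag[OF cs[OF a(2)] ct[OF a(2)], folded d_def]] h] a(3,4)])
  qed
  have "(\<exists>y. P y \<and> (\<forall>i\<in>ci d. x i = \<phi> y i)) \<longleftrightarrow> (\<exists>z\<in>sum_set e S f T. \<forall>i\<in>ci d. x i = gv d z i)" for x
  proof
    assume "\<exists>y. P y \<and> (\<forall>i\<in>ci d. x i = \<phi> y i)"
    then obtain y where y: "P y" "\<forall>i\<in>ci d. x i = \<phi> y i" by (elim exE conjE)
    from y(1) SA(3) obtain m where m: "m \<in> S" "\<forall>i\<in>ci e. xs y i = gv e m i" unfolding P_def by auto
    from y(1) TB(3) obtain n where n: "n \<in> T" "\<forall>i\<in>ci f. xt y i = gv f n i" unfolding P_def by auto
    have gc: "g y \<in> carrier_mat d d" and hc: "h y \<in> carrier_mat d d" by (simp_all add: g_def h_def)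
    have "g y * h y = 1\<^sub>m d"
    proof (rule eq_matI)
      fix i j assume "i < dim_row (1\<^sub>m d :: 'k mat)" "j < dim_col (1\<^sub>m d :: 'k mat)"
      then have "(i, j) \<in> K" by (simp add: K_def)
      then show "(g y * h y) $$ (i, j) = 1\<^sub>m d $$ (i, j)" using y(1) unfolding P_def by blast
    qed (use gc hc in auto)
    then have gh: "(g y, h y) \<in> GL (e + f)"
      using gc hc mat_mult_left_right_inverse[OF gc hc] by (simp add: GL_def d_def)
    have cm: "coord_mat e (xs y) a = m a" if "a \<in> gens" for a
    proof -
      have "coord_mat e (xs y) a = coord_mat e (gv e m) a"
        using m(2) that by (intro eq_matI) (auto simp: coord_mat_def coord_index_def)
      then show ?thesis using coord_mat_gv[of m e a] m(1) SA(1) that by auto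
    qed
    have cn: "coord_mat f (xt y) a = n a" if "a \<in> gens" for a
    proof -
      have "coord_mat f (xt y) a = coord_mat f (gv f n) a"
        using n(2) that by (intro eq_matI) (auto simp: coord_mat_def coord_index_def)
      then show ?thesis using coord_mat_gv[of n f a] n(1) TB(1) that by auto
    qed
    have "x i = gv d (conj_mod (g y) (h y) (mod_sum e m f n)) i" if i: "i \<in> ci d" for i
    proof -
      obtain a j k where a: "i = (a, j, k)" "a \<in> gens" using i by (rule ciE)
      then show ?thesis using y(2) i cm cn by (simp add: \<phi>_def gv_entry conj_mod_def mod_sum_def)
    qed
    then show "\<exists>z\<in>sum_set e S f T. \<forall>i\<in>ci d. x i = gv d z i"
      using sum_setI[OF m(1) n(1) gh SA(1) TB(1)] by (intro bexI ballI)
  next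
    assume "\<exists>z\<in>sum_set e S f T. \<forall>i\<in>ci d. x i = gv d z i"
    then obtain z where z: "z \<in> sum_set e S f T" "\<forall>i\<in>ci d. x i = gv d z i" ..
    obtain m n G H where m: "m \<in> S" and n: "n \<in> T" and GH: "(G, H) \<in> GL (e + f)"
      and zeq: "z = conj_mod G H (mod_sum e m f n)"
      using sum_setE[OF z(1) SA(1) TB(1)] .
    note gl = GL_D[OF GH, folded d_def]
    define y where "y = case_sum (gv e m) (case_sum (gv f n) (case_sum (\<lambda>p. G $$ p) (\<lambda>p. H $$ p)))"
    have gy: "g y = G" unfolding g_def y_def by (rule eq_matI) (use gl in auto)
    have hy: "h y = H" unfolding h_def y_def by (rule eq_matI) (use gl in auto)
    have xsy: "xs y = gv e m" and xty: "xt y = gv f n" by (simp_all add: xs_def[abs_def] xt_def[abs_def] y_def)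
    have "P y" unfolding P_def gy hy gl(3) xsy xty using SA(3) TB(3) m n by auto
    moreover have "x i = \<phi> y i" if i: "i \<in> ci d" for i
    proof -
      obtain a j k where a: "i = (a, j, k)" "a \<in> gens" using i by (rule ciE)
      have "coord_mat e (gv e m) a = m a" "coord_mat f (gv f n) a = n a"
        using coord_mat_gv[of m e a] coord_mat_gv[of n f a] m n SA(1) TB(1) a(2) by auto
      then show ?thesis using z(2) i unfolding \<phi>_def gy hy xsy xty
        by (simp add: a zeq gv_entry conj_mod_def mod_sum_def)
    qed
    ultimately show "\<exists>y. P y \<and> (\<forall>i\<in>ci d. x i = \<phi> y i)" by (intro exI[of _ y] conjI ballI)
  qed
  moreover have "constructible (ci d) (\<lambda>x. \<exists>y. P y \<and> (\<forall>i\<in>ci d. x i = \<phi> y i))"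
    by (rule chevalley_image[OF finite_ci finJ P \<phi>])
  ultimately show ?thesis
    unfolding constructible_set_def d_def[symmetric]
    using sum_set_subset[OF SA(1) TB(1)] by (intro conjI exI allI) (simp_all add: d_def)
qed

lemma constructible_set_list_sum:
  assumes "\<And>e W. (e, W) \<in> set Ws \<Longrightarrow> constructible_set e W"
  shows "mod_sets Ws \<and> constructible_set (sum_list (map fst Ws)) (list_sum Ws)"
  using assms
proof (induction Ws)
  case Nil
  have "list_sum [] = mv 0"
  proof
    show "list_sum [] \<subseteq> mv 0" using list_sum_subset[of "[]"] by simp
    show "mv 0 \<subseteq> list_sum []"
    proof
      fix m assume m: "m \<in> mv 0"
      have "total_sum [] a = m a" for a
        using module_varietyD(1)[OF m, of a] by (intro eq_matI) (auto simp: total_sum_def direct_sum_def)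
      then have "total_sum [] = m" ..
      then show "m \<in> list_sum []"
        using mod_iso_refl[OF module_variety_family[OF m]]
        by (intro list_sumI[of _ "[]"]) (simp_all add: total_dim_def)
    qed
  qed
  moreover have "constructible_set 0 (mv 0)"
    using constructible_set_Collect[OF constructible_const[of "ci 0" True]] by simp
  ultimately show ?case by simp
next
  case (Cons z Ws)
  obtain e W where z: "z = (e, W)" by (cases z)
  have IH: "mod_sets Ws" "constructible_set (sum_list (map fst Ws)) (list_sum Ws)" using Cons by auto
  have W: "constructible_set e W" using Cons.prems by (simp add: z)
  then have "W \<subseteq> mv e" by (simp add: constructible_set_def)
  then show ?case
    using constructible_set_sum_set[OF W IH(2)] list_sum_Cons[OF _ IH(1), of W e] IH(1) by (simp add: z)
qed

lemma constructible_generic: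
  assumes "constructible (ci d) P" and C: "irreducible_in (mt d) C"
  shows "\<exists>V. openin (mt d) V \<and> V \<inter> C \<noteq> {} \<and>
    ((\<forall>m\<in>V \<inter> C. P (gv d m)) \<or> (\<forall>m\<in>V \<inter> C. \<not> P (gv d m)))"
  using assms(1)
proof induction
  case (zero f)
  define V where "V = topspace (mt d) - {m \<in> mv d. \<forall>g\<in>{f}. g (gv d m) = 0}"
  have "closedin (mt d) {m \<in> mv d. \<forall>g\<in>{f}. g (gv d m) = 0}"
    unfolding closedin_mt using zero by (intro exI[of _ "{f}"]) simp
  then have V: "openin (mt d) V" unfolding V_def by auto
  have sub: "C \<subseteq> topspace (mt d)" by (rule irreducible_in_subset[OF C])
  show ?case
  proof (cases "V \<inter> C = {}")
    case True
    then have "\<forall>m\<in>topspace (mt d) \<inter> C. f (gv d m) = 0" using sub by (auto simp: V_def)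
    moreover have "topspace (mt d) \<inter> C \<noteq> {}" using sub irreducible_in_nonempty[OF C] by auto
    ultimately show ?thesis by (intro exI[of _ "topspace (mt d)"] conjI disjI1 openin_topspace)
  next
    case False
    moreover have "\<forall>m\<in>V \<inter> C. f (gv d m) \<noteq> 0" by (auto simp: V_def topspace_module_topology)
    ultimately show ?thesis using V by (intro exI[of _ V] conjI disjI2)
  qed
next
  case (neg P)
  then obtain V where "openin (mt d) V" "V \<inter> C \<noteq> {}"
    "(\<forall>m\<in>V \<inter> C. P (gv d m)) \<or> (\<forall>m\<in>V \<inter> C. \<not> P (gv d m))" by (elim exE conjE)
  then show ?case by (intro exI[of _ V] conjI) auto
next
  case (conj P Q)
  then obtain V W where V: "openin (mt d) V" "V \<inter> C \<noteq> {}"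
    "(\<forall>m\<in>V \<inter> C. P (gv d m)) \<or> (\<forall>m\<in>V \<inter> C. \<not> P (gv d m))"
    and W: "openin (mt d) W" "W \<inter> C \<noteq> {}"
    "(\<forall>m\<in>W \<inter> C. Q (gv d m)) \<or> (\<forall>m\<in>W \<inter> C. \<not> Q (gv d m))" by (elim exE conjE)
  have "openin (mt d) (V \<inter> W)" using V(1) W(1) by auto
  moreover have "V \<inter> W \<inter> C \<noteq> {}" by (rule irreducible_open_Int[OF C V(1,2) W(1,2)])
  moreover have "(\<forall>m\<in>V \<inter> W \<inter> C. P (gv d m) \<and> Q (gv d m)) \<or> (\<forall>m\<in>V \<inter> W \<inter> C. \<not> (P (gv d m) \<and> Q (gv d m)))"
    using V(3) W(3) by auto
  ultimately show ?case by (intro exI[of _ "V \<inter> W"] conjI)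
qed

lemma dense_constructible_contains_open:
  assumes C: "irreducible_in (mt d) C" and S: "constructible_set d S" and SC: "S \<subseteq> C"
    and dense: "C \<subseteq> top_closure (mt d) S"
  shows "\<exists>V. openin (mt d) V \<and> V \<inter> C \<noteq> {} \<and> V \<inter> C \<subseteq> S"
proof -
  obtain P where P: "S \<subseteq> mv d" "constructible (ci d) P" "\<forall>x. P x \<longleftrightarrow> (\<exists>m\<in>S. \<forall>i\<in>ci d. x i = gv d m i)"
    using S by (rule constructible_setE)
  have P_iff: "P (gv d m) \<longleftrightarrow> m \<in> S" if m: "m \<in> mv d" for m
  proof
    assume "P (gv d m)"
    then obtain n where n: "n \<in> S" "\<forall>i\<in>ci d. gv d m i = gv d n i" using P(3) by auto
    have "gv d m = gv d n"
    proof (rule ext)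
      show "gv d m i = gv d n i" for i using n(2) by (cases "i \<in> ci d") (auto simp: gen_values_def)
    qed
    then have "m = n" using gen_values_inj[OF generated_gens, of d] m n(1) P(1) by (auto dest: inj_onD)
    then show "m \<in> S" using n(1) by simp
  qed (use P(3) in auto)
  have sub: "C \<subseteq> mv d" using irreducible_in_subset[OF C] by (simp add: topspace_module_topology)
  obtain V where V: "openin (mt d) V" "V \<inter> C \<noteq> {}"
    "(\<forall>m\<in>V \<inter> C. P (gv d m)) \<or> (\<forall>m\<in>V \<inter> C. \<not> P (gv d m))"
    using constructible_generic[OF P(2) C] by (elim exE conjE)
  from V(3) show ?thesis
  proof
    assume "\<forall>m\<in>V \<inter> C. P (gv d m)"
    then have "V \<inter> C \<subseteq> S" using P_iff sub by auto
    with V(1,2) show ?thesis by (intro exI[of _ V] conjI)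
  next
    assume no: "\<forall>m\<in>V \<inter> C. \<not> P (gv d m)"
    then have "S \<subseteq> topspace (mt d) - V"
      using P_iff P(1) SC by (auto simp: topspace_module_topology)
    then have "top_closure (mt d) S \<subseteq> topspace (mt d) - V"
      using V(1) by (intro closure_of_minimal) auto
    then show ?thesis using dense V(2) by auto
  qed
qed

subsection \<open>Existence\<close>

lemma generic_decompositionD:
  assumes "generic_decomposition scale gens d C Cs"
  shows "sum_list (map fst Cs) = d" "mod_sets Cs" "C = top_closure (mt d) (list_sum Cs)"
    "(e, D) \<in> set Cs \<Longrightarrow> e \<ge> 1" "(e, D) \<in> set Cs \<Longrightarrow> irreducible_component (mt e) D"
    "(e, D) \<in> set Cs \<Longrightarrow> general_in (mt e) D (indecomposable scale e)"
proof -
  show comp: "(e, D) \<in> set Cs \<Longrightarrow> irreducible_component (mt e) D" for e D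
    using assms unfolding generic_decomposition_def by auto
  show "mod_sets Cs" unfolding mod_sets_def by (auto dest: component_subset_mv[OF comp])
  have "direct_sum_set scale Cs = list_sum Cs" by (rule direct_sum_set_eq_list_sum) (rule comp)
  then show "C = top_closure (mt d) (list_sum Cs)"
    using assms unfolding generic_decomposition_def by simp
  show "sum_list (map fst Cs) = d" "(e, D) \<in> set Cs \<Longrightarrow> e \<ge> 1"
    "(e, D) \<in> set Cs \<Longrightarrow> general_in (mt e) D (indecomposable scale e)"
    using assms unfolding generic_decomposition_def by auto
qed

lemma generic_decompositionI:
  assumes "sum_list (map fst Cs) = d" "C = top_closure (mt d) (list_sum Cs)"
    and "\<And>e D. (e, D) \<in> set Cs \<Longrightarrow> e \<ge> 1"
    and comp: "\<And>e D. (e, D) \<in> set Cs \<Longrightarrow> irreducible_component (mt e) D"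
    and "\<And>e D. (e, D) \<in> set Cs \<Longrightarrow> general_in (mt e) D (indecomposable scale e)"
  shows "generic_decomposition scale gens d C Cs"
proof -
  have "direct_sum_set scale Cs = list_sum Cs" by (rule direct_sum_set_eq_list_sum) (rule comp)
  then show ?thesis unfolding generic_decomposition_def using assms by (intro conjI) auto
qed

lemma component_cover:
  obtains \<K> where "\<forall>e. finite (\<K> e) \<and> (\<forall>K\<in>\<K> e. irreducible_component (mt e) K) \<and> mv e = \<Union>(\<K> e)"
proof -
  have "\<exists>\<K>. finite \<K> \<and> (\<forall>K\<in>\<K>. irreducible_component (mt e) K) \<and> mv e = \<Union>\<K>" for e
    using noetherian_component_cover[OF wf_closed_mt[of e]] unfolding topspace_module_topology by metis
  then have "\<forall>e. \<exists>\<K>. finite \<K> \<and> (\<forall>K\<in>\<K>. irreducible_component (mt e) K) \<and> mv e = \<Union>\<K>" ..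
  from choice[OF this] show thesis using that by blast
qed

lemma decomposable_mem_sum_set:
  assumes "d \<ge> 1" and m: "m \<in> mv d" and "\<not> indecomposable scale d m"
  obtains e f m1 m2 where "e \<ge> 1" "f \<ge> 1" "d = e + f" "m1 \<in> mv e" "m2 \<in> mv f"
    "mod_iso (e + f) (mod_sum e m1 f m2) (e + f) m"
proof -
  have "\<exists>e f m1 m2. e \<ge> 1 \<and> f \<ge> 1 \<and> d = e + f \<and> m1 \<in> mv e \<and> m2 \<in> mv f \<and>
      m \<in> conj_orbit d (direct_sum [m1, m2])"
    using assms(1,3) unfolding indecomposable_def de_Morgan_conj not_not by (elim disjE notE)
  then obtain e f m1 m2 where *: "e \<ge> 1" "f \<ge> 1" "d = e + f" "m1 \<in> mv e" "m2 \<in> mv f"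
    "m \<in> conj_orbit d (direct_sum [m1, m2])" by (elim exE conjE)
  have "direct_sum [m1, m2] = mod_sum e m1 f m2"
    using direct_sum_Cons[OF module_variety_family[OF *(4)], of f "[m2]"] module_variety_family[OF *(5)]
    by (simp add: direct_sum_single mod_sum_def)
  then have "mod_iso (e + f) (mod_sum e m1 f m2) (e + f) m"
    using *(3,6) mod_iso_iff_conj_orbit[OF module_variety_family[OF mod_sum_module_variety[OF *(4,5)]]] by simp
  with that * show thesis by simp
qed

lemma generic_decomposition_exists:
  assumes "d \<ge> 1" "irreducible_component (mt d) C"
  shows "\<exists>Cs. generic_decomposition scale gens d C Cs"
  using assms
proof (induction d arbitrary: C rule: less_induct)
  case (less d)
  note C = less.prems(2)
  note irrC = irreducible_component_irreducible[OF C]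
  obtain \<K> where K: "\<forall>e. finite (\<K> e) \<and> (\<forall>K\<in>\<K> e. irreducible_component (mt e) K) \<and> mv e = \<Union>(\<K> e)"
    by (rule component_cover)
  then have Kcomp: "irreducible_component (mt e) D" if "D \<in> \<K> e" for e D using that by simp
  define \<D> where "\<D> = (\<Union>e\<in>{1..<d}. (\<lambda>(E, F). top_closure (mt d) (sum_set e E (d - e) F)) ` (\<K> e \<times> \<K> (d - e)))"
  have fin: "finite \<D>" unfolding \<D>_def using K by (intro finite_UN_I finite_imageI finite_cartesian_product) simp_all
  have closed: "closedin (mt d) D" if "D \<in> \<D>" for D using that unfolding \<D>_def by auto
  show ?case
  proof (cases "C \<subseteq> \<Union>\<D>")
    case True
    obtain D where D: "D \<in> \<D>" "C \<subseteq> D" using irreducible_in_finite_cover[OF irrC fin closed True] by auto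
    obtain e E F where e: "1 \<le> e" "e < d" and E: "E \<in> \<K> e" and F: "F \<in> \<K> (d - e)"
      and D_eq: "D = top_closure (mt d) (sum_set e E (d - e) F)"
      using D(1) unfolding \<D>_def by auto
    define f where "f = d - e"
    have d: "d = e + f" and f: "1 \<le> f" "f < d" using e by (simp_all add: f_def)
    have F: "F \<in> \<K> f" and D_eq: "D = top_closure (mt (e + f)) (sum_set e E f F)"
      using F D_eq d unfolding f_def by simp_all
    have "irreducible_in (mt d) D"
      unfolding D_eq d
      by (intro irreducible_in_closure irreducible_sum_set irreducible_component_irreducible Kcomp E F)
    then have CD: "C = D" by (rule irreducible_component_maximal[OF C _ D(2)])
    obtain Es where Es: "generic_decomposition scale gens e E Es"
      using less.IH[OF e(2,1) Kcomp[OF E]] ..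
    obtain Fs where Fs: "generic_decomposition scale gens f F Fs"
      using less.IH[OF f(2,1) Kcomp[OF F]] ..
    note Es' = generic_decompositionD[OF Es] and Fs' = generic_decompositionD[OF Fs]
    have sum: "list_sum (Es @ Fs) = sum_set e (list_sum Es) f (list_sum Fs)"
      using list_sum_append[OF Es'(2) Fs'(2)] unfolding Es'(1) Fs'(1) .
    have subE: "list_sum Es \<subseteq> mv e" and subF: "list_sum Fs \<subseteq> mv f"
      using list_sum_subset[OF Es'(2)] list_sum_subset[OF Fs'(2)] unfolding Es'(1) Fs'(1) .
    have "C = top_closure (mt d) (list_sum (Es @ Fs))"
    proof
      have "sum_set e E f F \<subseteq> top_closure (mt d) (list_sum (Es @ Fs))"
        unfolding sum Es'(3) Fs'(3) d by (rule sum_set_closure[OF subE subF])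
      then show "C \<subseteq> top_closure (mt d) (list_sum (Es @ Fs))"
        unfolding CD D_eq d by (intro closure_of_minimal closedin_closure_of)
      have "list_sum Es \<subseteq> E" "list_sum Fs \<subseteq> F"
        unfolding Es'(3) Fs'(3) using subE subF
        by (auto intro!: closure_of_subset simp: topspace_module_topology)
      then show "top_closure (mt d) (list_sum (Es @ Fs)) \<subseteq> C"
        unfolding CD D_eq d sum by (intro closure_of_mono sum_set_mono)
    qed
    then have "generic_decomposition scale gens d C (Es @ Fs)"
      using Es'(1,4-6) Fs'(1,4-6) d by (intro generic_decompositionI) auto
    then show ?thesis ..
  next
    case False
    define V where "V = topspace (mt d) - \<Union>\<D>"
    have V: "openin (mt d) V" unfolding V_def using fin closed by (intro openin_diff closedin_Union) auto
    have sub: "C \<subseteq> mv d" by (rule component_subset_mv[OF C])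
    then have ne: "V \<inter> C \<noteq> {}" using False unfolding V_def topspace_module_topology by auto
    have "indecomposable scale d m" if m: "m \<in> V \<inter> C" for m
    proof (rule ccontr)
      assume dec: "\<not> indecomposable scale d m"
      have "m \<in> mv d" using m sub by auto
      then obtain e f m1 m2 where ef: "e \<ge> 1" "f \<ge> 1" "d = e + f" and m12: "m1 \<in> mv e" "m2 \<in> mv f"
        and iso: "mod_iso (e + f) (mod_sum e m1 f m2) (e + f) m"
        by (rule decomposable_mem_sum_set[OF less.prems(1) _ dec])
      have "\<exists>E\<in>\<K> e. m1 \<in> E" "\<exists>F\<in>\<K> f. m2 \<in> F" using m12 K by auto
      then obtain E F where E: "E \<in> \<K> e" "m1 \<in> E" and F: "F \<in> \<K> f" "m2 \<in> F" by auto
      have EF: "E \<subseteq> mv e" "F \<subseteq> mv f" using component_subset_mv[OF Kcomp] E(1) F(1) by auto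
      have "m \<in> sum_set e E f F" unfolding sum_set_def using E(2) F(2) iso by blast
      also have "sum_set e E f F \<subseteq> top_closure (mt d) (sum_set e E f F)"
        using sum_set_subset[OF EF] ef(3) by (intro closure_of_subset) (simp add: topspace_module_topology)
      finally have "m \<in> top_closure (mt d) (sum_set e E (d - e) F)" using ef(3) by simp
      moreover have "top_closure (mt d) (sum_set e E (d - e) F) \<in> \<D>"
        unfolding \<D>_def using ef E(1) F(1) by (intro UN_I[of e] image_eqI[of _ _ "(E, F)"]) auto
      ultimately show False using m unfolding V_def by auto
    qed
    then have gen: "general_in (mt d) C (indecomposable scale d)"
      unfolding general_in_irreducible_iff[OF irrC] using V ne by (intro exI[of _ V]) simp
    have "list_sum [(d, C)] = C"
    proof
      show "list_sum [(d, C)] \<subseteq> C" unfolding list_sum_single using component_iso_stable[OF C] by auto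
      show "C \<subseteq> list_sum [(d, C)]"
      proof
        fix m assume m: "m \<in> C"
        then have "mod_iso d m d m" using mod_iso_refl[OF module_variety_family] sub by auto
        with m show "m \<in> list_sum [(d, C)]" unfolding list_sum_single by (intro CollectI bexI[of _ m])
      qed
    qed
    then have "C = top_closure (mt d) (list_sum [(d, C)])"
      using closure_of_closedin[OF irreducible_component_closed[OF C]] by simp
    then have "generic_decomposition scale gens d C [(d, C)]"
      using less.prems gen by (intro generic_decompositionI) auto
    then show ?thesis ..
  qed
qed

subsection \<open>Uniqueness\<close>

lemma component_generic_open:
  assumes C: "irreducible_component (mt d) C" and gen: "general_in (mt d) C (indecomposable scale d)"
    and fin: "finite \<G>" and closed: "\<And>G. G \<in> \<G> \<Longrightarrow> closedin (mt d) G"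
  shows "\<exists>V. openin (mt d) V \<and> V \<inter> C \<noteq> {} \<and>
    (\<forall>m\<in>V \<inter> C. indecomposable scale d m \<and> (\<forall>G\<in>\<G>. m \<in> G \<longrightarrow> C \<subseteq> G))"
proof -
  note irr = irreducible_component_irreducible[OF C]
  obtain U where U: "openin (mt d) U" "U \<inter> C \<noteq> {}" "\<forall>m\<in>U \<inter> C. indecomposable scale d m"
    using gen unfolding general_in_irreducible_iff[OF irr] by (elim exE conjE)
  define \<H> where "\<H> = {G \<in> \<G>. \<not> C \<subseteq> G}"
  have H: "finite \<H>" "\<And>G. G \<in> \<H> \<Longrightarrow> closedin (mt d) G" using fin closed by (simp_all add: \<H>_def)
  define V where "V = U - \<Union>\<H>"
  have "openin (mt d) V" unfolding V_def using U(1) H by (intro openin_diff closedin_Union)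
  moreover have "V \<inter> C \<noteq> {}"
  proof
    assume "V \<inter> C = {}"
    then have "C \<subseteq> \<Union>(insert (topspace (mt d) - U) \<H>)"
      using irreducible_in_subset[OF irr] unfolding V_def by auto
    moreover have "finite (insert (topspace (mt d) - U) \<H>)" using H(1) by simp
    moreover have "closedin (mt d) G" if "G \<in> insert (topspace (mt d) - U) \<H>" for G
      using that H(2) U(1) by auto
    ultimately obtain G where "G \<in> insert (topspace (mt d) - U) \<H>" "C \<subseteq> G"
      using irreducible_in_finite_cover[OF irr] by meson
    then show False using U(2) unfolding \<H>_def by auto
  qed
  moreover have "\<forall>m\<in>V \<inter> C. indecomposable scale d m \<and> (\<forall>G\<in>\<G>. m \<in> G \<longrightarrow> C \<subseteq> G)"
    using U(3) unfolding V_def \<H>_def by auto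
  ultimately show ?thesis by (intro exI[of _ V] conjI)
qed

text \<open>The set of sums is dense in \<open>C\<close>, and constructible as the image of a constructible set.\<close>

lemma generic_list_sum:
  assumes C: "irreducible_component (mt d) C" and Cs: "generic_decomposition scale gens d C Cs"
    and V: "\<And>e D. (e, D) \<in> set Cs \<Longrightarrow> openin (mt e) (V e D) \<and> V e D \<inter> D \<noteq> {}"
  shows "\<exists>U. openin (mt d) U \<and> U \<inter> C \<noteq> {} \<and> U \<inter> C \<subseteq> list_sum (map (\<lambda>(e, D). (e, V e D \<inter> D)) Cs)"
proof -
  note D = generic_decompositionD[OF Cs]
  note irr = irreducible_component_irreducible[OF C]
  let ?Ws = "map (\<lambda>(e, D). (e, V e D \<inter> D)) Cs"
  have "list_all2 (\<lambda>(e, D) (f, W). f = e \<and> D \<subseteq> mv e \<and> W \<subseteq> D \<and> D \<subseteq> top_closure (mt e) W) Cs ?Ws"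
    unfolding list_all2_map2
  proof (rule list.rel_refl_strong)
    fix z assume z: "z \<in> set Cs"
    obtain e E where eE: "z = (e, E)" by (cases z)
    have comp: "irreducible_component (mt e) E" using D(5)[of e E] z by (simp add: eE)
    have "E \<subseteq> top_closure (mt e) (V e E \<inter> E)"
      using V[of e E] z irreducible_open_dense[OF irreducible_component_irreducible[OF comp]] by (simp add: eE)
    then show "(case z of (e, D) \<Rightarrow> \<lambda>(f, W). f = e \<and> D \<subseteq> mv e \<and> W \<subseteq> D \<and> D \<subseteq> top_closure (mt e) W)
        (case z of (e, D) \<Rightarrow> (e, V e D \<inter> D))"
      using component_subset_mv[OF comp] by (simp add: eE)
  qed
  from list_sum_dense[OF this] have dense: "map fst ?Ws = map fst Cs" "list_sum ?Ws \<subseteq> list_sum Cs"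
    "list_sum Cs \<subseteq> top_closure (mt d) (list_sum ?Ws)" unfolding D(1) by simp_all
  have con: "constructible_set e W" if "(e, W) \<in> set ?Ws" for e W
  proof -
    from that obtain E where E: "(e, E) \<in> set Cs" "W = V e E \<inter> E" by auto
    show ?thesis unfolding E(2)
      using V[OF E(1)] irreducible_component_closed[OF D(5)[OF E(1)]]
      by (intro constructible_set_open_Int_closed) simp_all
  qed
  have "constructible_set (sum_list (map fst ?Ws)) (list_sum ?Ws)"
    by (rule conjunct2[OF constructible_set_list_sum]) (rule con)
  then have con: "constructible_set d (list_sum ?Ws)" unfolding dense(1) D(1) .
  have "list_sum Cs \<subseteq> topspace (mt d)"
    using list_sum_subset[OF D(2)] D(1) by (simp add: topspace_module_topology)
  then have "list_sum Cs \<subseteq> C" unfolding D(3) by (rule closure_of_subset)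
  then have "list_sum ?Ws \<subseteq> C" using dense(2) by simp
  moreover have "C \<subseteq> top_closure (mt d) (list_sum ?Ws)"
    unfolding D(3) by (rule closure_of_minimal[OF dense(3) closedin_closure_of])
  ultimately show ?thesis by (rule dense_constructible_contains_open[OF irr con])
qed

lemma generic_decomposition_unique:
  assumes C: "irreducible_component (mt d) C"
    and Cs: "generic_decomposition scale gens d C Cs" and Ds: "generic_decomposition scale gens d C Ds"
  shows "mset Cs = mset Ds"
proof -
  note DC = generic_decompositionD[OF Cs] and DD = generic_decompositionD[OF Ds]
  note irr = irreducible_component_irreducible[OF C]
  define good where "good \<G> e D V \<longleftrightarrow> openin (mt e) V \<and> V \<inter> D \<noteq> {} \<and>
    (\<forall>m\<in>V \<inter> D. indecomposable scale e m \<and> (\<forall>G\<in>\<G>. m \<in> G \<longrightarrow> D \<subseteq> G))" for \<G> e D V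
  define \<G> where "\<G> e = {G. (e, G) \<in> set Ds}" for e
  have fin: "finite (\<G> e)" for e
  proof -
    have "\<G> e \<subseteq> snd ` set Ds" unfolding \<G>_def by force
    then show ?thesis by (rule finite_subset) simp
  qed
  define V where "V e D = (SOME V. good (\<G> e) e D V)" for e D
  have V: "good (\<G> e) e D (V e D)" if "(e, D) \<in> set Cs" for e D
    unfolding V_def good_def
    by (rule someI_ex, rule component_generic_open[OF DC(5)[OF that] DC(6)[OF that] fin])
      (simp add: \<G>_def irreducible_component_closed[OF DD(5)])
  define W where "W e D = (SOME V. good {} e D V)" for e D
  have W: "good {} e D (W e D)" if "(e, D) \<in> set Ds" for e D
    unfolding W_def good_def
    by (rule someI_ex, rule component_generic_open[OF DD(5)[OF that] DD(6)[OF that]]) simp_all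
  have VV: "openin (mt e) (V e D) \<and> V e D \<inter> D \<noteq> {}" if "(e, D) \<in> set Cs" for e D
    using V[OF that] unfolding good_def by simp
  have WW: "openin (mt e) (W e D) \<and> W e D \<inter> D \<noteq> {}" if "(e, D) \<in> set Ds" for e D
    using W[OF that] unfolding good_def by simp
  let ?Vs = "map (\<lambda>(e, D). (e, V e D \<inter> D)) Cs" and ?Ws = "map (\<lambda>(e, D). (e, W e D \<inter> D)) Ds"
  have "\<exists>A. openin (mt d) A \<and> A \<inter> C \<noteq> {} \<and> A \<inter> C \<subseteq> list_sum ?Vs"
    by (rule generic_list_sum[OF C Cs]) (rule VV)
  then obtain A where A: "openin (mt d) A" "A \<inter> C \<noteq> {}" "A \<inter> C \<subseteq> list_sum ?Vs"
    by (elim exE conjE)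
  have "\<exists>B. openin (mt d) B \<and> B \<inter> C \<noteq> {} \<and> B \<inter> C \<subseteq> list_sum ?Ws"
    by (rule generic_list_sum[OF C Ds]) (rule WW)
  then obtain B where B: "openin (mt d) B" "B \<inter> C \<noteq> {}" "B \<inter> C \<subseteq> list_sum ?Ws"
    by (elim exE conjE)
  obtain x where x: "x \<in> list_sum ?Vs" "x \<in> list_sum ?Ws"
    using irreducible_open_Int[OF irr A(1,2) B(1,2)] A(3) B(3) by auto
  have fsts: "map fst ?Vs = map fst Cs" "map fst ?Ws = map fst Ds" by (simp_all add: split_beta)
  obtain ms where ms: "list_all2 (\<lambda>(e, D) (f, n). f = e \<and> n \<in> D) ?Vs ms"
    and isom: "mod_iso (total_dim ms) (total_sum ms) (sum_list (map fst ?Vs)) x"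
    using x(1) by (rule list_sumE)
  obtain ns where ns: "list_all2 (\<lambda>(e, D) (f, n). f = e \<and> n \<in> D) ?Ws ns"
    and ison: "mod_iso (total_dim ns) (total_sum ns) (sum_list (map fst ?Ws)) x"
    using x(2) by (rule list_sumE)
  have iso: "mod_iso (total_dim ms) (total_sum ms) (total_dim ns) (total_sum ns)"
    using mod_iso_trans[OF isom mod_iso_sym] ison unfolding fsts DC(1) DD(1) by simp
  have ms': "list_all2 (\<lambda>(e, D) (f, n). f = e \<and> n \<in> V e D \<inter> D) Cs ms"
    using ms by (auto simp: list_all2_conv_all_nth split_beta)
  have ns': "list_all2 (\<lambda>(e, D) (f, n). f = e \<and> n \<in> W e D \<inter> D) Ds ns"
    using ns by (auto simp: list_all2_conv_all_nth split_beta)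
  have indm: "m \<in> mv e \<and> indecomposable scale e m" if em: "(e, m) \<in> set ms" for e m
  proof -
    obtain i where i: "i < length ms" "ms ! i = (e, m)" using em by (auto simp: in_set_conv_nth)
    obtain D where D: "Cs ! i = (e, D)" "m \<in> V e D \<inter> D"
      using list_all2_nthD2[OF ms' i(1)] unfolding i(2) by (cases "Cs ! i") auto
    have "(e, D) \<in> set Cs" using D(1) i(1) list_all2_lengthD[OF ms'] nth_mem by metis
    then show ?thesis using V[of e D] D(2) component_subset_mv[OF DC(5)[of e D]] unfolding good_def by auto
  qed
  have indn: "m \<in> mv e \<and> indecomposable scale e m" if em: "(e, m) \<in> set ns" for e m
  proof -
    obtain i where i: "i < length ns" "ns ! i = (e, m)" using em by (auto simp: in_set_conv_nth)
    obtain D where D: "Ds ! i = (e, D)" "m \<in> W e D \<inter> D"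
      using list_all2_nthD2[OF ns' i(1)] unfolding i(2) by (cases "Ds ! i") auto
    have "(e, D) \<in> set Ds" using D(1) i(1) list_all2_lengthD[OF ns'] nth_mem by metis
    then show ?thesis using W[of e D] D(2) component_subset_mv[OF DD(5)[of e D]] unfolding good_def by auto
  qed
  have "\<exists>ls. mset ls = mset ns \<and> list_all2 (\<lambda>(e, m) (f, n). mod_iso e m f n) ms ls"
    by (rule krull_remak_schmidt[of ms scale ns]) (rule indm, assumption, rule indn, assumption, rule iso)
  then obtain ls where ls: "mset ls = mset ns" "list_all2 (\<lambda>(e, m) (f, n). mod_iso e m f n) ms ls"
    by (elim exE conjE)
  have "list_all2 (\<lambda>(f, n) (e, D). f = e \<and> n \<in> D) ns Ds"
    using ns' by (auto simp: list_all2_conv_all_nth split_beta)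
  from list_all2_reorder_left_invariance[OF this ls(1)] obtain Es
    where Es: "list_all2 (\<lambda>(f, n) (e, D). f = e \<and> n \<in> D) ls Es" "mset Es = mset Ds" by (elim exE conjE)
  have len: "length Cs = length ms" "length ls = length ms" "length Es = length ms"
    using list_all2_lengthD[OF ms'] list_all2_lengthD[OF ls(2)] list_all2_lengthD[OF Es(1)] by simp_all
  have "Cs = Es"
  proof (rule nth_equalityI)
    show "length Cs = length Es" using len by simp
  next
    fix i assume "i < length Cs"
    then have i: "i < length ms" using len by simp
    obtain e D where D: "Cs ! i = (e, D)" by (cases "Cs ! i")
    obtain f D' where D': "Es ! i = (f, D')" by (cases "Es ! i")
    obtain m where m: "ms ! i = (e, m)" "m \<in> V e D \<inter> D"
      using list_all2_nthD2[OF ms' i] unfolding D by (cases "ms ! i") auto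
    obtain n where n: "ls ! i = (f, n)" "n \<in> D'"
      using list_all2_nthD[OF Es(1), of i] i unfolding D' by (cases "ls ! i") (auto simp: len)
    have mn: "mod_iso e m f n" using list_all2_nthD[OF ls(2) i] m(1) n(1) by simp
    have ef: "f = e" using mod_iso_dim[OF mn] by simp
    have "(e, D) \<in> set Cs" using D i len nth_mem by metis
    have "(f, D') \<in> set Es" using D' i len nth_mem by metis
    then have D'_mem: "(e, D') \<in> set Ds" using Es(2) ef mset_eq_setD by metis
    have "m \<in> D'" by (rule component_iso_stable[OF DD(5)[OF D'_mem] n(2)]) (use mod_iso_sym[OF mn] ef in simp)
    moreover have "D' \<in> \<G> e" using D'_mem by (simp add: \<G>_def)
    moreover have "\<forall>G\<in>\<G> e. m \<in> G \<longrightarrow> D \<subseteq> G"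
      using V[OF \<open>(e, D) \<in> set Cs\<close>] m(2) unfolding good_def by simp
    ultimately have "D \<subseteq> D'" by simp
    then have "D = D'"
      by (rule irreducible_component_maximal[OF DC(5)[OF \<open>(e, D) \<in> set Cs\<close>]
            irreducible_component_irreducible[OF DD(5)[OF D'_mem]]])
    then show "Cs ! i = Es ! i" unfolding D D' ef by (rule arg_cong)
  qed
  then show ?thesis using Es(2) by simp
qed

end

theorem theorem1p1:
  fixes scale :: "'k :: alg_closed_field \<Rightarrow> 'a :: {ring, monoid_mult} \<Rightarrow> 'a"
    and gens :: "'a set" and d :: nat and C :: "('a \<Rightarrow> 'k mat) set"
  assumes "fg_algebra scale gens"
    and "d \<ge> 1"
    and "irreducible_component (module_topology scale gens d) C"
  shows "(\<exists>Cs. generic_decomposition scale gens d C Cs) \<and>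
         (\<forall>Cs Cs'. generic_decomposition scale gens d C Cs \<longrightarrow>
            generic_decomposition scale gens d C Cs' \<longrightarrow> mset Cs = mset Cs')"
proof -
  have alg: "fg_alg_closed scale gens" by (rule fg_alg_closed.intro[OF assms(1)])
  show ?thesis
  proof (intro conjI allI impI)
    show "\<exists>Cs. generic_decomposition scale gens d C Cs"
      by (rule fg_alg_closed.generic_decomposition_exists[OF alg assms(2,3)])
    show "mset Cs = mset Cs'"
      if "generic_decomposition scale gens d C Cs" "generic_decomposition scale gens d C Cs'" for Cs Cs'
      by (rule fg_alg_closed.generic_decomposition_unique[OF alg assms(3) that])
  qed
qed

end
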